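(* For every simple multi-polytope $\mathcal P=(\Delta,\mathcal F)$, the Duistermaat-Heckman function and the winding number coincide: $\mathrm{DH}_{\mathcal P}=\mathrm{WN}_{\mathcal P}$ as functions on $V^*\setminus\bigcup_{i=1}^dF_i$.
   Context: **Multi-fans.** Let $N$ be a lattice of rank $n$ and $N_{\mathbb R}=N\otimes\mathbb R$. A cone in $N$ is a strongly convex rational polyhedral cone in $N_{\mathbb R}$ (the set of nonnegative real combinations of finitely many vectors of $N$, containing no line). $\mathrm{Cone}(N)$ is the set of all cones, partially ordered by $\tau\prec\sigma$ iff $\tau$ is a proper face of $\sigma$. A multi-fan of dimension $n$ in $N$ is a triple $\Delta=(\Sigma,C,w^{\pm})$ where $\Sigma$ is a finite partially ordered set with a unique minimum element $*$; $C:\Sigma\to\mathrm{Cone}(N)$ is a map with (1) $C( * )=\{0\}$, (2) $I<J$ implies $C(I)\prec C(J)$, (3) for each $J\in\Sigma$, $C$ restricts to an isomorphism of ordered sets from $\{I\in\Sigma: I\le J\}$ onto $\{\kappa\in\mathrm{Cone}(N):\kappa\preceq C(J)\}$; and, with $\Sigma^{(m)}=\{I\in\Sigma:\dim C(I)=m\}$ (write $|I|=m$ for $I\in\Sigma^{(m)}$), $w^+,w^-:\Sigma^{(n)}\to\mathbb Z_{\ge0}$ are functions such that $w^+(I)>0$ or $w^-(I)>0$ for each $I$. Put $w=w^+-w^-$. A vector $v\in N_{\mathbb R}$ is generic if it lies on no linear subspace spanned by a cone $C(I)$ of dimension $<n$. $\Delta$ is pre-complete if $\Sigma^{(n)}\ne\emptyset$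 and $d_v=\sum_{v\in C(I),\,I\in\Sigma^{(n)}}w(I)$ is independent of the generic vector $v$; this integer is $\deg(\Delta)$. For $K\in\Sigma$ the projected multi-fan $\Delta_K=(\Sigma_K,C_K,w_K^\pm)$ has $\Sigma_K=\{J\in\Sigma:K\le J\}$, $C_K(J)$ = the image of $C(J)$ in the quotient of $N_{\mathbb R}$ by the span of $C(K)$ (with lattice the quotient of $N$ by the subgroup generated by $C(K)\cap N$), and $w_K^\pm$ the restrictions of $w^\pm$. $\Delta$ is complete if $\Delta$ and all $\Delta_K$, $K\in\Sigma$, are pre-complete. $\Delta$ is simplicial if every $C(I)$ is generated by linearly independent vectors; then $\Sigma$ is identified with an augmented simplicial set (abstract simplicial complex including the empty set as minimum) of subsets of $\{1,\dots,d\}$ with $\Sigma^{(1)}=\{\{1\},\dots,\{d\}\}$, and $|I|$ is the cardinality of $I$. **Multi-polytopes.** Put $V=N_{\mathbb R}$, $V^*=\mathrm{Hom}(V,\mathbb R)$. A multi-polytope is a pair $\mathcal P=(\Delta,\mathcal F)$ where $\Delta$ is a complete multi-fan and $\mathcal F$ assigns to each $I\in\Sigma^{(1)}$ an affine hyperplane $\mathcal F(I)\subset V^*$ on which the elements of $C(I)$ are constant. It is simple if $\Delta$ is simplicial. For simple $\mathcal P$ let $v_i$ be a nonzero vector in $C(\{i\})$, $F_i=\mathcal F(\{i\})$, $F_I=\bigcap_{i\in I}F_i$. For $I\in\Sigma^{(n)}$, $F_I$ is a point $u_I$; let $\{u_i^I\}_{i\in I}\subset V^*$ be the basis dual to $\{v_i\}_{i\in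 I}$. **Duistermaat-Heckman function.** Fix a generic $v\in V$. For $I\in\Sigma^{(n)}$ put $(-1)^I=(-1)^{\sharp\{i\in I:\langle u_i^I,v\rangle>0\}}$, $(u_i^I)^+=u_i^I$ if $\langle u_i^I,v\rangle>0$ and $-u_i^I$ if $\langle u_i^I,v\rangle<0$; let $\phi_I$ be the characteristic function of the cone with apex $u_I$ spanned by the $(u_i^I)^+$, $i\in I$. Then $\mathrm{DH}_{\mathcal P}=\sum_{I\in\Sigma^{(n)}}(-1)^Iw(I)\phi_I$ on $V^*\setminus\bigcup_iF_i$ (it is independent of $v$). **Winding number.** Fix an orientation of $V$ and the dual orientation of $V^*$. For $I=\{i_1,\dots,i_n\}\in\Sigma^{(n)}$ let $\langle I\rangle=\langle i_1,\dots,i_n\rangle$ (oriented simplex) if $(v_{i_1},\dots,v_{i_n})$ is a positive basis and $\langle I\rangle=-\langle i_1,\dots,i_n\rangle$ otherwise. By completeness $\sum_{I\in\Sigma^{(n)}}w(I)\langle I\rangle$ is a cycle; its class is $[\Delta]\in\tilde H_{n-1}(\Sigma)$ (reduced homology). Let $S$ be the realization of the first barycentric subdivision of $\Sigma$, $S_i$ the union of the simplices of $S$ containing the vertex $\{i\}$, $S_I=\bigcap_{i\in I}S_i$. There is a continuous map $\Psi:S\to\bigcup_iF_i\subset V^*$ with $\Psi(S_I)\subset F_I$ for all nonempty $I\in\Sigma$, unique up to homotopy preserving these strata. For $u\in V^*\setminus\bigcup_iF_i$ let $[V^*\setminus\{u\}]\in\tilde H_{n-1}(V^*\setminus\{u\})$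 be the image of the fundamental class of $H_n(V^*,V^*\setminus\{u\})$ under the boundary isomorphism. The integer $\mathrm{WN}_{\mathcal P}(u)$ is defined by $\Psi_*([\Delta])=\mathrm{WN}_{\mathcal P}(u)[V^*\setminus\{u\}]$ (it does not depend on the orientation chosen). *)

theory Defs
  imports "HOL-Analysis.Analysis" "HOL-Homology.Homology" "HOL-Combinatorics.Permutations"
begin

section \<open>Multi-fans\<close>

definition is_lattice :: "'v::euclidean_space set \<Rightarrow> bool"
  where "is_lattice N \<longleftrightarrow>
    (\<exists>B. independent B \<and> N = {\<Sum>b\<in>B. of_int (c b) *\<^sub>R b | c :: 'v \<Rightarrow> int. True})"

text \<open>Strongly convex rational polyhedral cones.  The hull below is the set of nonnegative
  combinations of \<open>G\<close> (and \<open>{0}\<close> for empty \<open>G\<close>).\<close>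

definition Cone :: "'v::euclidean_space set \<Rightarrow> 'v set set"
  where "Cone N = {\<kappa>. (\<exists>G. finite G \<and> G \<subseteq> N \<and> \<kappa> = convex_cone hull G) \<and>
                       (\<forall>a d. d \<noteq> 0 \<longrightarrow> \<not> range (\<lambda>t::real. a + t *\<^sub>R d) \<subseteq> \<kappa>)}"

text \<open>The index poset is a finite subset of an ordered type.  The ambient space is the real span of
  the lattice, which may be a proper subspace of the type \<open>'v\<close>; this lets projected multi-fans live
  in the same type.\<close>

record ('s, 'v) multi_fan =
  fan_lattice :: "'v set"
  faces :: "'s set"
  fan_cone :: "'s \<Rightarrow> 'v set"
  w_plus :: "'s \<Rightarrow> nat"
  w_minus :: "'s \<Rightarrow> nat"

definition fan_dim :: "('s, 'v::euclidean_space) multi_fan \<Rightarrow> nat"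
  where "fan_dim \<Delta> = dim (fan_lattice \<Delta>)"

definition faces_dim :: "('s, 'v::euclidean_space) multi_fan \<Rightarrow> nat \<Rightarrow> 's set"
  where "faces_dim \<Delta> m = {I \<in> faces \<Delta>. dim (fan_cone \<Delta> I) = m}"

definition weight :: "('s, 'v) multi_fan \<Rightarrow> 's \<Rightarrow> int"
  where "weight \<Delta> I = int (w_plus \<Delta> I) - int (w_minus \<Delta> I)"

text \<open>The library's \<open>face_of\<close> also admits the empty set as a face; membership in \<open>Cone N\<close> excludes it.\<close>

definition is_multi_fan :: "('s::order, 'v::euclidean_space) multi_fan \<Rightarrow> bool"
  where "is_multi_fan \<Delta> \<longleftrightarrow>
    is_lattice (fan_lattice \<Delta>) \<and>
    finite (faces \<Delta>) \<and>
    (\<forall>I \<in> faces \<Delta>. fan_cone \<Delta> I \<in> Cone (fan_lattice \<Delta>)) \<and>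
    (\<exists>m \<in> faces \<Delta>. (\<forall>I \<in> faces \<Delta>. m \<le> I) \<and> fan_cone \<Delta> m = {0}) \<and>
    (\<forall>I \<in> faces \<Delta>. \<forall>J \<in> faces \<Delta>. I < J \<longrightarrow>
       fan_cone \<Delta> I face_of fan_cone \<Delta> J \<and> fan_cone \<Delta> I \<noteq> fan_cone \<Delta> J) \<and>
    (\<forall>J \<in> faces \<Delta>.
       bij_betw (fan_cone \<Delta>) {I \<in> faces \<Delta>. I \<le> J}
         {\<kappa> \<in> Cone (fan_lattice \<Delta>). \<kappa> face_of fan_cone \<Delta> J} \<and>
       (\<forall>I \<in> faces \<Delta>. \<forall>I' \<in> faces \<Delta>. I \<le> J \<and> I' \<le> J \<longrightarrow>
          (I \<le> I' \<longleftrightarrow> fan_cone \<Delta> I face_of fan_cone \<Delta> I'))) \<and>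
    (\<forall>I \<in> faces_dim \<Delta> (fan_dim \<Delta>). w_plus \<Delta> I > 0 \<or> w_minus \<Delta> I > 0)"

definition generic :: "('s, 'v::euclidean_space) multi_fan \<Rightarrow> 'v \<Rightarrow> bool"
  where "generic \<Delta> x \<longleftrightarrow> x \<in> span (fan_lattice \<Delta>) \<and>
    (\<forall>I \<in> faces \<Delta>. dim (fan_cone \<Delta> I) < fan_dim \<Delta> \<longrightarrow> x \<notin> span (fan_cone \<Delta> I))"

definition local_degree :: "('s, 'v::euclidean_space) multi_fan \<Rightarrow> 'v \<Rightarrow> int"
  where "local_degree \<Delta> x =
    (\<Sum>I \<in> {I \<in> faces_dim \<Delta> (fan_dim \<Delta>). x \<in> fan_cone \<Delta> I}. weight \<Delta> I)"

definition pre_complete :: "('s, 'v::euclidean_space) multi_fan \<Rightarrow> bool"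
  where "pre_complete \<Delta> \<longleftrightarrow> faces_dim \<Delta> (fan_dim \<Delta>) \<noteq> {} \<and>
    (\<forall>x y. generic \<Delta> x \<longrightarrow> generic \<Delta> y \<longrightarrow> local_degree \<Delta> x = local_degree \<Delta> y)"

text \<open>The quotient of the ambient space by a subspace \<open>W\<close> is realised as the orthogonal complement of
  \<open>W\<close>, with orthogonal projection as the quotient map.\<close>

definition quot_map :: "'v::euclidean_space set \<Rightarrow> 'v \<Rightarrow> 'v"
  where "quot_map W x = (THE y. y \<in> orthogonal_comp W \<and> x - y \<in> W)"

text \<open>The subgroup generated by \<open>C(K) \<inter> N\<close> is the intersection of \<open>N\<close> with the span of the rational cone
  \<open>C(K)\<close>, so the quotient lattice is the image of \<open>N\<close> under the quotient map.\<close>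

definition projected :: "('s::order, 'v::euclidean_space) multi_fan \<Rightarrow> 's \<Rightarrow> ('s, 'v) multi_fan"
  where "projected \<Delta> K =
    \<lparr>fan_lattice = quot_map (span (fan_cone \<Delta> K)) ` fan_lattice \<Delta>,
     faces = {J \<in> faces \<Delta>. K \<le> J},
     fan_cone = (\<lambda>J. quot_map (span (fan_cone \<Delta> K)) ` fan_cone \<Delta> J),
     w_plus = w_plus \<Delta>,
     w_minus = w_minus \<Delta>\<rparr>"

definition complete_fan :: "('s::order, 'v::euclidean_space) multi_fan \<Rightarrow> bool"
  where "complete_fan \<Delta> \<longleftrightarrow>
    pre_complete \<Delta> \<and> (\<forall>K \<in> faces \<Delta>. pre_complete (projected \<Delta> K))"

definition simplicial_fan :: "('s, 'v::euclidean_space) multi_fan \<Rightarrow> bool"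
  where "simplicial_fan \<Delta> \<longleftrightarrow>
    (\<forall>I \<in> faces \<Delta>. \<exists>B. independent B \<and> fan_cone \<Delta> I = convex_cone hull B)"

text \<open>For a simplicial multi-fan the index poset is identified with an augmented simplicial set of
  subsets of \<open>{1..d}\<close>, ordered by inclusion.\<close>

definition augmented_on :: "nat \<Rightarrow> (nat set, 'v::euclidean_space) multi_fan \<Rightarrow> bool"
  where "augmented_on d \<Delta> \<longleftrightarrow>
    faces \<Delta> \<subseteq> Pow {1..d} \<and> {} \<in> faces \<Delta> \<and>
    (\<forall>I \<in> faces \<Delta>. \<forall>J. J \<subseteq> I \<longrightarrow> J \<in> faces \<Delta>) \<and>
    faces_dim \<Delta> 1 = (\<lambda>i. {i}) ` {1..d}"


section \<open>Multi-polytopes\<close>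

definition affine_hyperplane :: "'a::real_vector set \<Rightarrow> bool"
  where "affine_hyperplane H \<longleftrightarrow>
    (\<exists>f c. linear f \<and> f \<noteq> (\<lambda>_. 0) \<and> H = {x. f x = (c::real)})"

text \<open>From here on the ambient space is the whole type \<open>'v\<close>; its dual is \<open>'v \<Rightarrow>\<^sub>L real\<close>, every linear
  functional on a finite-dimensional space being bounded.\<close>

definition multi_polytope ::
    "('s::order, 'v::euclidean_space) multi_fan \<Rightarrow> ('s \<Rightarrow> ('v \<Rightarrow>\<^sub>L real) set) \<Rightarrow> bool"
  where "multi_polytope \<Delta> F \<longleftrightarrow>
    is_multi_fan \<Delta> \<and> span (fan_lattice \<Delta>) = UNIV \<and> complete_fan \<Delta> \<and>
    (\<forall>I \<in> faces_dim \<Delta> 1. affine_hyperplane (F I) \<and>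
       (\<forall>x \<in> fan_cone \<Delta> I. \<forall>f \<in> F I. \<forall>g \<in> F I. blinfun_apply f x = blinfun_apply g x))"

definition simple_multi_polytope ::
    "nat \<Rightarrow> (nat set, 'v::euclidean_space) multi_fan \<Rightarrow> (nat set \<Rightarrow> ('v \<Rightarrow>\<^sub>L real) set) \<Rightarrow> bool"
  where "simple_multi_polytope d \<Delta> F \<longleftrightarrow>
    multi_polytope \<Delta> F \<and> simplicial_fan \<Delta> \<and> augmented_on d \<Delta>"

definition F_int :: "(nat set \<Rightarrow> ('v::euclidean_space \<Rightarrow>\<^sub>L real) set) \<Rightarrow> nat set \<Rightarrow> ('v \<Rightarrow>\<^sub>L real) set"
  where "F_int F I = (\<Inter>i\<in>I. F {i})"

definition apex :: "(nat set \<Rightarrow> ('v::euclidean_space \<Rightarrow>\<^sub>L real) set) \<Rightarrow> nat set \<Rightarrow> 'v \<Rightarrow>\<^sub>L real"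
  where "apex F I = (THE x. x \<in> F_int F I)"

text \<open>Member \<open>i\<close> of the basis dual to the basis \<open>(b j)\<close>, \<open>j \<in> A\<close>.\<close>

definition dual_vec :: "(nat \<Rightarrow> 'v::euclidean_space) \<Rightarrow> nat set \<Rightarrow> nat \<Rightarrow> 'v \<Rightarrow>\<^sub>L real"
  where "dual_vec b A i = (THE f. \<forall>j\<in>A. blinfun_apply f (b j) = (if j = i then 1 else 0))"


section \<open>Duistermaat-Heckman function\<close>

definition dual_vec_plus ::
    "(nat \<Rightarrow> 'v::euclidean_space) \<Rightarrow> 'v \<Rightarrow> nat set \<Rightarrow> nat \<Rightarrow> 'v \<Rightarrow>\<^sub>L real"
  where "dual_vec_plus v x I i =
    (if blinfun_apply (dual_vec v I i) x > 0 then dual_vec v I i else - dual_vec v I i)"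

definition shifted_cone ::
    "(nat set \<Rightarrow> ('v::euclidean_space \<Rightarrow>\<^sub>L real) set) \<Rightarrow> (nat \<Rightarrow> 'v) \<Rightarrow> 'v \<Rightarrow> nat set \<Rightarrow> ('v \<Rightarrow>\<^sub>L real) set"
  where "shifted_cone F v x I =
    (\<lambda>y. apex F I + y) ` (convex_cone hull (dual_vec_plus v x I ` I))"

definition DH ::
    "(nat set, 'v::euclidean_space) multi_fan \<Rightarrow> (nat set \<Rightarrow> ('v \<Rightarrow>\<^sub>L real) set) \<Rightarrow>
     (nat \<Rightarrow> 'v) \<Rightarrow> 'v \<Rightarrow> ('v \<Rightarrow>\<^sub>L real) \<Rightarrow> int"
  where "DH \<Delta> F v x u =
    (\<Sum>I \<in> faces_dim \<Delta> (fan_dim \<Delta>).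
       (-1) ^ card {i \<in> I. blinfun_apply (dual_vec v I i) x > 0} * weight \<Delta> I *
       indicator (shifted_cone F v x I) u)"


section \<open>Winding number\<close>

text \<open>An orientation is given by an ordered basis \<open>e 0, \<dots>, e (n - 1)\<close> declared to be positive.\<close>

definition ordered_basis :: "(nat \<Rightarrow> 'v::euclidean_space) \<Rightarrow> bool"
  where "ordered_basis e \<longleftrightarrow>
    inj_on e {..<DIM('v)} \<and> independent (e ` {..<DIM('v)}) \<and> span (e ` {..<DIM('v)}) = UNIV"

text \<open>Leibniz determinant of \<open>b 0, \<dots>, b (n - 1)\<close> in coordinates with respect to \<open>e\<close>.\<close>

definition det_wrt :: "(nat \<Rightarrow> 'v::euclidean_space) \<Rightarrow> (nat \<Rightarrow> 'v) \<Rightarrow> real"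
  where "det_wrt e b =
    (\<Sum>p | p permutes {..<DIM('v)}.
       of_int (sign p) * (\<Prod>k<DIM('v). representation (e ` {..<DIM('v)}) (b k) (e (p k))))"

definition positive_basis :: "(nat \<Rightarrow> 'v::euclidean_space) \<Rightarrow> (nat \<Rightarrow> 'v) \<Rightarrow> bool"
  where "positive_basis e b \<longleftrightarrow> det_wrt e b > 0"

text \<open>Geometric realisations are taken in the space of functions \<open>nat \<Rightarrow> real\<close> with the vertex \<open>i\<close> of the
  complex at the unit vector \<open>i\<close>.  The first barycentric subdivision is drawn inside the realisation
  of the complex itself, with the vertex \<open>I\<close> at the barycentre of the simplex \<open>I\<close>, so both have the same
  underlying space.\<close>

definition unit_pt :: "nat \<Rightarrow> nat \<Rightarrow> real"
  where "unit_pt i = (\<lambda>j. if j = i then 1 else 0)"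

definition barycentre :: "nat set \<Rightarrow> nat \<Rightarrow> real"
  where "barycentre I = (\<lambda>j. (\<Sum>i\<in>I. unit_pt i j) / real (card I))"

text \<open>Convex hull of a finite set of points; the function type is not an instance of \<open>real_vector\<close>.\<close>

definition fun_hull :: "(nat \<Rightarrow> real) set \<Rightarrow> (nat \<Rightarrow> real) set"
  where "fun_hull W =
    {\<lambda>j. \<Sum>y\<in>W. t y * y j | t. (\<forall>y\<in>W. 0 \<le> t y) \<and> (\<Sum>y\<in>W. t y) = 1}"

definition realization :: "nat set set \<Rightarrow> (nat \<Rightarrow> real) topology"
  where "realization K =
    subtopology (powertop_real UNIV) (\<Union>I \<in> K - {{}}. fun_hull (unit_pt ` I))"

text \<open>The simplices of the subdivision are spanned by the chains of nonempty simplices.\<close>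

definition sd_star :: "nat set set \<Rightarrow> nat \<Rightarrow> (nat \<Rightarrow> real) set"
  where "sd_star K i =
    (\<Union>c \<in> {c. subset.chain (K - {{}}) c \<and> {i} \<in> c}. fun_hull (barycentre ` c))"

definition sd_dual :: "nat set set \<Rightarrow> nat set \<Rightarrow> (nat \<Rightarrow> real) set"
  where "sd_dual K I = (\<Inter>i\<in>I. sd_star K i)"

definition stratified_map ::
    "nat \<Rightarrow> (nat set, 'v::euclidean_space) multi_fan \<Rightarrow> (nat set \<Rightarrow> ('v \<Rightarrow>\<^sub>L real) set) \<Rightarrow>
     ((nat \<Rightarrow> real) \<Rightarrow> 'v \<Rightarrow>\<^sub>L real) \<Rightarrow> bool"
  where "stratified_map d \<Delta> F \<Psi> \<longleftrightarrow>
    continuous_map (realization (faces \<Delta>)) (top_of_set (\<Union>i\<in>{1..d}. F {i})) \<Psi> \<and>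
    (\<forall>I \<in> faces \<Delta>. I \<noteq> {} \<longrightarrow> \<Psi> ` sd_dual (faces \<Delta>) I \<subseteq> F_int F I)"

text \<open>The oriented simplex of \<open>I = {i\<^sub>1 < \<dots> < i\<^sub>n}\<close> is the affine singular simplex through the vertices
  \<open>i\<^sub>1, \<dots>, i\<^sub>n\<close> of the realisation, taken with the sign of the basis \<open>v i\<^sub>1, \<dots>, v i\<^sub>n\<close>.\<close>

definition oriented_face ::
    "(nat \<Rightarrow> 'v::euclidean_space) \<Rightarrow> (nat \<Rightarrow> 'v) \<Rightarrow> nat set \<Rightarrow> (nat \<Rightarrow> real) chain"
  where "oriented_face e v I =
    frag_cmul (if positive_basis e (\<lambda>k. v (sorted_list_of_set I ! k)) then 1 else -1)
      (frag_of (oriented_simplex (card I - 1) (\<lambda>k. unit_pt (sorted_list_of_set I ! k))))"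

definition fan_class ::
    "(nat set, 'v::euclidean_space) multi_fan \<Rightarrow> (nat \<Rightarrow> 'v) \<Rightarrow> (nat \<Rightarrow> 'v) \<Rightarrow> (nat \<Rightarrow> real) chain set"
  where "fan_class \<Delta> e v =
    homologous_rel_set (fan_dim \<Delta> - 1) (realization (faces \<Delta>)) {}
      (\<Sum>I \<in> faces_dim \<Delta> (fan_dim \<Delta>). frag_cmul (weight \<Delta> I) (oriented_face e v I))"

definition affine_simplex :: "nat \<Rightarrow> (nat \<Rightarrow> 'a::real_vector) \<Rightarrow> (nat \<Rightarrow> real) \<Rightarrow> 'a"
  where "affine_simplex p l = (\<lambda>x \<in> standard_simplex p. \<Sum>j\<le>p. x j *\<^sub>R l j)"

text \<open>With \<open>f\<^sub>1, \<dots>, f\<^sub>n\<close> the basis dual to \<open>e\<close>, i.e. a positive basis for the dual orientation, the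
  fundamental class is represented by the simplex with vertices \<open>u - (f\<^sub>1 + \<dots> + f\<^sub>n), u + f\<^sub>1, \<dots>, u + f\<^sub>n\<close>.
  It has barycentre \<open>u\<close> and is positively oriented: its edge vectors at the first vertex are
  \<open>f\<^sub>k + (f\<^sub>1 + \<dots> + f\<^sub>n)\<close>, with determinant \<open>n + 1\<close>.\<close>

definition fundamental_class ::
    "(nat \<Rightarrow> 'v::euclidean_space) \<Rightarrow> ('v \<Rightarrow>\<^sub>L real) \<Rightarrow> ('v \<Rightarrow>\<^sub>L real) chain set"
  where "fundamental_class e u =
    homologous_rel_set DIM('v) euclidean (UNIV - {u})
      (frag_of (affine_simplex DIM('v)
        (\<lambda>j. case j of 0 \<Rightarrow> u - (\<Sum>k<DIM('v). dual_vec e {..<DIM('v)} k)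
                     | Suc k \<Rightarrow> u + dual_vec e {..<DIM('v)} k)))"

definition punctured_class ::
    "(nat \<Rightarrow> 'v::euclidean_space) \<Rightarrow> ('v \<Rightarrow>\<^sub>L real) \<Rightarrow> ('v \<Rightarrow>\<^sub>L real) chain set"
  where "punctured_class e u =
    hom_boundary (int DIM('v)) euclidean (UNIV - {u}) (fundamental_class e u)"

text \<open>The library writes homology groups multiplicatively, so the multiple by \<open>k\<close> is the power \<open>k\<close>.  The map
  \<open>\<Psi>\<close> exists and is unique up to stratified homotopy, so its choice does not affect the value.\<close>

definition WN ::
    "nat \<Rightarrow> (nat set, 'v::euclidean_space) multi_fan \<Rightarrow> (nat set \<Rightarrow> ('v \<Rightarrow>\<^sub>L real) set) \<Rightarrow>
     (nat \<Rightarrow> 'v) \<Rightarrow> (nat \<Rightarrow> 'v) \<Rightarrow> ('v \<Rightarrow>\<^sub>L real) \<Rightarrow> int"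
  where "WN d \<Delta> F v e u =
    (THE k::int. \<exists>\<Psi>. stratified_map d \<Delta> F \<Psi> \<and>
       hom_induced (int (DIM('v) - 1)) (realization (faces \<Delta>)) {} (top_of_set (UNIV - {u})) {} \<Psi>
         (fan_class \<Delta> e v)
       = punctured_class e u
           [^]\<^bsub>reduced_homology_group (int (DIM('v) - 1)) (top_of_set (UNIV - {u}))\<^esub> k)"

end

theory Submission
  imports Defs
begin

text \<open>
  The winding number is computed relative to a half space.  Choose the stratified map so that all of
  its cell centres, except the vertices \<open>u\<^sub>I\<close> of the arrangement, lie on a hyperplane where the generic
  vector \<open>x\<close> takes a constant value slightly above \<open>u x\<close>.  The boundary of every maximal simplex is then
  mapped to this hyperplane, so modulo the half space \<open>H\<close> above it, which avoids \<open>u\<close>, each maximal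
  simplex \<open>I\<close> contributes separately.  A linear isotopy shows that its image is homologous to \<open>0\<close> modulo
  \<open>H\<close> if \<open>u\<close> is outside the shifted cone of \<open>I\<close>, and to \<open>(-1)\<^sup>I\<close> times the punctured class, up to the
  orientation of \<open>I\<close>, if \<open>u\<close> is inside; the sum of the contributions is the Duistermaat-Heckman function.
  Since \<open>H\<close> is convex, the relation holds absolutely as well.  Any other stratified map is joined to the
  chosen one by straight segments inside the hyperplanes, hence off \<open>u\<close>, and the punctured class has
  infinite order, so the multiple is determined.
\<close>

section \<open>Chains on the standard simplex\<close>

text \<open>Write n for the dimension. Scaling the \<open>v i\<close> of a maximal face
  \<open>I\<close> by the coordinates of \<open>x\<close> gives vectors b_k with sum
  \<open>x\<close>; then \<open>u\<close> lies in the shifted cone iff its values exceed those of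
  u_I at every b_k, and (-1)^I is the parity of the number of positive factors. This turns the two
  cases into sign conditions on functionals. The model for the inside case is the simplex around
  \<open>u\<close> dual to the vectors 2x - b_k: they add up to (2n - 1)x, so every vertex but one
  has height 1/(2n - 1) above the value of \<open>u\<close> at \<open>x\<close>, and this fixes the
  height of the hyperplane. The factor 2 keeps them a basis when n = 1, where x - b_0 is 0. The
  passage from relative to absolute homology meets an obstacle in degree 0, where every chain is a
  cycle: for n = 1 total coefficients must be compared as well. Orientations are compared through
  changes of a single basis vector, which match the multiplicativity of the determinant.
  Completeness is used across faces of codimension one, where the multi-fan projects to a
  line.\<close>

lemma continuous_map_simplex_iff:
  "continuous_map (subtopology (powertop_real UNIV) S) (top_of_set T) f \<longleftrightarrow>
     continuous_on S f \<and> f \<in> S \<rightarrow> T"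
  by (simp add: euclidean_product_topology continuous_map_in_subtopology)

lemma continuous_on_eval [continuous_intros]: "continuous_on S (\<lambda>y::nat \<Rightarrow> real. y i)"
  by (rule continuous_on_product_coordinates[THEN continuous_on_subset]) auto

text \<open>The augmentation, with values in the free abelian group on one generator so that
  \<open>frag_extend\<close> defines it. In degree 0, where \<open>chain_boundary\<close> is zero
  and every chain is a cycle, it is the obstruction to bounding in a convex set.\<close>

definition chain_sum :: "'a chain \<Rightarrow> unit \<Rightarrow>\<^sub>0 int"
  where "chain_sum = frag_extend (\<lambda>_. frag_of ())"

lemma chain_sum_simps [simp]:
  "chain_sum 0 = 0" "chain_sum (frag_of f) = frag_of ()"
  "chain_sum (a + b) = chain_sum a + chain_sum b" "chain_sum (a - b) = chain_sum a - chain_sum b"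
  "chain_sum (- a) = - chain_sum a" "chain_sum (frag_cmul k a) = frag_cmul k (chain_sum a)"
  by (simp_all add: chain_sum_def frag_extend_add frag_extend_diff frag_extend_minus frag_extend_cmul)

lemma chain_sum_sum: "finite I \<Longrightarrow> chain_sum (sum f I) = (\<Sum>i\<in>I. chain_sum (f i))"
  by (induction rule: finite_induct) auto

lemma chain_sum_boundary: "chain_sum (chain_boundary (Suc 0) c) = 0"
  using subset_UNIV
proof (induction c rule: frag_induction)
  case (one f)
  then show ?case by (simp add: chain_boundary_of)
next
  case (diff a b)
  then show ?case by (simp add: chain_boundary_diff)
qed auto

lemma chain_sum_chain_map: "chain_sum (chain_map p f c) = chain_sum c"
  using subset_UNIV
proof (induction c rule: frag_induction)
  case (diff a b)
  then show ?case by (simp add: chain_map_diff)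
qed auto

text \<open>The universal simplex: every simplex \<open>restrict f (standard_simplex n)\<close> is
  its image under \<open>chain_map n f\<close>, so relations between chains reduce to homotopies of
  maps. The restriction is there because singular simplices are extensional.\<close>

abbreviation id_simplex :: "nat \<Rightarrow> (nat \<Rightarrow> real) \<Rightarrow> nat \<Rightarrow> real"
  where "id_simplex n \<equiv> restrict id (standard_simplex n)"

abbreviation simplex_top :: "nat \<Rightarrow> (nat \<Rightarrow> real) topology"
  where "simplex_top n \<equiv> subtopology (powertop_real UNIV) (standard_simplex n)"

definition simplex_bd :: "nat \<Rightarrow> (nat \<Rightarrow> real) set"
  where "simplex_bd n = {y \<in> standard_simplex n. \<exists>i\<le>n. y i = 0}"

text \<open>The union of the faces opposite to the vertices 1 to n; of the boundary, only the
  interior of the face opposite vertex 0 is missing.\<close>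

definition simplex_horn :: "nat \<Rightarrow> (nat \<Rightarrow> real) set"
  where "simplex_horn n = {y \<in> standard_simplex n. \<exists>i\<in>{1..n}. y i = 0}"

abbreviation bd_top :: "nat \<Rightarrow> (nat \<Rightarrow> real) topology"
  where "bd_top n \<equiv> subtopology (powertop_real UNIV) (simplex_bd n)"

lemma simplex_bd_subset: "simplex_bd n \<subseteq> standard_simplex n"
  by (auto simp: simplex_bd_def)

lemma simplex_horn_subset: "simplex_horn n \<subseteq> simplex_bd n"
  by (auto simp: simplex_bd_def simplex_horn_def)

lemma simplex_bd_0: "simplex_bd 0 = {}"
  by (auto simp: simplex_bd_def standard_simplex_def)

lemma singular_simplex_id: "singular_simplex n (simplex_top n) (id_simplex n)"
  by (auto simp: singular_simplex_def continuous_map_in_subtopology intro: continuous_map_eq[OF continuous_map_id_subt])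

lemma singular_chain_id: "singular_chain n (simplex_top n) (frag_of (id_simplex n))"
  by (simp add: singular_chain_of singular_simplex_id)

lemma singular_face_id_bd:
  assumes "k \<le> Suc n"
  shows "singular_simplex n (subtopology (powertop_real UNIV) {y\<in>standard_simplex (Suc n). y k = 0})
           (singular_face (Suc n) k (id_simplex (Suc n)))"
proof -
  have 1: "singular_simplex n (simplex_top (Suc n)) (singular_face (Suc n) k (id_simplex (Suc n)))"
    using singular_simplex_singular_face[OF singular_simplex_id, of "Suc n" k] assms by simp
  then have "singular_simplex n (powertop_real UNIV) (singular_face (Suc n) k (id_simplex (Suc n)))"
    by (simp add: singular_simplex_subtopology)
  moreover have "simplical_face k y \<in> standard_simplex (Suc n)" if "y \<in> standard_simplex n" for y :: "nat \<Rightarrow> real"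
    using simplical_face_in_standard_simplex[of "Suc n" k y] assms that by simp
  moreover have "simplical_face k y k = 0" for y :: "nat \<Rightarrow> real"
    by (simp add: simplical_face_def)
  ultimately show ?thesis
    by (auto simp: singular_simplex_subtopology singular_face_def)
qed

lemma chain_boundary_id:
  "chain_boundary (Suc n) (frag_of (id_simplex (Suc n))) =
     (\<Sum>k\<le>Suc n. frag_cmul ((-1) ^ k) (frag_of (singular_face (Suc n) k (id_simplex (Suc n)))))"
  by (simp add: chain_boundary_of del: sum.atMost_Suc)

lemma singular_simplex_mono_sub:
  "singular_simplex p (subtopology X S) f \<Longrightarrow> S \<subseteq> T \<Longrightarrow> singular_simplex p (subtopology X T) f"
  by (auto simp: singular_simplex_subtopology)

lemma singular_chain_bd_id:
  "singular_chain n (bd_top (Suc n)) (chain_boundary (Suc n) (frag_of (id_simplex (Suc n))))"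
  unfolding chain_boundary_id
proof (intro singular_chain_sum singular_chain_cmul)
  fix k assume "k \<in> {..Suc n}"
  then show "singular_chain n (bd_top (Suc n)) (frag_of (singular_face (Suc n) k (id_simplex (Suc n))))"
    unfolding singular_chain_of
    by (intro singular_simplex_mono_sub[OF singular_face_id_bd]) (auto simp: simplex_bd_def)
qed

lemma singular_cycle_bd_id:
  "singular_relcycle n (bd_top (Suc n)) {} (chain_boundary (Suc n) (frag_of (id_simplex (Suc n))))"
  using singular_chain_bd_id chain_boundary_boundary[OF singular_chain_id, of "Suc n"]
  by (simp add: singular_cycle)

lemma singular_relcycle_id: "singular_relcycle n (simplex_top n) (simplex_bd n) (frag_of (id_simplex n))"
proof (cases n)
  case 0
  then show ?thesis
    by (simp add: singular_relcycle singular_chain_id chain_boundary_def)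
next
  case (Suc m)
  have "standard_simplex (Suc m) \<inter> simplex_bd (Suc m) = simplex_bd (Suc m)"
    using simplex_bd_subset by blast
  then show ?thesis
    using singular_chain_bd_id[of m] Suc singular_chain_id[of n]
    by (simp add: singular_relcycle subtopology_subtopology)
qed

text \<open>Radial projection from vertex 0 maps the boundary onto the face opposite to it, carries
  the horn into the boundary of that face, and is the identity on the face. It is undefined at
  vertex 0 itself, which is therefore excised first.\<close>

lemma face_zero_relcycle_infinite_order:
  fixes m :: int
  assumes "singular_relboundary n (bd_top (Suc n)) (simplex_horn (Suc n))
      (frag_cmul m (frag_of (singular_face (Suc n) 0 (id_simplex (Suc n)))))"
  shows "singular_relboundary n (simplex_top n) (simplex_bd n) (frag_cmul m (frag_of (id_simplex n)))"
proof -
  let ?B = "simplex_bd (Suc n)" and ?L = "simplex_horn (Suc n)"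
  let ?f = "singular_face (Suc n) 0 (id_simplex (Suc n))"
  let ?c = "frag_cmul m (frag_of ?f)"
  define v0 :: "nat \<Rightarrow> real" where "v0 = (\<lambda>j. if j = 0 then 1 else 0)"
  let ?X = "bd_top (Suc n)"
  let ?Y = "subtopology ?X (?B - {v0})"
  have v0: "y = v0" if "y \<in> standard_simplex (Suc n)" "y 0 = 1" for y
  proof -
    have "(\<Sum>i\<le>Suc n. y i) = 1" "\<forall>i. 0 \<le> y i" "\<forall>i>Suc n. y i = 0" using that by (auto simp: standard_simplex_def)
    then have s0: "(\<Sum>i\<le>n. y (Suc i)) = 0"
      using that(2) by (simp add: sum.atMost_Suc_shift del: sum.atMost_Suc)
    have *: "y (Suc i) = 0" if "i \<le> n" for i
      using s0 that \<open>\<forall>i. 0 \<le> y i\<close> by (subst (asm) sum_nonneg_eq_0_iff) auto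
    have "y i = 0" if "i \<in> {1..Suc n}" for i
      using *[of "i - 1"] that by auto
    then show ?thesis
      using \<open>\<forall>i>Suc n. y i = 0\<close> that(2) unfolding v0_def
      by (intro ext) (metis One_nat_def Suc_leI atLeastAtMost_iff neq0_conv not_le)
  qed
  have open0: "openin ?X {y \<in> ?B. y 0 > 0}"
    by (rule openin_continuous_map_preimage[of ?X euclideanreal "\<lambda>y. y 0" "{0<..}", simplified, unfolded greaterThan_def mem_Collect_eq])
       (auto intro!: continuous_map_from_subtopology continuous_map_product_projection)
  \<comment> \<open>Near vertex 0 the boundary agrees with the horn, which is what excision of that
    vertex requires.\<close>
  have face_horn: "{y \<in> ?B. y 0 > 0} \<subseteq> ?L"
  proof
    fix y assume y: "y \<in> {y \<in> ?B. y 0 > 0}"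
    then obtain i where i: "i \<le> Suc n" "y i = 0" by (auto simp: simplex_bd_def)
    with y have "i \<noteq> 0" by (intro notI) simp
    with i have "i \<in> {1..Suc n}" by simp
    with i y show "y \<in> ?L" by (auto simp: simplex_bd_def simplex_horn_def)
  qed
  have clo: "?X closure_of {v0} \<subseteq> ?X interior_of ?L"
  proof -
    have "closedin (powertop_real UNIV) {v0}"
      by (simp add: euclidean_product_topology)
    then have "closedin ?X (?B \<inter> {v0})"
      by (auto simp: closedin_subtopology)
    then have "?X closure_of (?B \<inter> {v0}) \<subseteq> ?B \<inter> {v0}"
      by (intro closure_of_minimal) auto
    then have "?X closure_of {v0} \<subseteq> ?B \<inter> {v0}"
      using closure_of_restrict[of ?X "{v0}"] by (simp add: euclidean_product_topology)
    also have "\<dots> \<subseteq> {y \<in> ?B. y 0 > 0}" by (auto simp: v0_def)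
    also have "\<dots> \<subseteq> ?X interior_of ?L"
      by (rule interior_of_maximal[OF face_horn open0])
    finally show ?thesis .
  qed
  have Xeq: "subtopology ?X ?B = ?X"
    by (simp add: subtopology_subtopology)
  have iso: "hom_induced n ?Y (?L - {v0}) ?X ?L id
    \<in> iso (relative_homology_group n ?Y (?L - {v0})) (relative_homology_group n ?X ?L)"
    using homology_excision_axiom[OF clo simplex_horn_subset, of n] unfolding Xeq .
  have fimg: "?f ` standard_simplex n \<subseteq> {y \<in> standard_simplex (Suc n). y 0 = 0}"
    using singular_face_id_bd[of 0 n] by (simp add: singular_simplex_subtopology)
  have fs: "singular_simplex n ?Y ?f"
    using singular_face_id_bd[of 0 n]
    by (auto simp: singular_simplex_subtopology simplex_bd_def v0_def image_subset_iff)
  have bdy: "chain_boundary n (frag_of ?f) \<in> {c. singular_chain (n - 1) (subtopology ?Y (?L - {v0})) c}"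
  proof (cases n)
    case 0
    then show ?thesis by (simp add: chain_boundary_def)
  next
    case (Suc q)
    let ?Z = "subtopology ?Y (?L - {v0})"
    have "continuous_map (bd_top n) ?Z (simplical_face 0)"
    proof -
      have "continuous_map (powertop_real UNIV) (powertop_real UNIV) (simplical_face 0 :: (nat \<Rightarrow> real) \<Rightarrow> _)"
        unfolding continuous_map_componentwise simplical_face_def
        by (auto intro: continuous_map_product_projection)
      moreover have "simplical_face 0 y \<in> ?B \<inter> (?B - {v0}) \<inter> (?L - {v0})" if y: "y \<in> simplex_bd n" for y :: "nat \<Rightarrow> real"
      proof -
        have 1: "simplical_face 0 y \<in> standard_simplex (Suc n)"
          using simplical_face_in_standard_simplex[of "Suc n" 0 y] y by (simp add: simplex_bd_def)
        obtain i where i: "i \<le> n" "y i = 0" using y by (auto simp: simplex_bd_def)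
        have "simplical_face 0 y \<in> ?L"
          using 1 i by (auto simp: simplex_horn_def simplical_face_def intro!: bexI[of _ "Suc i"])
        moreover have "simplical_face 0 y \<noteq> v0" by (auto simp: v0_def simplical_face_def fun_eq_iff)
        ultimately show ?thesis using simplex_horn_subset by blast
      qed
      ultimately show ?thesis
        by (auto simp: continuous_map_in_subtopology continuous_map_from_subtopology)
    qed
    then have "singular_chain q ?Z (chain_map q (simplical_face 0) (chain_boundary n (frag_of (id_simplex n))))"
      using singular_chain_chain_map[OF singular_chain_bd_id[of q]] Suc by simp
    also have "chain_map q (simplical_face 0) (chain_boundary n (frag_of (id_simplex n)))
       = chain_boundary n (chain_map n (simplical_face 0) (frag_of (id_simplex n)))"
      using chain_boundary_chain_map[OF singular_chain_id, of n "simplical_face 0"] Suc by simp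
    also have "chain_map n (simplical_face 0) (frag_of (id_simplex n)) = frag_of ?f"
    proof -
      have "simplex_map n (simplical_face 0) (id_simplex n) = ?f"
        using simplical_face_in_standard_simplex[of "Suc n" 0]
        by (auto simp: simplex_map_def singular_face_def fun_eq_iff)
      then show ?thesis by simp
    qed
    finally show ?thesis using Suc by simp
  qed
  have cyc: "singular_relcycle n ?Y (?L - {v0}) ?c"
    using fs bdy by (intro singular_relcycle_cmul) (simp add: singular_relcycle singular_chain_of)
  have cid: "chain_map n id ?c = ?c"
    using chain_map_ident[of n ?Y ?c] fs by (simp add: singular_chain_of singular_chain_cmul)
  have hi: "hom_induced n ?Y (?L - {v0}) ?X ?L id (homologous_rel_set n ?Y (?L - {v0}) a) = homologous_rel_set n ?X ?L (chain_map n id a)"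
    if "singular_relcycle n ?Y (?L - {v0}) a" for a
    by (rule hom_induced_chain_map[OF _ _ that]) (auto intro: continuous_map_from_subtopology)
  \<comment> \<open>Injectivity of the excision isomorphism pulls the relation back to the
    complement of vertex 0.\<close>
  have "homologous_rel_set n ?Y (?L - {v0}) ?c = homologous_rel_set n ?Y (?L - {v0}) 0"
  proof (rule inj_onD[of "hom_induced n ?Y (?L - {v0}) ?X ?L id"])
    show "inj_on (hom_induced n ?Y (?L - {v0}) ?X ?L id) (carrier (relative_homology_group n ?Y (?L - {v0})))"
      using iso by (simp add: iso_def bij_betw_def)
    have "homologous_rel n ?X ?L ?c 0" using assms by (simp add: homologous_rel_def)
    then show "hom_induced n ?Y (?L - {v0}) ?X ?L id (homologous_rel_set n ?Y (?L - {v0}) ?c) =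
      hom_induced n ?Y (?L - {v0}) ?X ?L id (homologous_rel_set n ?Y (?L - {v0}) 0)"
      unfolding hi[OF cyc] hi[OF singular_relcycle_0] cid chain_map_0 homologous_rel_set_eq .
  qed (use cyc in \<open>auto simp: carrier_relative_homology_group\<close>)
  then have rb: "singular_relboundary n ?Y (?L - {v0}) ?c"
    unfolding homologous_rel_set_eq by (simp add: homologous_rel_def)
  \<comment> \<open>Projection from vertex 0 in barycentric coordinates: the coordinate at 0 is
    dropped and the others are renormalised.\<close>
  define q :: "(nat \<Rightarrow> real) \<Rightarrow> nat \<Rightarrow> real" where "q = (\<lambda>y i. y (Suc i) / (1 - y 0))"
  have qimg: "q y \<in> standard_simplex n" if "y \<in> ?B - {v0}" for y
  proof -
    have y: "y \<in> standard_simplex (Suc n)" "y \<noteq> v0" using that simplex_bd_subset by auto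
    then have "y 0 \<noteq> 1" using v0 by blast
    with y have y0: "y 0 < 1" by (simp add: standard_simplex_def less_le)
    have sum: "(\<Sum>i\<le>n. y (Suc i)) = 1 - y 0" using y(1)
      by (simp add: standard_simplex_def sum.atMost_Suc_shift del: sum.atMost_Suc)
    have nn: "\<forall>i. 0 \<le> y i" using y(1) by (simp add: standard_simplex_def)
    have "y (Suc i) \<le> 1 - y 0" for i
    proof (cases "i \<le> n")
      case True then show ?thesis using sum nn member_le_sum[of i "{..n}" "\<lambda>i. y (Suc i)"] by simp
    next
      case False then show ?thesis using y(1) y0 by (simp add: standard_simplex_def)
    qed
    then show ?thesis using y0 nn y(1) sum
      by (auto simp: standard_simplex_def q_def divide_simps sum_divide_distrib[symmetric])
  qed
  have qcont: "continuous_map ?Y (simplex_top n) q"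
  proof -
    have "continuous_on (?B - {v0}) q"
      unfolding q_def
    proof (intro continuous_on_coordinatewise_then_product continuous_intros ballI)
      fix y assume "y \<in> ?B - {v0}"
      then show "1 - y 0 \<noteq> 0" using v0 simplex_bd_subset by force
    qed
    moreover have "?Y = subtopology (powertop_real UNIV) (?B - {v0})"
      by (simp add: subtopology_subtopology Int_absorb1)
    ultimately show ?thesis
      using qimg by (simp add: euclidean_product_topology continuous_map_simplex_iff[unfolded euclidean_product_topology] Pi_iff)
  qed
  have qL: "q \<in> (?L - {v0}) \<rightarrow> simplex_bd n"
  proof
    fix y assume y: "y \<in> ?L - {v0}"
    then obtain i where "i \<in> {1..Suc n}" "y i = 0" by (auto simp: simplex_horn_def)
    then have "q y (i - 1) = 0" "i - 1 \<le> n" by (auto simp: q_def)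
    moreover have "q y \<in> standard_simplex n" using qimg y simplex_horn_subset by blast
    ultimately show "q y \<in> simplex_bd n" by (auto simp: simplex_bd_def)
  qed
  have "chain_map n q ?c = frag_cmul m (frag_of (id_simplex n))"
  proof -
    have "simplex_map n q ?f = id_simplex n"
      by (auto simp: simplex_map_def singular_face_def fun_eq_iff q_def simplical_face_def
           simplical_face_in_standard_simplex[of "Suc n" 0, simplified, unfolded simplical_face_def, simplified])
    then show ?thesis by simp
  qed
  then show ?thesis
    using singular_relboundary_chain_map[OF rb qcont qL] by simp
qed

text \<open>The descent on the dimension alternates between a relation for the boundary of a simplex
  and a relation for one face modulo its own boundary. It ends in degree 0, where the augmentation
  of a boundary vanishes.\<close>

lemma bd_id_infinite_order:
  "singular_relboundary n (bd_top (Suc n)) {} (frag_cmul m (chain_boundary (Suc n) (frag_of (id_simplex (Suc n))))) \<Longrightarrow> m = 0"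
proof (induction n)
  \<comment> \<open>All faces but the one opposite vertex 0 lie in the horn, so modulo the horn the
    boundary is that face, a simplex of one dimension less.\<close>
  have red: "singular_relboundary n (simplex_top n) (simplex_bd n) (frag_cmul m (frag_of (id_simplex n)))"
    if R: "singular_relboundary n (bd_top (Suc n)) {} (frag_cmul m (chain_boundary (Suc n) (frag_of (id_simplex (Suc n)))))" for n
  proof (rule face_zero_relcycle_infinite_order)
    let ?F = "\<lambda>k. singular_face (Suc n) k (id_simplex (Suc n))"
    let ?e = "\<Sum>k\<in>{1..Suc n}. frag_cmul ((-1) ^ k) (frag_of (?F k))"
    have eq: "chain_boundary (Suc n) (frag_of (id_simplex (Suc n))) = frag_of (?F 0) + ?e"
      unfolding chain_boundary_id atMost_atLeast0 by (subst sum.atLeast_Suc_atMost) (auto simp del: sum.cl_ivl_Suc)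
    have e: "singular_chain n (subtopology (bd_top (Suc n)) (simplex_horn (Suc n))) ?e"
    proof (intro singular_chain_sum singular_chain_cmul)
      fix k assume "k \<in> {1..Suc n}"
      then show "singular_chain n (subtopology (bd_top (Suc n)) (simplex_horn (Suc n))) (frag_of (?F k))"
        unfolding singular_chain_of subtopology_subtopology
        by (intro singular_simplex_mono_sub[OF singular_face_id_bd]) (auto simp: simplex_horn_def simplex_bd_def)
    qed
    obtain d where d: "singular_chain (Suc n) (bd_top (Suc n)) d"
      "chain_boundary (Suc n) d = frag_cmul m (chain_boundary (Suc n) (frag_of (id_simplex (Suc n))))"
      using R unfolding singular_boundary by blast
    show "singular_relboundary n (bd_top (Suc n)) (simplex_horn (Suc n)) (frag_cmul m (frag_of (?F 0)))"
      unfolding singular_relboundary_alt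
      by (intro exI[of _ d] exI[of _ "frag_cmul m ?e"] conjI d(1) singular_chain_cmul e)
         (simp add: d(2) eq frag_cmul_distrib2)
  qed
  {
    case 0
    from red[OF this] have "singular_relboundary 0 (simplex_top 0) {} (frag_cmul m (frag_of (id_simplex 0)))"
      by (simp add: simplex_bd_0)
    then obtain d where "chain_boundary (Suc 0) d = frag_cmul m (frag_of (id_simplex 0))"
      unfolding singular_boundary by blast
    then have "frag_cmul m (frag_of ()) = 0"
      using chain_sum_boundary[of d] by simp
    then show ?case
      by (metis frag_cmul_eq_0_iff frag_of_nonzero)
  next
    case (Suc n)
    from red[OF Suc.prems] obtain d e where de: "singular_chain (Suc (Suc n)) (simplex_top (Suc n)) d"
      "singular_chain (Suc n) (subtopology (simplex_top (Suc n)) (simplex_bd (Suc n))) e"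
      "chain_boundary (Suc (Suc n)) d + e = frag_cmul m (frag_of (id_simplex (Suc n)))"
      unfolding singular_relboundary by blast
    \<comment> \<open>Applying the boundary turns the relative relation into one for the boundary of
      the smaller simplex: the correction term \<open>e\<close> itself is the bounding
      chain.\<close>
    have "chain_boundary (Suc n) e = frag_cmul m (chain_boundary (Suc n) (frag_of (id_simplex (Suc n))))"
      using arg_cong[OF de(3), of "chain_boundary (Suc n)"] chain_boundary_boundary[OF de(1)]
      by (simp add: chain_boundary_add chain_boundary_cmul)
    moreover have "subtopology (simplex_top (Suc n)) (simplex_bd (Suc n)) = bd_top (Suc n)"
      by (simp add: subtopology_subtopology Int_absorb1 simplex_bd_subset)
    ultimately show ?case
      using de(2) by (intro Suc.IH) (unfold singular_boundary, intro exI[of _ e], simp only:)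
  }
qed

section \<open>Boundaries of affine simplices\<close>

text \<open>Every homotopy of the proof has this form, so a comparison of two chains becomes a check
  that certain segments avoid a point or stay in a half space.\<close>

lemma homologous_straight:
  fixes f g :: "'b \<Rightarrow> 'w::real_normed_vector"
  assumes c: "singular_relcycle p Y S c"
    and f: "continuous_map Y euclidean f" and g: "continuous_map Y euclidean g"
    and A: "\<And>y s. y \<in> topspace Y \<Longrightarrow> 0 \<le> s \<Longrightarrow> s \<le> 1 \<Longrightarrow> (1 - s) *\<^sub>R f y + s *\<^sub>R g y \<in> A"
    and H: "\<And>y s. y \<in> S \<Longrightarrow> 0 \<le> s \<Longrightarrow> s \<le> 1 \<Longrightarrow> (1 - s) *\<^sub>R f y + s *\<^sub>R g y \<in> H"
  shows "homologous_rel p (top_of_set A) H (chain_map p f c) (chain_map p g c)"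
proof (rule homotopic_imp_homologous_rel_chain_maps[OF _ c])
  let ?h = "\<lambda>z. (1 - fst z) *\<^sub>R f (snd z) + fst z *\<^sub>R g (snd z)"
  let ?P = "prod_topology (top_of_set {0..1::real}) Y"
  have cf: "continuous_map ?P euclideanreal fst"
    by (rule continuous_map_into_fulltopology[OF continuous_map_fst])
  have cfs: "continuous_map ?P euclidean (\<lambda>z. f (snd z))" "continuous_map ?P euclidean (\<lambda>z. g (snd z))"
    using continuous_map_compose[OF continuous_map_snd f] continuous_map_compose[OF continuous_map_snd g]
    by (simp_all add: o_def)
  \<comment> \<open>\<open>Y\<close> is an abstract topology; the pointwise form with
    \<open>atin\<close> makes the limit rules for \<open>+\<close> and \<open>*\<^sub>R\<close>
    available.\<close>
  have "continuous_map ?P euclidean ?h"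
    unfolding continuous_map_atin
    using cf cfs unfolding continuous_map_atin
    by (auto intro!: tendsto_intros)
  then have "continuous_map ?P (top_of_set A) ?h"
    using A by (auto simp: continuous_map_in_subtopology)
  then show "homotopic_with (\<lambda>h. h \<in> S \<rightarrow> H) Y (top_of_set A) f g"
    unfolding homotopic_with_def using H by (intro exI[of _ ?h]) auto
qed

lemma chain_map_const:
  "chain_map p (\<lambda>_. a) c = frag_extend (\<lambda>_. frag_of (restrict (\<lambda>_. a) (standard_simplex p))) (chain_sum c)"
  using subset_UNIV
proof (induction c rule: frag_induction)
  case (one x)
  then show ?case by (simp add: simplex_map_def o_def restrict_def)
next
  case (diff a b)
  then show ?case by (simp add: chain_map_diff frag_extend_diff)
qed auto

text \<open>The straight contraction to a point \<open>a\<close> makes \<open>c\<close> homologous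
  to a chain at \<open>a\<close>. In positive degree cycles at a point bound; in degree 0 that chain
  is determined by \<open>chain_sum c\<close>.\<close>

lemma convex_cycle_relboundary:
  fixes H :: "'w::real_normed_vector set"
  assumes "convex H" and c: "singular_relcycle p (top_of_set H) {} c" and "p = 0 \<Longrightarrow> chain_sum c = 0"
  shows "singular_relboundary p (top_of_set H) {} c"
proof (cases "H = {}")
  case True
  then show ?thesis using c by (simp add: singular_cycle singular_chain_empty)
next
  case False
  then obtain a where a: "a \<in> H" by blast
  have "homologous_rel p (top_of_set H) {} (chain_map p id c) (chain_map p (\<lambda>_. a) c)"
  proof (rule homologous_straight[OF c])
    show "(1 - s) *\<^sub>R id y + s *\<^sub>R a \<in> H" if "y \<in> topspace (top_of_set H)" "0 \<le> s" "s \<le> 1" for y s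
      using convexD_alt[OF \<open>convex H\<close>, of y a s] a that by simp
  qed auto
  then have 1: "singular_relboundary p (top_of_set H) {} (c - chain_map p (\<lambda>_. a) c)"
    using chain_map_ident[of p "top_of_set H" c] c by (simp add: homologous_rel_def singular_cycle)
  have "singular_relboundary p (top_of_set H) {} (chain_map p (\<lambda>_. a) c)"
  proof (cases "p = 0")
    case True
    show ?thesis using True assms(3) by (simp add: chain_map_const)
  next
    case False
    have sub: "subtopology (top_of_set H) {a} = top_of_set {a}"
      using a by (simp add: subtopology_subtopology Int_absorb1)
    have "singular_relcycle p (top_of_set {a}) {} (chain_map p (\<lambda>_. a) c)"
      by (rule singular_relcycle_chain_map[OF c]) auto
    then have "singular_relboundary p (top_of_set {a}) {} (chain_map p (\<lambda>_. a) c)"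
      using singular_boundary_eq_cycle_singleton[of "top_of_set {a}" a p] False by simp
    then show ?thesis
      using singular_boundary_mono[of "{a}" H p euclidean] a by simp
  qed
  with 1 show ?thesis
    using singular_relboundary_add[OF 1] by fastforce
qed

text \<open>The part \<open>e\<close> of the relation that lies in \<open>H\<close> equals
  \<open>z - z'\<close> minus a boundary, hence is a cycle, and it bounds because \<open>H\<close>
  is convex. In degree 0 this takes the equality of the augmentations.\<close>

lemma homologous_rel_imp_homologous:
  fixes A H :: "'w::real_normed_vector set"
  assumes "convex H" "H \<subseteq> A" and z: "singular_relcycle p (top_of_set A) {} z"
    and z': "singular_relcycle p (top_of_set A) {} z'"
    and "p = 0 \<Longrightarrow> chain_sum z = chain_sum z'"
    and "homologous_rel p (top_of_set A) H z z'"
  shows "homologous_rel p (top_of_set A) {} z z'"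
proof -
  have sub: "subtopology (top_of_set A) H = top_of_set H"
    using assms(2) by (simp add: subtopology_subtopology Int_absorb1)
  from assms(6) obtain d e where de: "singular_chain (Suc p) (top_of_set A) d"
    "singular_chain p (top_of_set H) e" "chain_boundary (Suc p) d + e = z - z'"
    unfolding homologous_rel_def singular_relboundary sub by blast
  have e: "e = z - z' - chain_boundary (Suc p) d" using de(3) by (simp add: algebra_simps)
  have "chain_boundary p e = 0"
    using z z' chain_boundary_boundary[OF de(1)] unfolding e by (simp add: chain_boundary_diff singular_cycle)
  then have "singular_relcycle p (top_of_set H) {} e" using de(2) by (simp add: singular_cycle)
  moreover have "chain_sum e = 0" if "p = 0"
    unfolding e using assms(5)[OF that] that chain_sum_boundary[of d] by simp
  ultimately have "singular_relboundary p (top_of_set H) {} e"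
    by (rule convex_cycle_relboundary[OF assms(1)])
  then have "singular_relboundary p (top_of_set A) {} e"
    using singular_boundary_mono[OF assms(2)] by blast
  moreover have "singular_relboundary p (top_of_set A) {} (chain_boundary (Suc p) d)"
    using de(1) unfolding singular_boundary by blast
  ultimately have "singular_relboundary p (top_of_set A) {} (chain_boundary (Suc p) d + e)"
    by (intro singular_relboundary_add)
  then show ?thesis unfolding de(3) homologous_rel_def .
qed

text \<open>Unlike \<open>affine_simplex\<close> it is not restricted to the simplex, so it serves
  as a map on the boundary, on the horn and in compositions.\<close>

definition aff :: "nat \<Rightarrow> (nat \<Rightarrow> 'w::real_normed_vector) \<Rightarrow> (nat \<Rightarrow> real) \<Rightarrow> 'w"
  where "aff n l y = (\<Sum>j\<le>n. y j *\<^sub>R l j)"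

lemma continuous_aff: "continuous_on S (aff n l)"
  unfolding aff_def by (intro continuous_intros)

lemma affine_simplex_aff: "affine_simplex n l = simplex_map n (aff n l) (id_simplex n)"
  by (auto simp: affine_simplex_def aff_def simplex_map_def)

lemma frag_of_affine_simplex: "frag_of (affine_simplex n l) = chain_map n (aff n l) (frag_of (id_simplex n))"
  by (simp add: affine_simplex_aff)

abbreviation aff_bd :: "nat \<Rightarrow> (nat \<Rightarrow> 'w::real_normed_vector) \<Rightarrow> 'w chain"
  where "aff_bd n l \<equiv> chain_boundary n (frag_of (affine_simplex n l))"

lemma aff_bd_eq: "aff_bd (Suc n) l =
    chain_map n (aff (Suc n) l) (chain_boundary (Suc n) (frag_of (id_simplex (Suc n))))"
  unfolding frag_of_affine_simplex using chain_boundary_chain_map[OF singular_chain_id, of "Suc n"] by simp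

lemma chain_sum_aff_bd: "n = 0 \<Longrightarrow> chain_sum (aff_bd (Suc n) l) = 0"
  by (metis chain_sum_boundary)

lemma continuous_map_aff:
  "(\<And>y. y \<in> S \<Longrightarrow> aff n l y \<in> A) \<Longrightarrow>
    continuous_map (subtopology (powertop_real UNIV) S) (top_of_set A) (aff n l)"
  unfolding continuous_map_simplex_iff using continuous_aff by auto

lemma singular_cycle_aff_bd:
  assumes "\<And>y. y \<in> simplex_bd (Suc n) \<Longrightarrow> aff (Suc n) l y \<in> A"
  shows "singular_relcycle n (top_of_set A) {} (aff_bd (Suc n) l)"
  unfolding aff_bd_eq
  by (rule singular_relcycle_chain_map[OF singular_cycle_bd_id continuous_map_aff]) (use assms in auto)

text \<open>Moving the vertices linearly moves each point along a segment. Only points of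
  \<open>simplex_bd\<close> matter, since the chain is the image of the boundary of the universal
  simplex.\<close>

lemma homologous_aff_bd:
  assumes "\<And>y s. y \<in> simplex_bd (Suc n) \<Longrightarrow> 0 \<le> s \<Longrightarrow> s \<le> 1 \<Longrightarrow>
    aff (Suc n) (\<lambda>j. (1 - s) *\<^sub>R l j + s *\<^sub>R l' j) y \<in> A"
  shows "homologous_rel n (top_of_set A) {} (aff_bd (Suc n) l) (aff_bd (Suc n) l')"
  unfolding aff_bd_eq
proof (rule homologous_straight[OF singular_cycle_bd_id])
  have *: "(1 - s) *\<^sub>R aff (Suc n) l y + s *\<^sub>R aff (Suc n) l' y =
    aff (Suc n) (\<lambda>j. (1 - s) *\<^sub>R l j + s *\<^sub>R l' j) y" for y s
    by (simp add: aff_def scaleR_add_right scaleR_right.sum sum.distrib scaleR_scaleR mult.commute)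
  show "(1 - s) *\<^sub>R aff (Suc n) l y + s *\<^sub>R aff (Suc n) l' y \<in> A"
    if "y \<in> topspace (bd_top (Suc n))" "0 \<le> s" "s \<le> 1" for y s
    unfolding * using assms that by (simp add: euclidean_product_topology)
qed (use continuous_map_aff[of "simplex_bd (Suc n)" _ _ UNIV] in auto)

lemma singular_face_affine_simplex:
  assumes "k \<le> Suc n"
  shows "singular_face (Suc n) k (affine_simplex (Suc n) l) =
    affine_simplex n (\<lambda>j. if j < k then l j else l (Suc j))"
proof -
  have "(\<Sum>j\<le>Suc n. simplical_face k x j *\<^sub>R l j) = (\<Sum>j\<le>n. x j *\<^sub>R (if j < k then l j else l (Suc j)))"
    for x :: "nat \<Rightarrow> real"
    using sum.zero_middle[of "Suc n" k "\<lambda>j. x j *\<^sub>R l j" "\<lambda>j. x j *\<^sub>R l (Suc j)"] assms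
    unfolding simplical_face_def
    by (simp add: if_distrib[of "\<lambda>x. x *\<^sub>R _"] if_distrib[of "\<lambda>v. _ *\<^sub>R v"] atLeast0AtMost
        cong: if_cong sum.cong_simp del: sum.atMost_Suc)
  then show ?thesis
    using simplical_face_in_standard_simplex[of "Suc n" k] assms
    by (auto simp: singular_face_def affine_simplex_def restrict_def fun_eq_iff)
qed

text \<open>The retraction of the simplex onto the horn: equal amounts are taken from the
  coordinates 1 to n and given to coordinate 0 until one of them vanishes.\<close>

definition horn_retract :: "nat \<Rightarrow> (nat \<Rightarrow> real) \<Rightarrow> nat \<Rightarrow> real"
  where "horn_retract n y = (\<lambda>i. if i = 0 then y 0 + real n * (INF k\<in>{1..n}. y k)
      else if i \<le> n then y i - (INF k\<in>{1..n}. y k) else 0)"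

lemma INF_interval_le:
  fixes y :: "nat \<Rightarrow> real"
  assumes "i \<in> {1..Suc n}"
  shows "(INF k\<in>{1..Suc n}. y k) \<le> y i"
  using assms by (intro cINF_lower) auto

lemma INF_interval_attained:
  fixes y :: "nat \<Rightarrow> real"
  shows "\<exists>i\<in>{1..Suc n}. (INF k\<in>{1..Suc n}. y k) = y i"
proof -
  have "(INF k\<in>{1..Suc n}. y k) = Min (y ` {1..Suc n})" by (intro cInf_eq_Min) auto
  moreover have "Min (y ` {1..Suc n}) \<in> y ` {1..Suc n}" by (rule Min_in) auto
  ultimately have "(INF k\<in>{1..Suc n}. y k) \<in> y ` {1..Suc n}" by (rule ssubst)
  then show ?thesis by (rule imageE) blast
qed

lemma continuous_on_horn_retract: "continuous_on S (horn_retract (Suc n))"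
proof -
  let ?N = "Suc n"
  let ?m = "\<lambda>y::nat \<Rightarrow> real. INF k\<in>{1..?N}. y k"
  have mMin: "?m y = Min (y ` {1..?N})" for y by (intro cInf_eq_Min) auto
  have mcont: "continuous_on S ?m" for S
  proof -
    have "continuous_on S (\<lambda>y::nat \<Rightarrow> real. Min (y ` {1..k}))" if "k \<ge> 1" for k
      using that
    proof (induction k rule: dec_induct)
      case base
      then show ?case by (simp add: continuous_on_eval)
    next
      case (step k)
      have "y ` {1..Suc k} = insert (y (Suc k)) (y ` {1..k})" for y :: "nat \<Rightarrow> real"
        by (simp add: atLeastAtMostSuc_conv)
      moreover have "y ` {1..k} \<noteq> {}" for y :: "nat \<Rightarrow> real" using step by auto
      ultimately have "Min (y ` {1..Suc k}) = min (y (Suc k)) (Min (y ` {1..k}))" for y :: "nat \<Rightarrow> real" by simp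
      then show ?case using step by (auto intro: continuous_intros)
    qed
    then show ?thesis unfolding mMin by simp
  qed
  show ?thesis
  proof (intro continuous_on_coordinatewise_then_product)
    fix i
    show "continuous_on S (\<lambda>y. horn_retract ?N y i)"
      unfolding horn_retract_def using mcont[of S]
      by (cases "i = 0"; cases "i \<le> ?N") (auto intro!: continuous_intros simp del: of_nat_Suc)
  qed
qed

lemma horn_retract_in_horn:
  assumes yN: "y \<in> standard_simplex (Suc n)"
  shows "horn_retract (Suc n) y \<in> simplex_horn (Suc n)"
proof -
  let ?N = "Suc n"
  let ?m = "\<lambda>y::nat \<Rightarrow> real. INF k\<in>{1..?N}. y k"
  let ?r = "horn_retract ?N"
  obtain i where i: "i \<in> {1..?N}" "?m y = y i" using INF_interval_attained by blast
  have y: "\<forall>i. 0 \<le> y i \<and> y i \<le> 1" "\<forall>i>?N. y i = 0" "(\<Sum>i\<le>?N. y i) = 1" using yN by (auto simp: standard_simplex_def)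
  have sum: "(\<Sum>i\<le>?N. ?r y i) = 1"
    using y(3) unfolding sum.atMost_Suc_shift by (simp add: horn_retract_def sum_subtractf del: sum.atMost_Suc)
  have nn: "0 \<le> ?r y i" for i
    using y(1) INF_interval_le[of i n y] i by (auto simp: horn_retract_def)
  have "?r y j \<le> 1" for j
  proof (cases "j \<le> ?N")
    case True
    then show ?thesis using member_le_sum[of j "{..?N}" "?r y"] nn sum by simp
  qed (simp add: horn_retract_def)
  then have "?r y \<in> standard_simplex ?N" using sum nn by (auto simp: standard_simplex_def horn_retract_def)
  moreover have "?r y i = 0" using i by (simp add: horn_retract_def)
  ultimately show ?thesis using i(1) by (auto simp: simplex_horn_def)
qed

lemma horn_retract_id:
  assumes yh: "y \<in> simplex_horn (Suc n)"
  shows "horn_retract (Suc n) y = y"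
proof -
  let ?N = "Suc n"
  let ?m = "\<lambda>y::nat \<Rightarrow> real. INF k\<in>{1..?N}. y k"
  have y: "y \<in> standard_simplex ?N" using yh by (simp add: simplex_horn_def)
  obtain i where i: "i \<in> {1..?N}" "y i = 0" using yh by (auto simp: simplex_horn_def)
  have "?m y \<le> 0" using INF_interval_le[OF i(1), of y] i(2) by simp
  moreover have "0 \<le> ?m y" using INF_interval_attained[of n y] y by (auto simp: standard_simplex_def)
  ultimately have "?m y = 0" by simp
  then show ?thesis using y by (auto simp: horn_retract_def fun_eq_iff standard_simplex_def)
qed

text \<open>The simplex \<open>l\<close> composed with the horn retraction lies in \<open>A\<close>
  and shares with \<open>l\<close> all faces except the one opposite vertex 0. Its boundary bounds
  in \<open>A\<close>, and subtracting it from the boundary of \<open>l\<close> leaves the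
  difference of the two exceptional faces.\<close>

lemma homologous_horn:
  assumes "\<And>y. y \<in> simplex_horn (Suc n) \<Longrightarrow> aff (Suc n) l y \<in> A"
  shows "homologous_rel n (top_of_set A) {} (aff_bd (Suc n) l)
     (frag_of (affine_simplex n (l \<circ> Suc)) -
      frag_of (\<lambda>y\<in>standard_simplex n. aff (Suc n) l (horn_retract (Suc n) (simplical_face 0 y))))"
proof -
  let ?N = "Suc n"
  let ?r = "horn_retract ?N"
  let ?s = "\<lambda>y\<in>standard_simplex ?N. aff ?N l (?r y)"
  note r_horn = horn_retract_in_horn and rid = horn_retract_id and rcont = continuous_on_horn_retract
  have "continuous_on (standard_simplex ?N) (\<lambda>y. aff ?N l (?r y))"
    by (rule continuous_on_compose2[OF continuous_aff[of UNIV] rcont]) auto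
  then have "singular_simplex ?N (top_of_set A) ?s"
    unfolding singular_simplex_def continuous_map_simplex_iff
    using assms r_horn by (auto cong: continuous_on_cong)
  then have "singular_chain ?N (top_of_set A) (frag_of ?s)" by (simp add: singular_chain_of)
  then have bd: "singular_relboundary n (top_of_set A) {} (chain_boundary ?N (frag_of ?s))"
    unfolding singular_boundary by blast
  let ?\<sigma> = "affine_simplex ?N l"
  have faces: "singular_face ?N k ?s = singular_face ?N k ?\<sigma>" if "k \<in> {1..?N}" for k
  proof -
    have "simplical_face k y \<in> simplex_horn ?N" if "y \<in> standard_simplex n" for y
      using simplical_face_in_standard_simplex[of ?N k y] that \<open>k \<in> {1..?N}\<close>
      by (auto simp: simplex_horn_def simplical_face_def)
    then show ?thesis
      using rid simplex_horn_subset simplex_bd_subset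
      by (auto simp: singular_face_def fun_eq_iff affine_simplex_def aff_def subset_iff del: sum.atMost_Suc)
  qed
  have split: "chain_boundary ?N (frag_of f) = frag_of (singular_face ?N 0 f) +
     (\<Sum>k\<in>{1..?N}. frag_cmul ((-1) ^ k) (frag_of (singular_face ?N k f)))" for f :: "(nat \<Rightarrow> real) \<Rightarrow> 'a"
    unfolding chain_boundary_of atMost_atLeast0 by (simp add: sum.atLeast_Suc_atMost del: sum.cl_ivl_Suc)
  have "aff_bd ?N l - (frag_of (singular_face ?N 0 ?\<sigma>) - frag_of (singular_face ?N 0 ?s))
     = chain_boundary ?N (frag_of ?s)"
    unfolding split using faces by simp
  moreover have "singular_face ?N 0 ?\<sigma> = affine_simplex n (l \<circ> Suc)"
    by (simp add: singular_face_affine_simplex o_def)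
  moreover have "singular_face ?N 0 ?s = (\<lambda>y\<in>standard_simplex n. aff ?N l (?r (simplical_face 0 y)))"
    using simplical_face_in_standard_simplex[of ?N 0] by (auto simp: singular_face_def fun_eq_iff)
  ultimately show ?thesis using bd by (simp add: homologous_rel_def)
qed

text \<open>All other faces of the degenerate simplex \<open>[l k, l 0, \<dots>, l n]\<close> lie in a face of \<open>[l 0, \<dots>, l n]\<close>.\<close>

lemma homologous_cycle_vertex:
  assumes A: "\<And>y. y \<in> simplex_bd (Suc n) \<Longrightarrow> aff (Suc n) l y \<in> A" and k: "k \<le> Suc n"
  shows "homologous_rel n (top_of_set A) {} (aff_bd (Suc n) l)
     (frag_cmul ((-1) ^ k) (aff_bd (Suc n) (\<lambda>j. if j = 0 then l k else if j \<le> k then l (j - 1) else l j)))"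
proof -
  let ?N = "Suc n"
  define L where "L = (\<lambda>j. if j = 0 then l k else l (j - 1))"
  define E where "E i = (\<lambda>j. if j < i then L j else L (Suc j))" for i
  let ?H = "homologous_rel n (top_of_set A) {}"
  let ?t = "\<lambda>i. frag_cmul ((-1) ^ i) (aff_bd ?N (E i))"
  have "singular_chain (Suc ?N) (top_of_set UNIV) (frag_of (affine_simplex (Suc ?N) L))"
    unfolding frag_of_affine_simplex by (rule singular_chain_chain_map[OF singular_chain_id continuous_map_aff]) auto
  \<comment> \<open>The double boundary of \<open>L\<close> relates the boundaries of its faces
    \<open>E i\<close>. Omitting either copy of \<open>l k\<close> gives \<open>E 0 = l\<close> and
    the rearranged simplex \<open>E (Suc k)\<close>; the remaining terms bound.\<close>
  from chain_boundary_boundary[OF this]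
  have "chain_boundary ?N (\<Sum>i\<le>Suc ?N. frag_cmul ((-1) ^ i) (frag_of (affine_simplex ?N (E i)))) = 0"
    by (simp add: chain_boundary_of singular_face_affine_simplex E_def del: sum.atMost_Suc cong: sum.cong_simp)
  then have sum0: "(\<Sum>i\<le>Suc ?N. ?t i) = 0"
    by (simp add: chain_boundary_sum o_def chain_boundary_cmul del: sum.atMost_Suc)
  have deg: "?H (?t i) 0" if i: "i \<le> Suc ?N" "i \<noteq> 0" "i \<noteq> Suc k" for i
  proof -
    have "aff ?N (E i) y \<in> A" if y: "y \<in> standard_simplex ?N" for y
    proof -
      text \<open>\<open>z\<close> collects the weights of \<open>y\<close> on the vertices of \<open>l\<close>; it vanishes at \<open>i - 1\<close>.\<close>
      define \<phi> where "\<phi> j = (let j' = if j < i then j else Suc j in if j' = 0 then k else j' - 1)" for j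
      have E\<phi>: "E i j = l (\<phi> j)" for j by (auto simp: E_def L_def \<phi>_def Let_def)
      have \<phi>le: "\<phi> j \<le> ?N" if "j \<le> ?N" for j using that k i by (auto simp: \<phi>_def Let_def)
      have \<phi>i: "\<phi> j \<noteq> i - 1" if "j \<le> ?N" for j using that i by (auto simp: \<phi>_def Let_def)
      define z where "z m = (\<Sum>j\<in>{j\<in>{..?N}. \<phi> j = m}. y j)" for m
      have yp: "0 \<le> y j" for j using y by (simp add: standard_simplex_def)
      have zsum: "(\<Sum>m\<le>?N. z m) = 1"
        unfolding z_def using y \<phi>le by (subst sum.group) (auto simp: standard_simplex_def simp del: sum.atMost_Suc)
      have z0: "0 \<le> z m" for m unfolding z_def by (intro sum_nonneg yp)
      have zbig: "z m = 0" if "m > ?N" for m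
        unfolding z_def using \<phi>le that by (intro sum.neutral) force
      have "z m \<le> 1" for m
      proof (cases "m \<le> ?N")
        case True
        then show ?thesis using member_le_sum[of m "{..?N}" z] z0 zsum by simp
      qed (simp add: zbig)
      then have "z \<in> standard_simplex ?N" using z0 zsum zbig by (auto simp: standard_simplex_def)
      moreover have "z (i - 1) = 0" unfolding z_def using \<phi>i by (intro sum.neutral) blast
      ultimately have "z \<in> simplex_bd ?N" using i by (auto simp: simplex_bd_def intro!: exI[of _ "i - 1"])
      then have "aff ?N l z \<in> A" by (rule A)
      also have "aff ?N l z = (\<Sum>m\<le>?N. \<Sum>j\<in>{j\<in>{..?N}. \<phi> j = m}. y j *\<^sub>R l (\<phi> j))"
        unfolding aff_def z_def scaleR_sum_left by (intro sum.cong refl) auto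
      also have "\<dots> = (\<Sum>j\<le>?N. y j *\<^sub>R l (\<phi> j))"
        by (rule sum.group) (use \<phi>le in auto)
      finally show ?thesis by (simp add: aff_def E\<phi> del: sum.atMost_Suc)
    qed
    then have "singular_chain ?N (top_of_set A) (frag_of (affine_simplex ?N (E i)))"
      unfolding frag_of_affine_simplex by (intro singular_chain_chain_map[OF singular_chain_id continuous_map_aff]) auto
    then have "singular_relboundary n (top_of_set A) {} (aff_bd ?N (E i))"
      unfolding singular_boundary by blast
    then show ?thesis by (simp add: homologous_rel_def singular_relboundary_cmul)
  qed
  have "?H (\<Sum>i\<in>{..Suc ?N} - {0, Suc k}. ?t i) (\<Sum>i\<in>{..Suc ?N} - {0, Suc k}. 0)"
    by (rule homologous_rel_sum) (use deg in auto)
  moreover have "(\<Sum>i\<in>{..Suc ?N} - {0, Suc k}. ?t i) = - ?t 0 - ?t (Suc k)"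
    using sum0 sum.subset_diff[of "{0, Suc k}" "{..Suc ?N}" ?t] k by (simp add: algebra_simps eq_neg_iff_add_eq_0 del: sum.atMost_Suc)
  ultimately have "?H (- ?t 0 - ?t (Suc k)) 0" by simp
  then have "singular_relboundary n (top_of_set A) {} (- ?t 0 - ?t (Suc k))" by (simp add: homologous_rel_def)
  then have "singular_relboundary n (top_of_set A) {} (- (- ?t 0 - ?t (Suc k)))"
    by (simp only: singular_relboundary_minus)
  also have "- (- ?t 0 - ?t (Suc k)) = aff_bd ?N (E 0) - frag_cmul ((-1) ^ k) (aff_bd ?N (E (Suc k)))"
    by simp
  also have "E 0 = l" by (auto simp: E_def L_def)
  also have "E (Suc k) = (\<lambda>j. if j = 0 then l k else if j \<le> k then l (j - 1) else l j)"
    by (auto simp: E_def L_def)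
  finally show ?thesis by (simp add: homologous_rel_def)
qed

lemma frag_cmul_uminus: "frag_cmul k (- a) = - frag_cmul k a"
proof -
  have "frag_cmul k (- a) + frag_cmul k a = 0" using frag_cmul_distrib2[of k "- a" a] by simp
  then show ?thesis by (simp only: eq_neg_iff_add_eq_0)
qed

lemma homologous_rel_cmul: "homologous_rel p X S a b \<Longrightarrow> homologous_rel p X S (frag_cmul k a) (frag_cmul k b)"
  unfolding homologous_rel_def
  by (drule singular_relboundary_cmul[where a=k])
     (metis add_diff_cancel_right' diff_add_cancel frag_cmul_distrib2)

lemma homologous_rel_empty_imp: "homologous_rel p X {} a b \<Longrightarrow> homologous_rel p X S a b"
  unfolding homologous_rel_def singular_boundary
  by (metis mod_subset_refl singular_relboundary_def)

lemma homologous_rel_minus: "homologous_rel p X S a b \<Longrightarrow> homologous_rel p X S (- a) (- b)"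
  using homologous_rel_cmul[of p X S a b "-1"] by simp

text \<open>A transposition as a product of cycles: bringing vertex \<open>k\<close> to the front
  costs (-1)^k for \<open>l\<close> and for the swapped \<open>m\<close>, and the two results differ
  in the order of their first two vertices, which is a cycle with k = 1.\<close>

lemma homologous_swap_vertex:
  assumes A: "\<And>y. y \<in> simplex_bd (Suc n) \<Longrightarrow> aff (Suc n) l y \<in> A" and k: "1 \<le> k" "k \<le> Suc n"
  shows "homologous_rel n (top_of_set A) {} (aff_bd (Suc n) l)
     (- aff_bd (Suc n) (\<lambda>j. if j = 0 then l k else if j = k then l 0 else l j))"
proof -
  let ?N = "Suc n" and ?H = "homologous_rel n (top_of_set A) {}"
  define c where "c k l = (\<lambda>j. if j = 0 then l k else if j \<le> k then l (j - 1) else l j)" for k and l :: "nat \<Rightarrow> 'a"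
  define m where "m = (\<lambda>j. if j = 0 then l k else if j = k then l 0 else l j)"
  \<comment> \<open>Permuting the vertices permutes the barycentric coordinates and leaves the image
    of \<open>simplex_bd\<close> unchanged, so the assumption on \<open>A\<close> holds for every
    arrangement.\<close>
  have reidx: "aff ?N (l \<circ> \<pi>) y \<in> A" if \<pi>: "\<pi> permutes {..?N}" and y: "y \<in> simplex_bd ?N" for \<pi> y
  proof -
    have inv: "inv_into UNIV \<pi> permutes {..?N}" using \<pi> by (rule permutes_inv)
    have y': "y \<in> standard_simplex ?N" using y simplex_bd_subset by blast
    have "(\<Sum>i\<le>?N. y (inv_into UNIV \<pi> i)) = (\<Sum>i\<le>?N. y i)"
      using sum.permute[OF inv, of y] by (simp add: o_def)
    moreover have "inv_into UNIV \<pi> i = i" if "i > ?N" for i using permutes_not_in[OF inv] that by auto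
    ultimately have 1: "y \<circ> inv_into UNIV \<pi> \<in> standard_simplex ?N"
      using y' by (auto simp: standard_simplex_def)
    obtain i where i: "i \<le> ?N" "y i = 0" using y by (auto simp: simplex_bd_def)
    then have "\<pi> i \<le> ?N" "(y \<circ> inv_into UNIV \<pi>) (\<pi> i) = 0"
      using permutes_in_image[OF \<pi>, of i] permutes_inverses(2)[OF \<pi>] by auto
    with 1 have "y \<circ> inv_into UNIV \<pi> \<in> simplex_bd ?N" unfolding simplex_bd_def by blast
    then have "aff ?N l (y \<circ> inv_into UNIV \<pi>) \<in> A" by (rule A)
    also have "aff ?N l (y \<circ> inv_into UNIV \<pi>) = aff ?N (l \<circ> \<pi>) y"
      unfolding aff_def using sum.permute[OF \<pi>, of "\<lambda>j. y (inv_into UNIV \<pi> j) *\<^sub>R l j"] permutes_inverses(2)[OF \<pi>]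
      by (simp add: o_def del: sum.atMost_Suc)
    finally show ?thesis .
  qed
  have m: "m = l \<circ> Transposition.transpose 0 k" using k by (auto simp: m_def fun_eq_iff transpose_def)
  have mA: "aff ?N m y \<in> A" if "y \<in> simplex_bd ?N" for y
    unfolding m by (rule reidx[OF permutes_swap_id that]) (use k in auto)
  have cyc: "?H (aff_bd ?N l) (frag_cmul ((-1) ^ k) (aff_bd ?N (c k l)))"
    if "\<And>y. y \<in> simplex_bd ?N \<Longrightarrow> aff ?N l y \<in> A" "k \<le> ?N" for k l
    using homologous_cycle_vertex[OF that] by (simp add: c_def)
  have 1: "?H (aff_bd ?N l) (frag_cmul ((-1) ^ k) (aff_bd ?N (c k l)))"
    by (rule cyc[OF A k(2)])
  have 2: "?H (aff_bd ?N m) (frag_cmul ((-1) ^ k) (aff_bd ?N (c k m)))"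
    by (rule cyc[OF mA k(2)])
  have c1: "c 1 (c k m) = c k l"
    using k by (auto simp: c_def m_def fun_eq_iff)
  have "bij_betw (\<lambda>j. if j = 0 then k else if j \<le> k then j - 1 else j) {..?N} {..?N}"
    by (rule bij_betw_byWitness[where f' = "\<lambda>j. if j = k then 0 else if j < k then Suc j else j"]) (use k in \<open>auto split: if_splits\<close>)
  then have "(\<lambda>j. if j = 0 then k else if j \<le> k then j - 1 else j) permutes {..?N}"
    by (rule bij_imp_permutes) (use k in auto)
  from permutes_compose[OF this permutes_swap_id[of 0 "{..?N}" k]]
  have perm: "Transposition.transpose 0 k \<circ> (\<lambda>j. if j = 0 then k else if j \<le> k then j - 1 else j) permutes {..?N}"
    using k by auto
  have "c k m = l \<circ> (Transposition.transpose 0 k \<circ> (\<lambda>j. if j = 0 then k else if j \<le> k then j - 1 else j))"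
    by (auto simp: c_def m fun_eq_iff)
  then have ckA: "aff ?N (c k m) y \<in> A" if "y \<in> simplex_bd ?N" for y
    using reidx[OF perm that] by simp
  have "?H (aff_bd ?N (c k m)) (frag_cmul ((-1) ^ 1) (aff_bd ?N (c 1 (c k m))))"
    by (rule cyc[OF ckA]) auto
  then have "?H (aff_bd ?N (c k m)) (- aff_bd ?N (c k l))" unfolding c1 by simp
  from homologous_rel_trans[OF homologous_rel_cmul[OF this, of "(-1) ^ k"] 2]
  have "?H (- aff_bd ?N m) (- frag_cmul ((-1) ^ k) (- aff_bd ?N (c k l)))"
    by (rule homologous_rel_minus)
  also have "- frag_cmul ((-1) ^ k) (- aff_bd ?N (c k l)) = frag_cmul ((-1) ^ k) (aff_bd ?N (c k l))"
    by (simp only: frag_cmul_uminus minus_minus)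
  finally have "?H (aff_bd ?N l) (- aff_bd ?N m)"
    using 1 by (metis homologous_rel_sym homologous_rel_trans)
  then show ?thesis by (simp add: m_def)
qed

section \<open>Dual bases and determinants\<close>

lemma blinfun_interpolation:
  fixes b :: "nat \<Rightarrow> 'v::euclidean_space"
  assumes "inj_on b A" "independent (b ` A)"
  obtains f :: "'v \<Rightarrow>\<^sub>L real" where "\<And>j. j \<in> A \<Longrightarrow> blinfun_apply f (b j) = c j"
proof -
  obtain g where g: "linear g" "\<forall>y\<in>b ` A. g y = c (inv_into A b y)"
    using linear_independent_extend[OF assms(2), of "\<lambda>y. c (inv_into A b y)"] by blast
  then have "blinfun_apply (Blinfun g) (b j) = c j" if "j \<in> A" for j
    using that assms(1) by (simp add: bounded_linear_Blinfun_apply linear_conv_bounded_linear)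
  then show ?thesis using that by blast
qed

lemma blinfun_eq_spanning:
  fixes f g :: "'v::euclidean_space \<Rightarrow>\<^sub>L real"
  assumes "span (b ` A) = UNIV" "\<And>j. j \<in> A \<Longrightarrow> blinfun_apply f (b j) = blinfun_apply g (b j)"
  shows "f = g"
proof (rule blinfun_eqI)
  fix z
  have "linear (blinfun_apply f)" "linear (blinfun_apply g)"
    by (simp_all add: bounded_linear.linear[OF blinfun.bounded_linear_right])
  from linear_eq_on_span[OF this, of "b ` A" z] show "blinfun_apply f z = blinfun_apply g z"
    using assms by auto
qed

abbreviation dual :: "(nat \<Rightarrow> 'v::euclidean_space) \<Rightarrow> nat \<Rightarrow> 'v \<Rightarrow>\<^sub>L real"
  where "dual b \<equiv> dual_vec b {..<DIM('v)}"

lemma dual_vec_eqI: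
  fixes b :: "nat \<Rightarrow> 'v::euclidean_space"
  assumes "span (b ` A) = UNIV" "\<And>j. j \<in> A \<Longrightarrow> blinfun_apply f (b j) = (if j = i then 1 else 0)"
  shows "dual_vec b A i = f"
  unfolding dual_vec_def
  by (rule the_equality) (use assms in \<open>auto intro!: blinfun_eq_spanning[OF assms(1)]\<close>)

lemma dual_vec_apply:
  fixes b :: "nat \<Rightarrow> 'v::euclidean_space"
  assumes "inj_on b A" "independent (b ` A)" "span (b ` A) = UNIV" "j \<in> A"
  shows "blinfun_apply (dual_vec b A i) (b j) = (if j = i then 1 else 0)"
proof -
  obtain f :: "'v \<Rightarrow>\<^sub>L real" where f: "\<And>j. j \<in> A \<Longrightarrow> blinfun_apply f (b j) = (if j = i then 1 else 0)"
    using blinfun_interpolation[OF assms(1,2), of "\<lambda>j. if j = i then 1 else 0"] by blast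
  then have "dual_vec b A i = f" by (intro dual_vec_eqI[OF assms(3)])
  then show ?thesis using f assms(4) by simp
qed

lemma dual_apply:
  fixes b :: "nat \<Rightarrow> 'v::euclidean_space"
  assumes "ordered_basis b" "j < DIM('v)"
  shows "blinfun_apply (dual b i) (b j) = (if j = i then 1 else 0)"
  by (rule dual_vec_apply) (use assms in \<open>auto simp: ordered_basis_def\<close>)

lemma dual_eqI:
  fixes b :: "nat \<Rightarrow> 'v::euclidean_space"
  assumes "ordered_basis b" "\<And>j. j < DIM('v) \<Longrightarrow> blinfun_apply f (b j) = (if j = i then 1 else 0)"
  shows "dual b i = f"
  by (rule dual_vec_eqI) (use assms in \<open>auto simp: ordered_basis_def\<close>)

lemma basis_expand:
  fixes b :: "nat \<Rightarrow> 'v::euclidean_space"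
  assumes b: "ordered_basis b"
  shows "w = (\<Sum>k<DIM('v). blinfun_apply (dual b k) w *\<^sub>R b k)"
proof -
  have "w \<in> span (b ` {..<DIM('v)})" using b by (simp add: ordered_basis_def)
  then obtain c where c: "w = (\<Sum>y\<in>b ` {..<DIM('v)}. c y *\<^sub>R y)"
    by (auto simp: span_finite)
  then have w: "w = (\<Sum>k<DIM('v). c (b k) *\<^sub>R b k)"
    using b by (simp add: sum.reindex ordered_basis_def)
  have "blinfun_apply (dual b k) w = c (b k)" if "k < DIM('v)" for k
    using that by (subst w) (simp add: blinfun.bilinear_simps blinfun.sum_right dual_apply[OF b] if_distrib cong: if_cong)
  with w show ?thesis by simp
qed

lemma ordered_basisI:
  fixes b :: "nat \<Rightarrow> 'v::euclidean_space"
  assumes "\<And>c k. (\<Sum>k<DIM('v). c k *\<^sub>R b k) = 0 \<Longrightarrow> k < DIM('v) \<Longrightarrow> c k = 0"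
  shows "ordered_basis b"
proof -
  let ?A = "{..<DIM('v)}"
  have inj: "inj_on b ?A"
  proof (rule inj_onI, rule ccontr)
    fix i j assume ij: "i \<in> ?A" "j \<in> ?A" "b i = b j" "i \<noteq> j"
    let ?c = "\<lambda>k. (if k = i then 1 else 0) - (if k = j then 1 else 0) :: real"
    have "(\<Sum>k<DIM('v). ?c k *\<^sub>R b k) = 0"
      using ij by (simp add: scaleR_left_diff_distrib sum_subtractf if_distrib[of "\<lambda>r. r *\<^sub>R _"] cong: if_cong)
    from assms[OF this, of i] ij show False by simp
  qed
  have ind: "independent (b ` ?A)"
    unfolding independent_explicit_finite_subsets
  proof (intro allI impI ballI)
    fix S u y assume S: "S \<subseteq> b ` ?A" "finite S" "(\<Sum>y\<in>S. u y *\<^sub>R y) = 0" "y \<in> S"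
    have "(\<Sum>k<DIM('v). (if b k \<in> S then u (b k) else 0) *\<^sub>R b k) = (\<Sum>y\<in>b ` ?A. (if y \<in> S then u y else 0) *\<^sub>R y)"
      using inj by (simp add: sum.reindex)
    also have "\<dots> = (\<Sum>y\<in>S. u y *\<^sub>R y)"
      using S(1) by (intro sum.mono_neutral_cong_right) auto
    finally have 0: "(\<Sum>k<DIM('v). (if b k \<in> S then u (b k) else 0) *\<^sub>R b k) = 0" using S(3) by simp
    obtain k where "k < DIM('v)" "y = b k" using S by auto
    then show "u y = 0" using assms[OF 0, of k] S(4) by simp
  qed
  have "UNIV \<subseteq> span (b ` ?A)"
    by (rule card_ge_dim_independent) (use ind inj in \<open>auto simp: card_image dim_UNIV\<close>)
  then show ?thesis using inj ind by (auto simp: ordered_basis_def)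
qed

lemma ordered_basis_dual:
  fixes b :: "nat \<Rightarrow> 'v::euclidean_space"
  assumes "\<And>i j. i < DIM('v) \<Longrightarrow> j < DIM('v) \<Longrightarrow> blinfun_apply (f i) (b j) = (if j = i then 1 else 0 :: real)"
  shows "ordered_basis b" "\<And>i. i < DIM('v) \<Longrightarrow> dual b i = f i"
proof -
  show *: "ordered_basis b"
  proof (rule ordered_basisI)
    fix c k assume 0: "(\<Sum>k<DIM('v). c k *\<^sub>R b k) = 0" and k: "k < DIM('v)"
    have "blinfun_apply (f k) (\<Sum>k<DIM('v). c k *\<^sub>R b k) = (\<Sum>j<DIM('v). c j * (if j = k then 1 else 0))"
      unfolding blinfun.sum_right blinfun.scaleR_right using k assms by (intro sum.cong) auto
    then have "blinfun_apply (f k) (\<Sum>k<DIM('v). c k *\<^sub>R b k) = c k" using k by (simp add: if_distrib cong: if_cong)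
    then show "c k = 0" unfolding 0 by simp
  qed
  show "dual b i = f i" if "i < DIM('v)" for i
    by (rule dual_eqI[OF *]) (use assms that in auto)
qed

lemma ordered_basis_upd:
  fixes b :: "nat \<Rightarrow> 'v::euclidean_space"
  assumes b: "ordered_basis b" and i: "i < DIM('v)" and r: "blinfun_apply (dual b i) w = r" "r \<noteq> 0"
  shows "ordered_basis (b(i := w))"
    and "\<And>k. k < DIM('v) \<Longrightarrow> dual (b(i := w)) k =
       (if k = i then (1 / r) *\<^sub>R dual b i else dual b k - (blinfun_apply (dual b k) w / r) *\<^sub>R dual b i)"
proof -
  let ?f = "\<lambda>k. if k = i then (1 / r) *\<^sub>R dual b i else dual b k - (blinfun_apply (dual b k) w / r) *\<^sub>R dual b i"
  have *: "blinfun_apply (?f k) ((b(i := w)) j) = (if j = k then 1 else 0)" if "k < DIM('v)" "j < DIM('v)" for k j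
    using that r i by (auto simp: blinfun.bilinear_simps dual_apply[OF b])
  show "ordered_basis (b(i := w))"
    by (rule ordered_basis_dual(1)[of ?f, OF *])
  show "dual (b(i := w)) k = ?f k" if "k < DIM('v)" for k
    by (rule ordered_basis_dual(2)[of ?f, OF * that])
qed

text \<open>An induction over replacements of single vectors. As \<open>ordered_basis\<close> only
  concerns the indices below the dimension, the target \<open>b\<close> is reached up to agreement
  there.\<close>

lemma basis_exchange:
  fixes e b :: "nat \<Rightarrow> 'v::euclidean_space"
  assumes e: "ordered_basis e" and b: "ordered_basis b" and "P e"
    and step: "\<And>c i w. ordered_basis c \<Longrightarrow> P c \<Longrightarrow> i < DIM('v) \<Longrightarrow> blinfun_apply (dual c i) w \<noteq> 0 \<Longrightarrow> P (c(i := w))"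
  obtains c where "P c" "\<And>k. k < DIM('v) \<Longrightarrow> c k = b k"
proof -
  have "\<exists>c. ordered_basis c \<and> P c \<and> (\<forall>k<m. c k = b k)" if "m \<le> DIM('v)" for m
    using that
  proof (induction m)
    case 0
    then show ?case using e \<open>P e\<close> by blast
  next
    case (Suc m)
    then have m: "m < DIM('v)" by simp
    from Suc obtain c where c: "ordered_basis c" "P c" "\<And>k. k < m \<Longrightarrow> c k = b k" by auto
    \<comment> \<open>Otherwise \<open>b m\<close> would be a combination of the \<open>b k\<close>
      with k < m, against the dual functional of \<open>b\<close> at \<open>m\<close>.\<close>
    have "\<exists>j\<ge>m. j < DIM('v) \<and> blinfun_apply (dual c j) (b m) \<noteq> 0"
    proof (rule ccontr)
      assume "\<not> ?thesis"
      then have 0: "blinfun_apply (dual c j) (b m) = 0" if "j \<ge> m" "j < DIM('v)" for j using that by blast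
      have "b m = (\<Sum>k<DIM('v). blinfun_apply (dual c k) (b m) *\<^sub>R c k)" by (rule basis_expand[OF c(1)])
      also have "\<dots> = (\<Sum>k<DIM('v). (if k < m then blinfun_apply (dual c k) (b m) else 0) *\<^sub>R b k)"
        using 0 c(3) by (intro sum.cong) auto
      finally have "blinfun_apply (dual b m) (b m) =
         blinfun_apply (dual b m) (\<Sum>k<DIM('v). (if k < m then blinfun_apply (dual c k) (b m) else 0) *\<^sub>R b k)" by simp
      also have "\<dots> = 0"
        unfolding blinfun.sum_right blinfun.scaleR_right
        by (intro sum.neutral) (auto simp: dual_apply[OF b])
      finally show False using dual_apply[OF b m, of m] by simp
    qed
    then obtain j where j: "m \<le> j" "j < DIM('v)" "blinfun_apply (dual c j) (b m) \<noteq> 0" by blast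
    show ?case
    proof (cases "blinfun_apply (dual c m) (b m) = 0")
      case False
      have "\<forall>k<Suc m. (c(m := b m)) k = b k" using c(3) by (auto simp: less_Suc_eq)
      then show ?thesis
        using ordered_basis_upd(1)[OF c(1) m refl False] step[OF c(1,2) m False] by blast
    next
      case True
      with j have "j \<noteq> m" by auto
      \<comment> \<open>When its coordinate at \<open>m\<close> is 0, \<open>b m\<close> cannot
        replace \<open>c m\<close> directly. Subtracting \<open>c m\<close> from \<open>c j\<close>
        makes the new coordinate at \<open>m\<close> the sum of the old ones at \<open>m\<close> and
        \<open>j\<close>, which is nonzero.\<close>
      let ?c = "c(j := c j - c m)"
      have 1: "blinfun_apply (dual c j) (c j - c m) = 1"
        using \<open>j \<noteq> m\<close> j m by (simp add: blinfun.diff_right dual_apply[OF c(1)])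
      then have c': "ordered_basis ?c" "P ?c"
        using ordered_basis_upd(1)[OF c(1) j(2) 1] step[OF c(1,2) j(2), of "c j - c m"] by auto
      have "dual ?c m = dual c m + dual c j"
        by (rule dual_eqI[OF c'(1)])
           (use \<open>j \<noteq> m\<close> j m in \<open>auto simp: blinfun.bilinear_simps dual_apply[OF c(1)]\<close>)
      then have ne: "blinfun_apply (dual ?c m) (b m) \<noteq> 0" using True j by (simp add: blinfun.add_left)
      have "\<forall>k<Suc m. (?c(m := b m)) k = b k" using c(3) j(1) by (auto simp: less_Suc_eq)
      then show ?thesis
        using ordered_basis_upd(1)[OF c'(1) m refl ne] step[OF c'(1,2) m ne] by blast
    qed
  qed
  from this[of "DIM('v)"] show ?thesis using that by auto
qed

section \<open>Determinants relative to an ordered basis\<close>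

lemma det_wrt_dual:
  fixes e :: "nat \<Rightarrow> 'v::euclidean_space"
  assumes e: "ordered_basis e"
  shows "det_wrt e b = (\<Sum>p | p permutes {..<DIM('v)}. of_int (sign p) * (\<Prod>k<DIM('v). blinfun_apply (dual e (p k)) (b k)))"
proof -
  have "representation (e ` {..<DIM('v)}) w (e i) = blinfun_apply (dual e i) w" if i: "i < DIM('v)" for w i
  proof -
    let ?r = "representation (e ` {..<DIM('v)}) w"
    have "w = (\<Sum>y\<in>e ` {..<DIM('v)}. ?r y *\<^sub>R y)"
      using e by (intro real_vector.sum_representation_eq[symmetric]) (auto simp: ordered_basis_def)
    also have "\<dots> = (\<Sum>k<DIM('v). ?r (e k) *\<^sub>R e k)"
      using e by (simp add: sum.reindex ordered_basis_def)
    finally have "blinfun_apply (dual e i) w = blinfun_apply (dual e i) (\<Sum>k<DIM('v). ?r (e k) *\<^sub>R e k)" by simp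
    then show ?thesis
      using i by (simp add: blinfun.bilinear_simps blinfun.sum_right dual_apply[OF e] if_distrib cong: if_cong)
  qed
  moreover have "p k < DIM('v)" if "p permutes {..<DIM('v)}" "k < DIM('v)" for p k
    using permutes_in_image[OF that(1), of k] that(2) by simp
  ultimately show ?thesis unfolding det_wrt_def by (intro sum.cong refl) simp
qed

lemma det_wrt_cong: "(\<And>k. k < DIM('v) \<Longrightarrow> b k = b' k) \<Longrightarrow> det_wrt e b = det_wrt e (b' :: nat \<Rightarrow> 'v::euclidean_space)"
  unfolding det_wrt_def by simp

lemma linear_det_wrt_upd:
  fixes e :: "nat \<Rightarrow> 'v::euclidean_space"
  assumes e: "ordered_basis e" and i: "i < DIM('v)"
  shows "linear (\<lambda>w. det_wrt e (b(i := w)))"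
proof -
  have "(\<Prod>k<DIM('v). blinfun_apply (dual e (p k)) ((b(i := w)) k)) =
     (\<Prod>k\<in>{..<DIM('v)} - {i}. blinfun_apply (dual e (p k)) (b k)) * blinfun_apply (dual e (p i)) w" for p w
    using i by (subst prod.remove[of _ i]) auto
  then have "(\<lambda>w. det_wrt e (b(i := w))) = (\<lambda>w. \<Sum>p | p permutes {..<DIM('v)}. of_int (sign p) *
     ((\<Prod>k\<in>{..<DIM('v)} - {i}. blinfun_apply (dual e (p k)) (b k)) * blinfun_apply (dual e (p i)) w))"
    unfolding det_wrt_dual[OF e] by auto
  moreover have "linear (\<lambda>w. \<Sum>p | p permutes {..<DIM('v)}. of_int (sign p) *
     ((\<Prod>k\<in>{..<DIM('v)} - {i}. blinfun_apply (dual e (p k)) (b k)) * blinfun_apply (dual e (p i)) w))"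
    by (intro linearI) (auto simp: blinfun.bilinear_simps sum.distrib sum_distrib_left algebra_simps)
  ultimately show ?thesis by simp
qed

lemma det_wrt_swap:
  fixes e :: "nat \<Rightarrow> 'v::euclidean_space"
  assumes e: "ordered_basis e" and ij: "i < DIM('v)" "j < DIM('v)" "i \<noteq> j"
  shows "det_wrt e (b \<circ> Transposition.transpose i j) = - det_wrt e b"
proof -
  let ?S = "{..<DIM('v)}" and ?t = "Transposition.transpose i j"
  have t: "?t permutes ?S" using ij by (intro permutes_swap_id) auto
  have "det_wrt e (b \<circ> ?t) = (\<Sum>p | p permutes ?S. of_int (sign (p \<circ> ?t)) * (\<Prod>k\<in>?S. blinfun_apply (dual e ((p \<circ> ?t) k)) ((b \<circ> ?t) k)))"
    unfolding det_wrt_dual[OF e]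
    by (subst sum_permutations_compose_right[OF t]) (rule refl)
  also have "\<dots> = (\<Sum>p | p permutes ?S. - (of_int (sign p) * (\<Prod>k\<in>?S. blinfun_apply (dual e (p k)) (b k))))"
  proof (rule sum.cong[OF refl])
    fix p assume "p \<in> {p. p permutes ?S}"
    then have "permutation p" by (auto intro: permutation_permutes[THEN iffD2])
    then have "sign (p \<circ> ?t) = - sign p"
      using ij by (simp add: sign_compose permutation_swap_id sign_swap_id)
    moreover have "(\<Prod>k\<in>?S. blinfun_apply (dual e ((p \<circ> ?t) k)) ((b \<circ> ?t) k)) = (\<Prod>k\<in>?S. blinfun_apply (dual e (p k)) (b k))"
      using prod.permute[OF t, of "\<lambda>k. blinfun_apply (dual e (p k)) (b k)"] by (simp add: o_def)
    ultimately show "of_int (sign (p \<circ> ?t)) * (\<Prod>k\<in>?S. blinfun_apply (dual e ((p \<circ> ?t) k)) ((b \<circ> ?t) k)) =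
      - (of_int (sign p) * (\<Prod>k\<in>?S. blinfun_apply (dual e (p k)) (b k)))" by simp
  qed
  finally show ?thesis by (simp add: det_wrt_dual[OF e] sum_negf)
qed

lemma det_wrt_eq_rows:
  fixes e :: "nat \<Rightarrow> 'v::euclidean_space"
  assumes "ordered_basis e" "i < DIM('v)" "j < DIM('v)" "i \<noteq> j" "b i = b j"
  shows "det_wrt e b = 0"
proof -
  have "b \<circ> Transposition.transpose i j = b" using assms(5) by (auto simp: fun_eq_iff Transposition.transpose_def)
  then show ?thesis using det_wrt_swap[OF assms(1-4), of b] by simp
qed

lemma det_wrt_combination:
  fixes e :: "nat \<Rightarrow> 'v::euclidean_space"
  assumes e: "ordered_basis e" and i: "i < DIM('v)"
  shows "det_wrt e (b(i := (\<Sum>k<DIM('v). t k *\<^sub>R b k))) = t i * det_wrt e b"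
proof -
  let ?D = "\<lambda>w. det_wrt e (b(i := w))"
  have lin: "linear ?D" by (rule linear_det_wrt_upd[OF e i])
  have "?D (\<Sum>k<DIM('v). t k *\<^sub>R b k) = (\<Sum>k<DIM('v). t k * ?D (b k))"
    by (simp add: linear_sum[OF lin] linear_scale[OF lin])
  also have "\<dots> = (\<Sum>k<DIM('v). if k = i then t i * det_wrt e b else 0)"
  proof (rule sum.cong[OF refl])
    fix k assume "k \<in> {..<DIM('v)}"
    moreover have "?D (b k) = 0" if "k < DIM('v)" "k \<noteq> i"
      by (rule det_wrt_eq_rows[OF e i that(1)]) (use that in auto)
    ultimately show "t k * ?D (b k) = (if k = i then t i * det_wrt e b else 0)"
      by auto
  qed
  finally show ?thesis using i by simp
qed

lemma det_wrt_upd: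
  fixes e :: "nat \<Rightarrow> 'v::euclidean_space"
  assumes e: "ordered_basis e" and b: "ordered_basis b" and i: "i < DIM('v)"
  shows "det_wrt e (b(i := w)) = blinfun_apply (dual b i) w * det_wrt e b"
  using det_wrt_combination[OF e i, of b "\<lambda>k. blinfun_apply (dual b k) w"] basis_expand[OF b, of w] by simp

lemma det_wrt_scale:
  fixes e :: "nat \<Rightarrow> 'v::euclidean_space"
  assumes e: "ordered_basis e"
  shows "det_wrt e (\<lambda>k. t k *\<^sub>R b k) = (\<Prod>k<DIM('v). t k) * det_wrt e b"
  unfolding det_wrt_dual[OF e]
  by (simp add: blinfun.scaleR_right prod.distrib sum_distrib_left algebra_simps)

text \<open>The sign counts the \<open>p\<close> adjacent transpositions that bring \<open>w\<close>
  to the front. It is also the sign of face \<open>p\<close> in a simplicial boundary, which is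
  where the two get compared.\<close>

lemma det_wrt_insert:
  fixes e :: "nat \<Rightarrow> 'v::euclidean_space"
  assumes e: "ordered_basis e" and "p < DIM('v)"
  shows "det_wrt e (\<lambda>k. if k < p then b k else if k = p then w else b (k - 1)) =
    (-1) ^ p * det_wrt e (\<lambda>k. if k = 0 then w else b (k - 1))"
  using assms(2)
proof (induction p)
  case 0
  then show ?case by simp
next
  case (Suc p)
  have "(\<lambda>k. if k < Suc p then b k else if k = Suc p then w else b (k - 1)) =
     (\<lambda>k. if k < p then b k else if k = p then w else b (k - 1)) \<circ> Transposition.transpose p (Suc p)"
    by (auto simp: fun_eq_iff Transposition.transpose_def)
  then show ?case using det_wrt_swap[OF e, of p "Suc p"] Suc by simp
qed

text \<open>With \<open>x\<close> present as one of the vectors, replacing \<open>b m\<close> by 2x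
  - \<open>b m\<close> changes the sign; this happens in all slots but the first. In slot 0,
  \<open>x\<close> is traded for \<open>b 0\<close> as the sum of the \<open>b k\<close>, and for 2x
  - \<open>b 0\<close> because the reflected vectors sum to (2n - 1)x with n the dimension.\<close>

lemma det_wrt_reflect:
  fixes e :: "nat \<Rightarrow> 'v::euclidean_space"
  assumes e: "ordered_basis e" and x: "x = (\<Sum>k<DIM('v). b k)"
  shows "det_wrt e (\<lambda>k. 2 *\<^sub>R x - b k) = (-1) ^ (DIM('v) - 1) * (2 * DIM('v) - 1) * det_wrt e b"
proof -
  let ?n = "DIM('v)"
  have n: "0 < ?n" by simp
  then have "1 \<le> real ?n" by linarith
  then have N: "2 * real ?n - 1 \<noteq> 0" by linarith
  define a where "a k = 2 *\<^sub>R x - b k" for k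
  define c where "c m k = (if k = 0 then x else if k < m then b k else a k)" for m k
  have step: "det_wrt e (c m) = - det_wrt e (c (Suc m))" if m: "1 \<le> m" "m < ?n" for m
  proof -
    let ?t = "\<lambda>k. (if k = 0 then 2 else 0) + (if k = m then -1 else 0) :: real"
    have "(\<Sum>k<?n. ?t k *\<^sub>R c (Suc m) k) = 2 *\<^sub>R c (Suc m) 0 + (-1) *\<^sub>R c (Suc m) m"
      using m n unfolding scaleR_left_distrib sum.distrib
      by (simp add: if_distrib[of "\<lambda>r. r *\<^sub>R _"] cong: if_cong)
    also have "\<dots> = a m" using m by (simp add: c_def a_def)
    finally have "c m = (c (Suc m))(m := (\<Sum>k<?n. ?t k *\<^sub>R c (Suc m) k))"
      using m by (auto simp: c_def fun_eq_iff less_Suc_eq)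
    then show ?thesis using det_wrt_combination[OF e m(2), of "c (Suc m)" ?t] m by simp
  qed
  have down: "det_wrt e (c (?n - j)) = (-1) ^ j * det_wrt e (c ?n)" if "j < ?n" for j
    using that
  proof (induction j)
    case (Suc j)
    then show ?case using step[of "?n - Suc j"] by (simp add: Suc_diff_Suc)
  qed simp
  have "det_wrt e (c 1) = (-1) ^ (?n - 1) * det_wrt e (c ?n)" using down[of "?n - 1"] n by simp
  moreover have "det_wrt e (c ?n) = det_wrt e b"
  proof -
    have "det_wrt e (c ?n) = det_wrt e (b(0 := (\<Sum>k<?n. 1 *\<^sub>R b k)))"
      using x by (intro det_wrt_cong) (auto simp: c_def)
    then show ?thesis using det_wrt_combination[OF e n, of b "\<lambda>_. 1"] by simp
  qed
  moreover have "det_wrt e (c 1) = 1 / (2 * ?n - 1) * det_wrt e a"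
  proof -
    have "(\<Sum>k<?n. a k) = (2 * ?n - 1) *\<^sub>R x"
      unfolding a_def sum_subtractf x[symmetric] by (simp add: scaleR_left_diff_distrib sum_constant_scaleR mult.commute)
    then have "x = (\<Sum>k<?n. (1 / (2 * ?n - 1)) *\<^sub>R a k)"
      using N by (simp flip: scaleR_right.sum)
    then have "c 1 = a(0 := (\<Sum>k<?n. (1 / (2 * ?n - 1)) *\<^sub>R a k))"
      by (auto simp: c_def fun_eq_iff)
    then show ?thesis using det_wrt_combination[OF e n, of a "\<lambda>_. 1 / (2 * ?n - 1)"] by simp
  qed
  ultimately have "det_wrt e a = (2 * ?n - 1) * ((-1) ^ (?n - 1) * det_wrt e b)"
    using N by (simp add: field_simps)
  then show ?thesis by (simp add: a_def[abs_def] algebra_simps)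
qed

lemma det_wrt_self:
  fixes e :: "nat \<Rightarrow> 'v::euclidean_space"
  assumes e: "ordered_basis e"
  shows "det_wrt e e = 1"
proof -
  let ?S = "{..<DIM('v)}"
  have "(\<Prod>k\<in>?S. blinfun_apply (dual e (p k)) (e k)) = (if p = id then 1 else 0)" if p: "p permutes ?S" for p
  proof (cases "p = id")
    case True
    then show ?thesis by (simp add: dual_apply[OF e])
  next
    case False
    then obtain k where k: "p k \<noteq> k" by (auto simp: fun_eq_iff)
    then have "k \<in> ?S" using permutes_not_in[OF p, of k] by blast
    moreover from this k have "blinfun_apply (dual e (p k)) (e k) = 0" by (simp add: dual_apply[OF e])
    ultimately have "(\<Prod>k\<in>?S. blinfun_apply (dual e (p k)) (e k)) = 0"
      by (intro prod_zero) auto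
    then show ?thesis using False by simp
  qed
  then have "det_wrt e e = (\<Sum>p | p permutes ?S. if p = id then of_int (sign p) else 0)"
    unfolding det_wrt_dual[OF e] by (intro sum.cong) auto
  also have "\<dots> = 1" by (simp add: finite_permutations permutes_id)
  finally show ?thesis .
qed

text \<open>The vertices of the simplex in \<open>fundamental_class\<close>, with an arbitrary basis
  in place of the orientation basis.\<close>

definition dual_simplex :: "('v::euclidean_space \<Rightarrow>\<^sub>L real) \<Rightarrow> (nat \<Rightarrow> 'v) \<Rightarrow> nat \<Rightarrow> 'v \<Rightarrow>\<^sub>L real"
  where "dual_simplex u b = (\<lambda>j. case j of 0 \<Rightarrow> u - (\<Sum>k<DIM('v). dual b k) | Suc k \<Rightarrow> u + dual b k)"

lemma aff_shift:
  assumes "y \<in> standard_simplex n"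
  shows "aff n (\<lambda>j. u + l j) y = u + aff n l y"
  using assms by (simp add: aff_def scaleR_add_right sum.distrib standard_simplex_def flip: scaleR_left.sum)

lemma aff_Suc: "aff (Suc n) l y = y 0 *\<^sub>R l 0 + (\<Sum>k<Suc n. y (Suc k) *\<^sub>R l (Suc k))"
  unfolding aff_def sum.atMost_Suc_shift lessThan_Suc_atMost ..

lemma simplex_bd_not_const:
  assumes "y \<in> simplex_bd (Suc n)" "\<And>k. k < Suc n \<Longrightarrow> y (Suc k) = y 0"
  shows False
proof -
  have *: "y i = y 0" if "i \<le> Suc n" for i using assms(2)[of "i - 1"] that by (cases i) auto
  obtain i where i: "i \<le> Suc n" "y i = 0" using assms(1) by (auto simp: simplex_bd_def)
  then have "y j = 0" if "j \<le> Suc n" for j using *[OF that] *[of i] by simp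
  then have "(\<Sum>i\<le>Suc n. y i) = 0" by (intro sum.neutral) auto
  then show False using assms(1) by (simp add: simplex_bd_def standard_simplex_def)
qed

section \<open>The simplex around a point of the dual space\<close>

lemma Suc_DIM: "Suc (DIM('v::euclidean_space) - 1) = DIM('v)"
  using DIM_positive[where 'a='v] by simp

text \<open>Members of the boundary of the simplex \<open>u + l j\<close> differ from \<open>u\<close> as soon as their values at
  \<open>b 0, \<dots>, b (n - 1)\<close> determine the weights up to a common constant.\<close>

lemma aff_dual_simplex:
  fixes b :: "nat \<Rightarrow> 'v::euclidean_space"
  assumes "y \<in> standard_simplex DIM('v)"
  shows "aff DIM('v) (dual_simplex u b) y = u + (\<Sum>k<DIM('v). (y (Suc k) - y 0) *\<^sub>R dual b k)"
proof -
  let ?n = "DIM('v) - 1"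
  let ?l = "\<lambda>j. case j of 0 \<Rightarrow> - (\<Sum>k<DIM('v). dual b k) | Suc k \<Rightarrow> dual b k"
  have "dual_simplex u b = (\<lambda>j. u + ?l j)" by (auto simp: dual_simplex_def fun_eq_iff split: nat.split)
  then have "aff DIM('v) (dual_simplex u b) y = u + aff DIM('v) ?l y" using aff_shift[OF assms] by simp
  also have "aff DIM('v) ?l y = (\<Sum>k<DIM('v). (y (Suc k) - y 0) *\<^sub>R dual b k)"
    using aff_Suc[of ?n ?l y] unfolding Suc_DIM
    by (simp add: scaleR_left_diff_distrib sum_subtractf scaleR_right.sum)
  finally show ?thesis .
qed

lemma aff_interpolate:
  "aff n (\<lambda>j. (1 - s) *\<^sub>R l j + s *\<^sub>R l' j) y = (1 - s) *\<^sub>R aff n l y + s *\<^sub>R aff n l' y"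
  by (simp add: aff_def scaleR_add_right scaleR_right.sum sum.distrib mult.commute)

lemma simplex_bd_DIM_not_const:
  assumes "y \<in> simplex_bd DIM('v::euclidean_space)" "\<And>k. k < DIM('v) \<Longrightarrow> y (Suc k) = y 0"
  shows False
  using simplex_bd_not_const[of y "DIM('v) - 1"] assms unfolding Suc_DIM by blast

lemma dual_simplex_avoids:
  fixes b :: "nat \<Rightarrow> 'v::euclidean_space"
  assumes b: "ordered_basis b" and y: "y \<in> simplex_bd DIM('v)"
  shows "aff DIM('v) (dual_simplex u b) y \<noteq> u"
proof
  assume "aff DIM('v) (dual_simplex u b) y = u"
  moreover have "y \<in> standard_simplex DIM('v)" using y simplex_bd_subset by blast
  ultimately have 0: "(\<Sum>k<DIM('v). (y (Suc k) - y 0) *\<^sub>R dual b k) = 0" by (simp add: aff_dual_simplex)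
  have "y (Suc j) = y 0" if "j < DIM('v)" for j
  proof -
    have "0 = blinfun_apply (\<Sum>k<DIM('v). (y (Suc k) - y 0) *\<^sub>R dual b k) (b j)" unfolding 0 by simp
    also have "\<dots> = y (Suc j) - y 0"
      using that by (simp add: blinfun.bilinear_simps blinfun.sum_left dual_apply[OF b] if_distrib cong: if_cong)
    finally show ?thesis by simp
  qed
  then show False using simplex_bd_DIM_not_const[OF y] by blast
qed

lemma sum_dual_split:
  fixes a :: "nat \<Rightarrow> 'w::real_vector"
  assumes "i < n"
  shows "(\<Sum>k<n. a k) = a i + (\<Sum>k\<in>{..<n} - {i}. a k)"
  using assms by (subst sum.remove[of _ i]) auto

text \<open>The interpolated functionals keep their values at \<open>b j\<close> for j \<noteq> i,
  and the \<open>i\<close>-th one has a positive value at \<open>b i\<close> since the coordinate of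
  \<open>w\<close> is positive. They stay a basis, so the boundary stays off
  \<open>u\<close>.\<close>

lemma homologous_dual_simplex_upd:
  fixes b :: "nat \<Rightarrow> 'v::euclidean_space"
  assumes b: "ordered_basis b" and i: "i < DIM('v)" and r: "blinfun_apply (dual b i) w > 0"
  shows "homologous_rel (DIM('v) - 1) (top_of_set (UNIV - {u})) {}
    (aff_bd DIM('v) (dual_simplex u b)) (aff_bd DIM('v) (dual_simplex u (b(i := w))))"
proof -
  let ?b = "b(i := w)"
  let ?n = "DIM('v) - 1"
  have b': "ordered_basis ?b" and d: "\<And>k. k < DIM('v) \<Longrightarrow> dual ?b k =
       (if k = i then (1 / blinfun_apply (dual b i) w) *\<^sub>R dual b i
        else dual b k - (blinfun_apply (dual b k) w / blinfun_apply (dual b i) w) *\<^sub>R dual b i)"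
    using ordered_basis_upd[OF b i refl] r by auto
  have "aff (Suc ?n) (\<lambda>j. (1 - s) *\<^sub>R dual_simplex u b j + s *\<^sub>R dual_simplex u ?b j) y \<in> UNIV - {u}"
    if y: "y \<in> simplex_bd (Suc ?n)" and s: "0 \<le> s" "s \<le> 1" for y s
  proof
    show "aff (Suc ?n) (\<lambda>j. (1 - s) *\<^sub>R dual_simplex u b j + s *\<^sub>R dual_simplex u ?b j) y \<notin> {u}"
    proof
      have yb: "y \<in> simplex_bd DIM('v)" "y \<in> standard_simplex DIM('v)"
        using y simplex_bd_subset unfolding Suc_DIM by auto
      let ?z = "\<lambda>k. y (Suc k) - y 0"
      let ?a = "\<lambda>k. (1 - s) *\<^sub>R dual b k + s *\<^sub>R dual ?b k"
      assume "aff (Suc ?n) (\<lambda>j. (1 - s) *\<^sub>R dual_simplex u b j + s *\<^sub>R dual_simplex u ?b j) y \<in> {u}"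
      then have "(1 - s) *\<^sub>R (u + (\<Sum>k<DIM('v). ?z k *\<^sub>R dual b k)) + s *\<^sub>R (u + (\<Sum>k<DIM('v). ?z k *\<^sub>R dual ?b k)) = u"
        unfolding Suc_DIM aff_interpolate aff_dual_simplex[OF yb(2)] by simp
      then have "(1 - s) *\<^sub>R (\<Sum>k<DIM('v). ?z k *\<^sub>R dual b k) + s *\<^sub>R (\<Sum>k<DIM('v). ?z k *\<^sub>R dual ?b k) = 0"
        by (simp add: scaleR_add_right scaleR_left_diff_distrib algebra_simps)
      then have 0: "(\<Sum>k<DIM('v). ?z k *\<^sub>R ?a k) = 0"
        by (simp add: scaleR_right.sum scaleR_add_right sum.distrib mult.commute)
      have app: "(\<Sum>k<DIM('v). ?z k * blinfun_apply (?a k) w) = 0" for w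
        using arg_cong[OF 0, of "\<lambda>f. blinfun_apply f w"] by (simp add: blinfun.sum_left blinfun.scaleR_left)
      have z0: "?z j = 0" if j: "j < DIM('v)" "j \<noteq> i" for j
      proof -
        have "blinfun_apply (?a k) (b j) = (if k = j then 1 else 0)" if "k < DIM('v)" for k
          using dual_apply[OF b j(1), of k] dual_apply[OF b' j(1), of k] j(2) that
          by (simp add: blinfun.bilinear_simps)
        then have "(\<Sum>k<DIM('v). ?z k * (if k = j then 1 else 0)) = 0"
          using app[of "b j"] by (simp cong: sum.cong_simp)
        then show ?thesis using j by (simp add: if_distrib cong: if_cong)
      qed
      have "?z i * blinfun_apply (?a i) (b i) = 0"
        using app[of "b i"] z0 i by (subst (asm) sum.remove[of _ i]) (auto simp: sum.neutral)
      moreover have "blinfun_apply (?a i) (b i) = (1 - s) + s * (1 / blinfun_apply (dual b i) w)"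
        using i by (simp add: d blinfun.bilinear_simps dual_apply[OF b])
      moreover have "(1 - s) + s * (1 / blinfun_apply (dual b i) w) > 0"
        using s r by (cases "s = 0") (auto intro!: add_nonneg_pos mult_pos_pos)
      ultimately have "?z i = 0" by auto
      with z0 have "y (Suc k) = y 0" if "k < DIM('v)" for k using that by (cases "k = i") auto
      then show False using simplex_bd_DIM_not_const[OF yb(1)] by blast
    qed
  qed simp
  from homologous_aff_bd[OF this] show ?thesis unfolding Suc_DIM .
qed

text \<open>Exchanging the vertices 0 and \<open>Suc i\<close> accounts for the sign. Afterwards the
  two simplices differ only in where the sum \<open>?A\<close> of the other dual vectors is
  subtracted; it is shifted from vertex \<open>Suc i\<close> to vertex 0.\<close>

lemma homologous_dual_simplex_reflect:
  fixes b :: "nat \<Rightarrow> 'v::euclidean_space"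
  assumes b: "ordered_basis b" and i: "i < DIM('v)"
  shows "homologous_rel (DIM('v) - 1) (top_of_set (UNIV - {u})) {}
    (aff_bd DIM('v) (dual_simplex u b)) (- aff_bd DIM('v) (dual_simplex u (b(i := - b i))))"
proof -
  let ?b = "b(i := - b i)" and ?n = "DIM('v) - 1" and ?l = "dual_simplex u b"
  have r: "blinfun_apply (dual b i) (- b i) = -1" using i by (simp add: blinfun.minus_right dual_apply[OF b])
  have b': "ordered_basis ?b" using ordered_basis_upd(1)[OF b i r] by simp
  have d: "dual ?b k = (if k = i then - dual b i else dual b k)" if "k < DIM('v)" for k
    using ordered_basis_upd(2)[OF b i r _ that] i that by (auto simp: blinfun.minus_right dual_apply[OF b])
  define m where "m = (\<lambda>j. if j = 0 then ?l (Suc i) else if j = Suc i then ?l 0 else ?l j)"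
  have "homologous_rel ?n (top_of_set (UNIV - {u})) {} (aff_bd (Suc ?n) ?l) (- aff_bd (Suc ?n) m)"
    unfolding m_def
  proof (rule homologous_swap_vertex)
    show "aff (Suc ?n) ?l y \<in> UNIV - {u}" if "y \<in> simplex_bd (Suc ?n)" for y
      using dual_simplex_avoids[OF b] that unfolding Suc_DIM by blast
  qed (use i in auto)
  moreover have "homologous_rel ?n (top_of_set (UNIV - {u})) {} (aff_bd (Suc ?n) m) (aff_bd (Suc ?n) (dual_simplex u ?b))"
  proof (rule homologous_aff_bd)
    fix y s assume "y \<in> simplex_bd (Suc ?n)"
    then have yb: "y \<in> simplex_bd DIM('v)" "y \<in> standard_simplex DIM('v)"
      using simplex_bd_subset unfolding Suc_DIM by auto
    let ?A = "\<Sum>k\<in>{..<DIM('v)} - {i}. dual b k"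
    have sumb: "(\<Sum>k<DIM('v). dual b k) = dual b i + ?A" by (rule sum_dual_split[OF i])
    have sumb': "(\<Sum>k<DIM('v). dual ?b k) = - dual b i + ?A"
      by (subst sum_dual_split[OF i]) (use d i in \<open>auto intro!: arg_cong2[where f="(+)"] sum.cong\<close>)
    let ?c = "\<lambda>j. if j = 0 then dual b i - s *\<^sub>R ?A else if j = Suc i then - dual b i - (1 - s) *\<^sub>R ?A else dual b (j - 1)"
    have "(1 - s) *\<^sub>R m j + s *\<^sub>R dual_simplex u ?b j = u + ?c j" if j: "j \<le> DIM('v)" for j
    proof (cases j)
      case 0
      then show ?thesis by (simp add: m_def dual_simplex_def sumb' algebra_simps)
    next
      case (Suc k)
      then show ?thesis using j d[of k] by (auto simp: m_def dual_simplex_def sumb algebra_simps)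
    qed
    then have "aff (Suc ?n) (\<lambda>j. (1 - s) *\<^sub>R m j + s *\<^sub>R dual_simplex u ?b j) y = aff DIM('v) (\<lambda>j. u + ?c j) y"
      unfolding Suc_DIM aff_def by (intro sum.cong) auto
    also have "\<dots> = u + aff DIM('v) ?c y" by (rule aff_shift[OF yb(2)])
    finally have eq: "aff (Suc ?n) (\<lambda>j. (1 - s) *\<^sub>R m j + s *\<^sub>R dual_simplex u ?b j) y = u + aff DIM('v) ?c y" .
    have "aff DIM('v) ?c y \<noteq> 0"
    proof
      assume 0: "aff DIM('v) ?c y = 0"
      have aff: "aff DIM('v) ?c y = y 0 *\<^sub>R ?c 0 + (\<Sum>k<DIM('v). y (Suc k) *\<^sub>R ?c (Suc k))"
        using aff_Suc[of ?n ?c y] unfolding Suc_DIM by simp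
      have app: "y 0 * blinfun_apply (?c 0) w + (\<Sum>k<DIM('v). y (Suc k) * blinfun_apply (?c (Suc k)) w) = 0" for w
        using arg_cong[OF 0[unfolded aff], of "\<lambda>f. blinfun_apply f w"]
        by (simp only: blinfun.add_left blinfun.sum_left blinfun.scaleR_left blinfun.zero_left real_scaleR_def)
      have A: "blinfun_apply ?A (b j) = (if j = i then 0 else 1)" if "j < DIM('v)" for j
        using that by (simp add: blinfun.sum_left dual_apply[OF b])
      have ci: "blinfun_apply (?c (Suc k)) (b i) = (if k = i then -1 else 0)" for k
        using i by (simp add: blinfun.bilinear_simps A dual_apply[OF b])
      \<comment> \<open>At \<open>b i\<close> only the displacements of the vertices 0 and
        \<open>Suc i\<close> are nonzero, with values 1 and -1.\<close>
      have y0: "y 0 = y (Suc i)"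
        using app[of "b i"] i unfolding ci
        by (simp add: blinfun.bilinear_simps A dual_apply[OF b] if_distrib cong: if_cong)
      have "y (Suc j) = y 0" if j: "j < DIM('v)" "j \<noteq> i" for j
      proof -
        have cj: "blinfun_apply (?c (Suc k)) (b j) = (if k = i then s - 1 else 0) + (if k = j then 1 else 0)" for k
          using j by (simp add: blinfun.bilinear_simps A dual_apply[OF b])
        have "y 0 * (- s) + (\<Sum>k<DIM('v). y (Suc k) * ((if k = i then s - 1 else 0) + (if k = j then 1 else 0))) = 0"
          using app[of "b j"] j unfolding cj by (simp add: blinfun.bilinear_simps A dual_apply[OF b])
        moreover have "y (Suc k) * ((if k = i then s - 1 else 0) + (if k = j then 1 else 0)) =
            (if k = i then y (Suc i) * (s - 1) else 0) + (if k = j then y (Suc j) else 0)" for k using j(2) by auto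
        ultimately have "y 0 * (- s) + (y (Suc i) * (s - 1) + y (Suc j)) = 0"
          using i j by (simp add: sum.distrib)
        then show ?thesis using y0 by (simp add: algebra_simps)
      qed
      with y0 have "y (Suc k) = y 0" if "k < DIM('v)" for k using that by (cases "k = i") auto
      then show False using simplex_bd_DIM_not_const[OF yb(1)] by blast
    qed
    then show "aff (Suc ?n) (\<lambda>j. (1 - s) *\<^sub>R m j + s *\<^sub>R dual_simplex u ?b j) y \<in> UNIV - {u}"
      unfolding eq by simp
  qed
  ultimately show ?thesis
    unfolding Suc_DIM using homologous_rel_minus homologous_rel_trans by blast
qed

text \<open>Each replacement multiplies the determinant by the coordinate of \<open>w\<close> at
  \<open>i\<close>. A positive factor leaves the class unchanged; for a negative one
  \<open>c i\<close> is reflected first, which contributes the sign.\<close>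

lemma homologous_dual_simplex:
  fixes e b :: "nat \<Rightarrow> 'v::euclidean_space"
  assumes e: "ordered_basis e" and b: "ordered_basis b"
  shows "det_wrt e b \<noteq> 0"
    and "homologous_rel (DIM('v) - 1) (top_of_set (UNIV - {u})) {}
      (aff_bd DIM('v) (dual_simplex u b))
      (frag_cmul (if det_wrt e b > 0 then 1 else -1) (aff_bd DIM('v) (dual_simplex u e)))"
proof -
  let ?H = "homologous_rel (DIM('v) - 1) (top_of_set (UNIV - {u})) {}"
  let ?D = "\<lambda>b. aff_bd DIM('v) (dual_simplex u b)"
  let ?s = "\<lambda>b. if det_wrt e b > 0 then 1 else -1 :: int"
  let ?P = "\<lambda>b. det_wrt e b \<noteq> 0 \<and> ?H (?D b) (frag_cmul (?s b) (?D e))"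
  have "\<exists>c. ?P c \<and> (\<forall>k<DIM('v). c k = b k)"
  proof (rule basis_exchange[OF e b, where P = ?P])
    show "\<exists>c. ?P c \<and> (\<forall>k<DIM('v). c k = b k)" if "?P c" "\<And>k. k < DIM('v) \<Longrightarrow> c k = b k" for c
      using that by blast
    show "?P e" by (simp add: det_wrt_self[OF e])
    fix c :: "nat \<Rightarrow> 'v" and i w
    assume c: "ordered_basis c" and P: "?P c" and i: "i < DIM('v)" and r: "blinfun_apply (dual c i) w \<noteq> 0"
    have det: "det_wrt e (c(i := w)) = blinfun_apply (dual c i) w * det_wrt e c"
      by (rule det_wrt_upd[OF e c i])
    show "?P (c(i := w))"
    proof (cases "blinfun_apply (dual c i) w > 0")
      case True
      have "?H (?D (c(i := w))) (?D c)"
        using homologous_dual_simplex_upd[OF c i True, of u] homologous_rel_sym by blast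
      then have "?H (?D (c(i := w))) (frag_cmul (?s c) (?D e))"
        using P homologous_rel_trans by blast
      moreover have "?s (c(i := w)) = ?s c" using det True by (simp add: zero_less_mult_iff)
      ultimately show ?thesis using P det r by simp
    next
      case False
      let ?c = "c(i := - c i)"
      have "blinfun_apply (dual c i) (- c i) = -1" using i by (simp add: blinfun.minus_right dual_apply[OF c])
      from ordered_basis_upd[OF c i this] have c': "ordered_basis ?c" "dual ?c i = - dual c i"
        using i by auto
      then have "blinfun_apply (dual ?c i) w > 0" using False r by (simp add: blinfun.minus_left)
      from homologous_dual_simplex_upd[OF c'(1) i this, of u]
      have "?H (?D ?c) (?D (c(i := w)))" by simp
      from homologous_rel_trans[OF homologous_rel_minus[OF this] homologous_dual_simplex_reflect[OF c i]]
      have "?H (?D c) (- ?D (c(i := w)))" .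
      from homologous_rel_minus[OF this] have "?H (?D (c(i := w))) (- ?D c)"
        using homologous_rel_sym by (metis minus_minus)
      moreover have "?H (- ?D c) (- frag_cmul (?s c) (?D e))"
        using P homologous_rel_minus by blast
      ultimately have "?H (?D (c(i := w))) (- frag_cmul (?s c) (?D e))"
        using homologous_rel_trans by blast
      moreover have "?s (c(i := w)) = - ?s c"
        using det False r P by (auto simp: zero_less_mult_iff not_less)
      ultimately show ?thesis using P det r by simp
    qed
  qed
  then obtain c where c: "?P c" "\<And>k. k < DIM('v) \<Longrightarrow> c k = b k" by blast
  have "det_wrt e c = det_wrt e b" by (rule det_wrt_cong[OF c(2)])
  \<comment> \<open>\<open>basis_exchange\<close> gives agreement of \<open>c\<close> with
    \<open>b\<close> only below the dimension, but the description defining \<open>dual_vec\<close>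
    looks no further.\<close>
  moreover have "dual c k = dual b k" for k
  proof -
    have "(\<forall>j\<in>{..<DIM('v)}. blinfun_apply f (c j) = (if j = k then 1 else 0)) \<longleftrightarrow>
      (\<forall>j\<in>{..<DIM('v)}. blinfun_apply f (b j) = (if j = k then 1 else 0))" for f :: "'v \<Rightarrow>\<^sub>L real"
      using c(2) by auto
    then show ?thesis unfolding dual_vec_def by simp
  qed
  then have "dual_simplex u c = dual_simplex u b" unfolding dual_simplex_def by simp
  ultimately show "det_wrt e b \<noteq> 0" "?H (?D b) (frag_cmul (?s b) (?D e))" using c(1) by auto
qed

text \<open>Values at the \<open>e k\<close> recover the barycentric coordinates of a point of the
  dual simplex up to a common constant. Subtracting the minimum and normalising gives a map
  \<open>\<rho>\<close> from the complement of \<open>u\<close> to the boundary of the standard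
  simplex that inverts \<open>dual_simplex u e\<close>, so a relation passes to
  \<open>bd_id_infinite_order\<close>.\<close>

lemma dual_simplex_infinite_order:
  fixes e :: "nat \<Rightarrow> 'v::euclidean_space"
  assumes e: "ordered_basis e"
    and "singular_relboundary (DIM('v) - 1) (top_of_set (UNIV - {u})) {}
      (frag_cmul m (aff_bd DIM('v) (dual_simplex u e)))"
  shows "m = 0"
proof -
  let ?n = "DIM('v) - 1"
  \<comment> \<open>Coordinate 0 is the reference: at the point with weights \<open>y\<close> the
    value is \<open>y j - y 0\<close>.\<close>
  define c where "c f j = (case j of 0 \<Rightarrow> 0 | Suc k \<Rightarrow> blinfun_apply (f - u) (e k))" for f :: "'v \<Rightarrow>\<^sub>L real" and j
  define \<mu> where "\<mu> f = Min (c f ` {..DIM('v)})" for f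
  define S where "S f = (\<Sum>j\<le>DIM('v). c f j - \<mu> f)" for f
  define \<rho> where "\<rho> f = (\<lambda>j. if j \<le> DIM('v) then (c f j - \<mu> f) / S f else 0)" for f
  have ccont: "continuous_on A (\<lambda>f. c f j)" for A j
    unfolding c_def by (cases j) (auto intro!: continuous_intros)
  have \<mu>cont: "continuous_on A \<mu>" for A
  proof -
    have "continuous_on A (\<lambda>f. Min (c f ` {..k}))" for k
    proof (induction k)
      case 0
      then show ?case using ccont by simp
    next
      case (Suc k)
      have "Min (c f ` {..Suc k}) = min (c f (Suc k)) (Min (c f ` {..k}))" for f
        by (simp add: atMost_Suc)
      then show ?case using Suc ccont by (auto intro: continuous_intros)
    qed
    then show ?thesis unfolding \<mu>_def .
  qed
  have \<mu>le: "\<mu> f \<le> c f j" if "j \<le> DIM('v)" for f j unfolding \<mu>_def using that by (intro Min_le) auto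
  have \<mu>att: "\<exists>j\<le>DIM('v). \<mu> f = c f j" for f
  proof -
    have "\<mu> f \<in> c f ` {..DIM('v)}" unfolding \<mu>_def by (rule Min_in) auto
    then show ?thesis by auto
  qed
  have Spos: "S f > 0" if "f \<noteq> u" for f
  proof -
    have "S f \<ge> 0" unfolding S_def using \<mu>le by (intro sum_nonneg) auto
    moreover have "S f \<noteq> 0"
    proof
      assume "S f = 0"
      then have *: "c f j = \<mu> f" if "j \<le> DIM('v)" for j
        using that \<mu>le unfolding S_def by (subst (asm) sum_nonneg_eq_0_iff) auto
      then have "\<mu> f = 0" using *[of 0] by (simp add: c_def)
      then have "blinfun_apply f (e k) = blinfun_apply u (e k)" if "k < DIM('v)" for k
        using *[of "Suc k"] that by (simp add: c_def blinfun.diff_left)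
      then have "f = u" using e by (intro blinfun_eq_spanning[of e "{..<DIM('v)}"]) (auto simp: ordered_basis_def)
      then show False using that by simp
    qed
    ultimately show ?thesis by simp
  qed
  have \<rho>_in: "\<rho> f \<in> simplex_bd DIM('v)" if "f \<noteq> u" for f
  proof -
    have nn: "0 \<le> \<rho> f j" for j using Spos[OF that] \<mu>le by (auto simp: \<rho>_def)
    have sum: "(\<Sum>j\<le>DIM('v). \<rho> f j) = 1"
      using Spos[OF that] by (simp add: \<rho>_def S_def flip: sum_divide_distrib)
    have "\<rho> f j \<le> 1" for j
    proof (cases "j \<le> DIM('v)")
      case True
      then show ?thesis using member_le_sum[of j "{..DIM('v)}" "\<rho> f"] nn sum by simp
    qed (simp add: \<rho>_def)
    moreover obtain j where "j \<le> DIM('v)" "\<mu> f = c f j" using \<mu>att by blast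
    ultimately show ?thesis using nn sum
      by (auto simp: simplex_bd_def standard_simplex_def \<rho>_def intro!: exI[of _ j])
  qed
  have "continuous_on (UNIV - {u}) \<rho>"
  proof (rule continuous_on_coordinatewise_then_product)
    fix j
    have "continuous_on (UNIV - {u}) (\<lambda>f. (c f j - \<mu> f) / S f)"
      using Spos unfolding S_def by (intro continuous_intros ccont \<mu>cont) force
    then show "continuous_on (UNIV - {u}) (\<lambda>f. \<rho> f j)" by (cases "j \<le> DIM('v)") (auto simp: \<rho>_def)
  qed
  then have cont: "continuous_map (top_of_set (UNIV - {u})) (bd_top (Suc ?n)) \<rho>"
    using \<rho>_in unfolding Suc_DIM by (auto simp: euclidean_product_topology)
  have \<rho>id: "\<rho> (aff DIM('v) (dual_simplex u e) y) = y" if y: "y \<in> simplex_bd DIM('v)" for y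
  proof -
    let ?f = "aff DIM('v) (dual_simplex u e) y"
    have ys: "y \<in> standard_simplex DIM('v)" using y simplex_bd_subset by blast
    have cf: "c ?f j = y j - y 0" if "j \<le> DIM('v)" for j
    proof (cases j)
      case (Suc k)
      then show ?thesis using that
        by (simp add: c_def aff_dual_simplex[OF ys] blinfun.bilinear_simps blinfun.sum_left dual_apply[OF e] if_distrib cong: if_cong)
    qed (simp add: c_def)
    obtain i where i: "i \<le> DIM('v)" "y i = 0" using y by (auto simp: simplex_bd_def)
    have "\<mu> ?f = - y 0"
    proof (rule antisym)
      show "\<mu> ?f \<le> - y 0" using \<mu>le[OF i(1), of ?f] cf[OF i(1)] i by simp
      obtain j where "j \<le> DIM('v)" "\<mu> ?f = c ?f j" using \<mu>att by blast
      then show "- y 0 \<le> \<mu> ?f" using cf ys by (simp add: standard_simplex_def)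
    qed
    moreover from this have "S ?f = 1" unfolding S_def using cf ys by (simp add: standard_simplex_def)
    ultimately show ?thesis using cf ys by (auto simp: \<rho>_def fun_eq_iff standard_simplex_def)
  qed
  let ?\<iota> = "chain_boundary (Suc ?n) (frag_of (id_simplex (Suc ?n)))"
  have "singular_relboundary ?n (bd_top (Suc ?n)) {} (chain_map ?n \<rho> (frag_cmul m (aff_bd DIM('v) (dual_simplex u e))))"
    by (rule singular_relboundary_chain_map[OF assms(2) cont]) auto
  also have "chain_map ?n \<rho> (frag_cmul m (aff_bd DIM('v) (dual_simplex u e)))
     = frag_cmul m (chain_map ?n (\<rho> \<circ> aff (Suc ?n) (dual_simplex u e)) ?\<iota>)"
    using aff_bd_eq[of ?n "dual_simplex u e"] unfolding Suc_DIM by (simp add: chain_map_compose)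
  also have "chain_map ?n (\<rho> \<circ> aff (Suc ?n) (dual_simplex u e)) ?\<iota> = ?\<iota>"
    by (rule chain_map_id_gen[OF singular_chain_bd_id]) (use \<rho>id in \<open>simp add: Suc_DIM euclidean_product_topology\<close>)
  finally show ?thesis by (rule bd_id_infinite_order)
qed

section \<open>Cones of simplicial multi-fans\<close>

lemma convex_cone_hull_finite:
  assumes "finite S"
  shows "convex_cone hull S = {\<Sum>x\<in>S. c x *\<^sub>R x | c. \<forall>x\<in>S. 0 \<le> c x}"
proof
  let ?R = "{\<Sum>x\<in>S. c x *\<^sub>R x | c. \<forall>x\<in>S. (0::real) \<le> c x}"
  show "convex_cone hull S \<subseteq> ?R"
  proof (rule hull_minimal)
    show "S \<subseteq> ?R"
    proof
      fix y assume "y \<in> S"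
      then have "y = (\<Sum>x\<in>S. (if x = y then 1 else 0) *\<^sub>R x)"
        using assms by (simp add: if_distrib[of "\<lambda>r. r *\<^sub>R _"] cong: if_cong)
      then show "y \<in> ?R" by (intro CollectI exI[of _ "\<lambda>x. if x = y then 1 else 0"]) simp
    qed
    show "convex_cone ?R"
      unfolding convex_cone_iff
    proof (intro conjI ballI allI impI)
      have "0 = (\<Sum>x\<in>S. (0::real) *\<^sub>R x)" by simp
      then show "0 \<in> ?R" by (intro CollectI exI[of _ "\<lambda>x. 0"]) simp
    next
      fix a b assume "a \<in> ?R" "b \<in> ?R"
      then obtain c c' where "a = (\<Sum>x\<in>S. c x *\<^sub>R x)" "\<forall>x\<in>S. 0 \<le> c x" "b = (\<Sum>x\<in>S. c' x *\<^sub>R x)" "\<forall>x\<in>S. 0 \<le> c' x"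
        by blast
      then show "a + b \<in> ?R"
        by (intro CollectI exI[of _ "\<lambda>x. c x + c' x"]) (simp add: scaleR_add_left sum.distrib)
    next
      fix a and t :: real assume "a \<in> ?R" "0 \<le> t"
      then obtain c where "a = (\<Sum>x\<in>S. c x *\<^sub>R x)" "\<forall>x\<in>S. 0 \<le> c x" by blast
      then show "t *\<^sub>R a \<in> ?R"
        using \<open>0 \<le> t\<close> by (intro CollectI exI[of _ "\<lambda>x. t * c x"]) (simp add: scaleR_right.sum)
    qed
  qed
  show "?R \<subseteq> convex_cone hull S"
  proof
    fix z assume "z \<in> ?R"
    then obtain c where z: "z = (\<Sum>x\<in>S. c x *\<^sub>R x)" and c: "\<forall>x\<in>S. 0 \<le> c x" by blast
    have "(\<Sum>x\<in>T. c x *\<^sub>R x) \<in> convex_cone hull S" if "T \<subseteq> S" for T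
      using finite_subset[OF that assms] that
    proof (induction rule: finite_induct)
      case (insert x T)
      then show ?case
        using c by (auto intro!: convex_cone_hull_add convex_cone_hull_mul intro: hull_inc)
    qed (simp add: convex_cone_hull_contains_0)
    then show "z \<in> convex_cone hull S" unfolding z by blast
  qed
qed

lemma convex_cone_hull_subset: "S \<subseteq> convex_cone hull T \<Longrightarrow> convex_cone hull S \<subseteq> convex_cone hull T"
  by (rule hull_minimal) (auto simp: convex_cone_convex_cone_hull)

lemma span_convex_cone_hull: "span (convex_cone hull S) = span S"
proof
  have "convex_cone hull S \<subseteq> span S" by (rule hull_minimal) (auto simp: convex_cone_span span_base)
  then show "span (convex_cone hull S) \<subseteq> span S" by (simp add: span_minimal)
  show "span S \<subseteq> span (convex_cone hull S)" by (rule span_mono) (auto intro: hull_inc)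
qed

lemma dim_convex_cone_hull: "dim (convex_cone hull S) = dim (S :: 'a::euclidean_space set)"
  by (metis dim_span span_convex_cone_hull)

lemma dual_family_independent:
  fixes v :: "'i \<Rightarrow> 'v::euclidean_space"
  assumes "\<And>i. i \<in> J \<Longrightarrow> \<exists>f. linear f \<and> f (v i) = (1::real) \<and> (\<forall>j\<in>J - {i}. f (v j) = 0)"
  shows "inj_on v J" "independent (v ` J)"
proof -
  show inj: "inj_on v J"
  proof (rule inj_onI, rule ccontr)
    fix i j assume "i \<in> J" "j \<in> J" "v i = v j" "i \<noteq> j"
    then show False using assms[of i] by fastforce
  qed
  show "independent (v ` J)"
    unfolding dependent_def
  proof
    assume "\<exists>a\<in>v ` J. a \<in> span (v ` J - {a})"
    then obtain i where i: "i \<in> J" "v i \<in> span (v ` J - {v i})" by blast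
    from assms[OF i(1)] obtain f where f: "linear f" "f (v i) = 1" "\<forall>j\<in>J - {i}. f (v j) = (0::real)" by blast
    have "f z = 0" if "z \<in> v ` J - {v i}" for z using that f(3) by auto
    then have "f (v i) = 0" using linear_eq_0_on_span[OF f(1) _ i(2)] by blast
    then show False using f(2) by simp
  qed
qed

lemma coordinate_functional:
  assumes "independent (B :: 'v::euclidean_space set)" "b \<in> B"
  obtains f where "linear f" "f b = (1::real)" "\<And>x. x \<in> B \<Longrightarrow> x \<noteq> b \<Longrightarrow> f x = 0"
proof -
  obtain f where f: "linear f" "\<forall>x\<in>B. f x = (if x = b then 1 else (0::real))"
    using linear_independent_extend[OF assms(1), of "\<lambda>x. if x = b then 1 else (0::real)"] by blast
  show ?thesis by (rule that[of f]) (use f assms(2) in auto)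
qed

section \<open>Rays of a simplicial cone\<close>

lemma ray_face_of:
  assumes B: "independent (B :: 'v::euclidean_space set)" and b: "b \<in> B"
  shows "convex_cone hull {b} face_of convex_cone hull B"
  unfolding face_of_def
proof (intro conjI ballI impI)
  have fin: "finite B" using B by (rule independent_imp_finite)
  show "convex_cone hull {b} \<subseteq> convex_cone hull B" by (rule hull_mono) (use b in auto)
  show "convex (convex_cone hull {b})" by (rule convex_convex_cone_hull)
  fix x y z assume x: "x \<in> convex_cone hull B" and y: "y \<in> convex_cone hull B"
    and z: "z \<in> convex_cone hull {b}" and seg: "z \<in> open_segment x y"
  obtain c where c: "x = (\<Sum>a\<in>B. c a *\<^sub>R a)" "\<forall>a\<in>B. 0 \<le> c a" using x convex_cone_hull_finite[OF fin] by auto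
  obtain c' where c': "y = (\<Sum>a\<in>B. c' a *\<^sub>R a)" "\<forall>a\<in>B. 0 \<le> c' a" using y convex_cone_hull_finite[OF fin] by auto
  obtain t where t: "z = t *\<^sub>R b" using z convex_cone_hull_finite[of "{b}"] by auto
  obtain s where s: "0 < s" "s < 1" "z = (1 - s) *\<^sub>R x + s *\<^sub>R y" using seg unfolding in_segment by blast
  have 0: "c a = 0 \<and> c' a = 0" if a: "a \<in> B" "a \<noteq> b" for a
  proof -
    obtain f where f: "linear f" "f a = (1::real)" "\<And>x. x \<in> B \<Longrightarrow> x \<noteq> a \<Longrightarrow> f x = 0"
      using coordinate_functional[OF B a(1)] by blast
    have fs: "f (\<Sum>x\<in>B. g x *\<^sub>R x) = g a" for g
    proof -
      have "f (\<Sum>x\<in>B. g x *\<^sub>R x) = (\<Sum>x\<in>B. g x * f x)" by (simp add: linear_sum[OF f(1)] linear_scale[OF f(1)])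
      also have "\<dots> = (\<Sum>x\<in>B. if x = a then g a else 0)" using f by (intro sum.cong) auto
      finally show ?thesis using fin a by simp
    qed
    have "0 = f z" using t f(3)[OF b] a(2) by (simp add: linear_scale[OF f(1)])
    also have "\<dots> = (1 - s) * c a + s * c' a"
      unfolding s(3) c(1) c'(1) by (simp add: linear_add[OF f(1)] linear_scale[OF f(1)] fs)
    finally have "(1 - s) * c a + s * c' a = 0" by simp
    moreover have "0 \<le> (1 - s) * c a" "0 \<le> s * c' a" using c c' a s by auto
    ultimately show ?thesis using s by (auto simp: add_nonneg_eq_0_iff)
  qed
  have "x = c b *\<^sub>R b" "y = c' b *\<^sub>R b"
    unfolding c(1) c'(1) using 0 fin b by (subst sum.remove[of _ b]; auto intro!: sum.neutral)+
  then show "x \<in> convex_cone hull {b}" "y \<in> convex_cone hull {b}"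
    using c c' b by (auto intro: convex_cone_hull_mul hull_inc)
qed

text \<open>Membership in \<open>Cone N\<close> asks for a lattice vector generating the ray. Some
  lattice generator \<open>g\<close> of the whole cone occurs in \<open>b\<close> with a positive
  coefficient; as all coordinates are nonnegative and those of \<open>b\<close> at other basis
  vectors vanish, \<open>g\<close> is a positive multiple of \<open>b\<close>.\<close>

lemma ray_in_Cone:
  assumes B: "independent (B :: 'v::euclidean_space set)" and b: "b \<in> B" and C: "convex_cone hull B \<in> Cone N"
  shows "convex_cone hull {b} \<in> Cone N"
proof -
  have fin: "finite B" using B by (rule independent_imp_finite)
  have b0: "b \<noteq> 0" using B b dependent_zero by blast
  from C obtain G where G: "finite G" "G \<subseteq> N" "convex_cone hull B = convex_cone hull G"
    and nl: "\<forall>a d. d \<noteq> 0 \<longrightarrow> \<not> range (\<lambda>t::real. a + t *\<^sub>R d) \<subseteq> convex_cone hull B"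
    unfolding Cone_def by blast
  have "b \<in> convex_cone hull G" using G(3) b hull_inc[of b B convex_cone] by simp
  then obtain c where c: "b = (\<Sum>g\<in>G. c g *\<^sub>R g)" "\<forall>g\<in>G. 0 \<le> c g" using convex_cone_hull_finite[OF G(1)] by auto
  have "\<exists>g\<in>G. c g *\<^sub>R g \<noteq> 0" using c(1) b0 sum.neutral[of G "\<lambda>g. c g *\<^sub>R g"] by auto
  then obtain g where g: "g \<in> G" "c g > 0" "g \<noteq> 0" using c(2) by (auto simp: less_le)
  have coord: "\<exists>\<gamma>. h = (\<Sum>a\<in>B. \<gamma> a *\<^sub>R a) \<and> (\<forall>a\<in>B. 0 \<le> \<gamma> a)" if "h \<in> G" for h
    using that G(3) convex_cone_hull_finite[OF fin] hull_inc[of h G convex_cone] by auto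
  obtain \<gamma> where \<gamma>: "g = (\<Sum>a\<in>B. \<gamma> a *\<^sub>R a)" "\<forall>a\<in>B. 0 \<le> \<gamma> a" using coord[OF g(1)] by blast
  have "\<gamma> a = 0" if a: "a \<in> B" "a \<noteq> b" for a
  proof -
    obtain f where f: "linear f" "f a = (1::real)" "\<And>x. x \<in> B \<Longrightarrow> x \<noteq> a \<Longrightarrow> f x = 0"
      using coordinate_functional[OF B a(1)] by blast
    have fs: "f (\<Sum>x\<in>B. g x *\<^sub>R x) = g a" for g
    proof -
      have "f (\<Sum>x\<in>B. g x *\<^sub>R x) = (\<Sum>x\<in>B. g x * f x)" by (simp add: linear_sum[OF f(1)] linear_scale[OF f(1)])
      also have "\<dots> = (\<Sum>x\<in>B. if x = a then g a else 0)" using f by (intro sum.cong) auto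
      finally show ?thesis using fin a by simp
    qed
    have fpos: "0 \<le> f h" if "h \<in> G" for h using coord[OF that] fs a(1) by auto
    have "0 = f b" using f(3)[OF b] a(2) by simp
    also have "\<dots> = (\<Sum>g\<in>G. c g * f g)" by (subst c(1)) (simp add: linear_sum[OF f(1)] linear_scale[OF f(1)])
    finally have "\<forall>g\<in>G. c g * f g = 0"
      using c(2) fpos G(1) by (subst (asm) eq_commute, subst (asm) sum_nonneg_eq_0_iff) auto
    then have "f g = 0" using g by auto
    then show ?thesis using fs[of \<gamma>] \<gamma>(1) by simp
  qed
  then have gb: "g = \<gamma> b *\<^sub>R b" unfolding \<gamma>(1) using fin b by (subst sum.remove[of _ b]) (auto intro!: sum.neutral)
  with g(3) \<gamma>(2) b have pos: "\<gamma> b > 0" by (metis less_le scaleR_zero_left)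
  have "convex_cone hull {b} = convex_cone hull {g}"
  proof
    have "b = (1 / \<gamma> b) *\<^sub>R g" using gb pos by simp
    also have "\<dots> \<in> convex_cone hull {g}" using pos by (intro convex_cone_hull_mul hull_inc) auto
    finally show "convex_cone hull {b} \<subseteq> convex_cone hull {g}" by (intro convex_cone_hull_subset) simp
    have "g \<in> convex_cone hull {b}" unfolding gb using pos by (intro convex_cone_hull_mul hull_inc) auto
    then show "convex_cone hull {g} \<subseteq> convex_cone hull {b}" by (intro convex_cone_hull_subset) simp
  qed
  moreover have "convex_cone hull {b} \<subseteq> convex_cone hull B" by (rule hull_mono) (use b in auto)
  ultimately show ?thesis
    unfolding Cone_def using nl G(2) g(1) by (auto intro!: exI[of _ "{g}"]) blast
qed

text \<open>The sum a + b is the midpoint of 2a and 2b, and 2a is the midpoint of a and 3a. Open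
  segments need distinct endpoints, hence the cases a = b and a = 0.\<close>

lemma face_of_cone_summand:
  assumes face: "T face_of S" and S: "convex_cone S" and ab: "a \<in> S" "b \<in> S" "a + b \<in> T"
  shows "a \<in> T"
proof -
  have 0: "0 \<in> T" if "a + b \<noteq> 0"
  proof -
    have "a + b \<in> open_segment 0 (2 *\<^sub>R (a + b))"
      using that unfolding in_segment by (auto intro!: exI[of _ "1/2"])
    moreover have "0 \<in> S" "2 *\<^sub>R (a + b) \<in> S"
      using S ab by (auto intro: convex_cone_contains_0 convex_cone_scaleR convex_cone_add)
    ultimately show ?thesis using face ab(3) unfolding face_of_def by blast
  qed
  have *: "2 *\<^sub>R a \<in> T"
  proof (cases "a = b")
    case True
    then show ?thesis using ab(3) by (simp add: scaleR_2)
  next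
    case False
    have "a + b \<in> open_segment (2 *\<^sub>R a) (2 *\<^sub>R b)"
      using False unfolding in_segment by (auto intro!: exI[of _ "1/2"])
    moreover have "2 *\<^sub>R a \<in> S" "2 *\<^sub>R b \<in> S" using S ab by (auto intro: convex_cone_scaleR)
    ultimately show ?thesis using face ab(3) unfolding face_of_def by blast
  qed
  show ?thesis
  proof (cases "a = 0")
    case True
    then show ?thesis
      using * by simp
  next
    case False
    have "3 *\<^sub>R a - a = 2 *\<^sub>R a" by (simp add: scaleR_left_diff_distrib[of 3 1 a, simplified])
    with False have "a \<noteq> 3 *\<^sub>R a" by auto
    then have "2 *\<^sub>R a \<in> open_segment a (3 *\<^sub>R a)"
      unfolding in_segment by (auto intro!: exI[of _ "1/2"] simp: scaleR_left_distrib[symmetric])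
    moreover have "3 *\<^sub>R a \<in> S" using S ab by (auto intro: convex_cone_scaleR)
    ultimately show ?thesis using face ab(1) * unfolding face_of_def by blast
  qed
qed

text \<open>\<open>simplicial_fan\<close> provides some basis \<open>B\<close> of the cone, not the
  given \<open>v i\<close>. The order isomorphism matches the rays of \<open>B\<close> with the
  one-element faces of \<open>J\<close>, so each \<open>v i\<close> is a positive multiple of one
  member of \<open>B\<close>, and different \<open>i\<close> belong to different members.\<close>

lemma fan_cone_generators:
  fixes \<Delta> :: "(nat set, 'v::euclidean_space) multi_fan"
  assumes poly: "simple_multi_polytope d \<Delta> F"
    and v: "\<forall>i\<in>{1..d}. v i \<in> fan_cone \<Delta> {i} \<and> v i \<noteq> 0"
    and J: "J \<in> faces \<Delta>"
  shows "inj_on v J" "independent (v ` J)" "fan_cone \<Delta> J = convex_cone hull (v ` J)"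
proof -
  let ?C = "fan_cone \<Delta>" and ?N = "fan_lattice \<Delta>"
  have fan: "is_multi_fan \<Delta>" and simp: "simplicial_fan \<Delta>" and aug: "augmented_on d \<Delta>"
    using poly by (auto simp: simple_multi_polytope_def multi_polytope_def)
  have sub: "J \<subseteq> {1..d}" and down: "\<And>I. I \<subseteq> J \<Longrightarrow> I \<in> faces \<Delta>" and f1: "faces_dim \<Delta> 1 = (\<lambda>i. {i}) ` {1..d}"
    using aug J by (auto simp: augmented_on_def)
  have CC: "?C J \<in> Cone ?N" using fan J by (auto simp: is_multi_fan_def)
  have bij: "bij_betw ?C {I \<in> faces \<Delta>. I \<le> J} {\<kappa> \<in> Cone ?N. \<kappa> face_of ?C J}"
    using fan J by (auto simp: is_multi_fan_def)
  obtain B where B: "independent B" "?C J = convex_cone hull B" using simp J by (auto simp: simplicial_fan_def)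
  have fin: "finite B" using B(1) by (rule independent_imp_finite)
  have nz: "b \<noteq> 0" if "b \<in> B" for b using B(1) that dependent_zero by blast
  \<comment> \<open>The ray is a face and a cone of the lattice, so it is the cone of some I
    \<subseteq> J; having dimension 1, this \<open>I\<close> is a singleton by
    \<open>augmented_on\<close>.\<close>
  have ray: "\<exists>i\<in>J. ?C {i} = convex_cone hull {b}" if b: "b \<in> B" for b
  proof -
    have "convex_cone hull {b} \<in> {\<kappa> \<in> Cone ?N. \<kappa> face_of ?C J}"
      using ray_in_Cone[OF B(1) b] ray_face_of[OF B(1) b] CC B(2) by simp
    then obtain I where I: "I \<in> faces \<Delta>" "I \<subseteq> J" "?C I = convex_cone hull {b}"
      using bij unfolding bij_betw_def by (metis (no_types, lifting) imageE mem_Collect_eq)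
    then have "dim (?C I) = 1" using nz[OF b] by (simp add: dim_convex_cone_hull dim_insert)
    then have "I \<in> faces_dim \<Delta> 1" using I by (simp add: faces_dim_def)
    then show ?thesis using I f1 by auto
  qed
  have vmult: "\<exists>b\<in>B. \<exists>r>0. v i = r *\<^sub>R b \<and> ?C {i} = convex_cone hull {b}" if i: "i \<in> J" for i
  proof -
    have id: "i \<in> {1..d}" using i sub by auto
    have vi: "v i \<in> ?C {i}" "v i \<noteq> 0" using v id by auto
    have "{i} \<in> {I \<in> faces \<Delta>. I \<le> J}" using i down[of "{i}"] by auto
    then have face: "?C {i} face_of ?C J" and CCi: "?C {i} \<in> Cone ?N" using bij unfolding bij_betw_def by blast+
    have dim1: "dim (?C {i}) = 1" using f1 id by (auto simp: faces_dim_def)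
    have "v i \<in> convex_cone hull B" using face vi face_of_imp_subset B(2) by blast
    then obtain c where c: "v i = (\<Sum>a\<in>B. c a *\<^sub>R a)" "\<forall>a\<in>B. 0 \<le> c a" using convex_cone_hull_finite[OF fin] by auto
    have "\<exists>b\<in>B. c b *\<^sub>R b \<noteq> 0" using c(1) vi(2) sum.neutral[of B "\<lambda>g. c g *\<^sub>R g"] by auto
    then obtain b where b: "b \<in> B" "c b > 0" using c(2) by (auto simp: less_le)
    have cc: "convex_cone (?C J)" unfolding B(2) by (rule convex_cone_convex_cone_hull)
    \<comment> \<open>A summand of \<open>v i\<close> lies in the face that contains
      \<open>v i\<close>, and a one-dimensional face containing \<open>b\<close> is its ray.\<close>
    have "c b *\<^sub>R b \<in> ?C {i}"
    proof (rule face_of_cone_summand[OF face cc])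
      show "c b *\<^sub>R b \<in> ?C J" unfolding B(2) using b by (intro convex_cone_hull_mul hull_inc) auto
      show "(\<Sum>a\<in>B - {b}. c a *\<^sub>R a) \<in> ?C J"
      proof -
        have "(\<Sum>a\<in>B - {b}. c a *\<^sub>R a) = (\<Sum>a\<in>B. (if a = b then 0 else c a) *\<^sub>R a)"
          using fin by (intro sum.mono_neutral_cong_left) auto
        then show ?thesis unfolding B(2) convex_cone_hull_finite[OF fin] using c(2)
          by (intro CollectI exI[of _ "\<lambda>a. if a = b then 0 else c a"]) auto
      qed
      show "c b *\<^sub>R b + (\<Sum>a\<in>B - {b}. c a *\<^sub>R a) \<in> ?C {i}"
        using vi(1) c(1) fin b(1) by (simp add: sum.remove)
    qed
    moreover obtain G where "?C {i} = convex_cone hull G" using CCi unfolding Cone_def by auto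
    ultimately have bC: "b \<in> ?C {i}"
      using b(2) convex_cone_hull_mul[of "c b *\<^sub>R b" G "1 / c b"] by simp
    have inspan: "?C {i} \<subseteq> span {b}"
    proof -
      have "span {b} \<subseteq> span (?C {i})" using bC by (intro span_mono) auto
      moreover have "dim (span {b}) = dim (span (?C {i}))" using dim1 nz[OF b(1)] by (simp add: dim_insert)
      ultimately have "span {b} = span (?C {i})" by (intro subspace_dim_equal) auto
      then show ?thesis using span_superset by blast
    qed
    obtain f where f: "linear f" "f b = (1::real)" "\<And>x. x \<in> B \<Longrightarrow> x \<noteq> b \<Longrightarrow> f x = 0"
      using coordinate_functional[OF B(1) b(1)] by blast
    have pos: "0 \<le> f z" if zB: "z \<in> convex_cone hull B" for z
    proof -
      obtain g where g: "z = (\<Sum>a\<in>B. g a *\<^sub>R a)" "\<forall>a\<in>B. 0 \<le> g a" using zB convex_cone_hull_finite[OF fin] by auto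
      have "f z = (\<Sum>a\<in>B. g a * f a)" unfolding g by (simp add: linear_sum[OF f(1)] linear_scale[OF f(1)])
      also have "\<dots> \<ge> 0" using g f by (intro sum_nonneg) (metis mult_nonneg_nonneg order.refl zero_le_one)
      finally show ?thesis .
    qed
    have mult: "z = f z *\<^sub>R b \<and> 0 \<le> f z" if zi: "z \<in> ?C {i}" for z
    proof -
      obtain r where "z = r *\<^sub>R b" using inspan zi by (auto simp: span_singleton)
      then show ?thesis using pos[of z] zi face face_of_imp_subset B(2) f by (auto simp: linear_scale)
    qed
    have "?C {i} = convex_cone hull {b}"
    proof
      show "?C {i} \<subseteq> convex_cone hull {b}"
      proof
        fix z assume "z \<in> ?C {i}"
        with mult[of z] show "z \<in> convex_cone hull {b}"
          using convex_cone_hull_mul[OF hull_inc[of b "{b}"], of "f z"] by auto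
      qed
      show "convex_cone hull {b} \<subseteq> ?C {i}"
        using bC \<open>?C {i} = convex_cone hull G\<close> by (metis convex_cone_hull_subset empty_subsetI insert_subset)
    qed
    moreover have "v i = f (v i) *\<^sub>R b" "f (v i) > 0"
      using mult[OF vi(1)] vi(2) by (auto simp: less_le)
    ultimately show ?thesis using b(1) by blast
  qed
  then obtain \<beta> r where \<beta>: "\<And>i. i \<in> J \<Longrightarrow> \<beta> i \<in> B" "\<And>i. i \<in> J \<Longrightarrow> r i > 0" "\<And>i. i \<in> J \<Longrightarrow> v i = r i *\<^sub>R \<beta> i"
     "\<And>i. i \<in> J \<Longrightarrow> ?C {i} = convex_cone hull {\<beta> i}" by metis
  have sing: "i = j" if "i \<in> J" "j \<in> J" "?C {i} = ?C {j}" for i j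
  proof -
    have "inj_on ?C {I \<in> faces \<Delta>. I \<le> J}" using bij by (simp add: bij_betw_def)
    then have "{i} = {j}" by (rule inj_onD) (use that down[of "{i}"] down[of "{j}"] in auto)
    then show ?thesis by simp
  qed
  have fam: "\<exists>f. linear f \<and> f (v i) = (1::real) \<and> (\<forall>j\<in>J - {i}. f (v j) = 0)" if i: "i \<in> J" for i
  proof -
    obtain f where f: "linear f" "f (\<beta> i) = (1::real)" "\<And>x. x \<in> B \<Longrightarrow> x \<noteq> \<beta> i \<Longrightarrow> f x = 0"
      using coordinate_functional[OF B(1) \<beta>(1)[OF i]] by blast
    have "f (v j) = 0" if "j \<in> J - {i}" for j
    proof -
      have "\<beta> j \<noteq> \<beta> i" using sing[of i j] \<beta>(4)[of i] \<beta>(4)[of j] that i by auto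
      then show ?thesis using f(3) \<beta>(1,3)[of j] that by (simp add: linear_scale[OF f(1)])
    qed
    then show ?thesis
      using f \<beta>(2,3)[OF i] by (intro exI[of _ "\<lambda>z. f z / r i"])
        (auto simp: linear_scale intro!: linear_compose_scale_right[of f "1 / r i", simplified])
  qed
  from dual_family_independent[OF fam] show "inj_on v J" "independent (v ` J)" by auto
  show "?C J = convex_cone hull (v ` J)"
    unfolding B(2)
  proof
    show "convex_cone hull (v ` J) \<subseteq> convex_cone hull B"
    proof (rule convex_cone_hull_subset, rule subsetI)
      fix z assume "z \<in> v ` J"
      then obtain i where i: "i \<in> J" "z = v i" by blast
      show "z \<in> convex_cone hull B"
        unfolding i(2) \<beta>(3)[OF i(1)]
        by (rule convex_cone_hull_mul[OF hull_inc[OF \<beta>(1)[OF i(1)]]]) (use \<beta>(2)[OF i(1)] in simp)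
    qed
    have "b \<in> convex_cone hull (v ` J)" if b: "b \<in> B" for b
    proof -
      obtain i where i: "i \<in> J" "?C {i} = convex_cone hull {b}" using ray[OF b] by blast
      have "b \<in> convex_cone hull {\<beta> i}" using i \<beta>(4) hull_inc[of b "{b}"] by force
      then obtain t where t: "b = t *\<^sub>R \<beta> i" "t \<ge> 0" using convex_cone_hull_finite[of "{\<beta> i}"] by auto
      have "b = (t / r i) *\<^sub>R v i" using t(1) \<beta>(2,3)[OF i(1)] by simp
      also have "\<dots> \<in> convex_cone hull (v ` J)"
        by (rule convex_cone_hull_mul[OF hull_inc]) (use t(2) \<beta>(2)[OF i(1)] i(1) in auto)
      finally show ?thesis .
    qed
    then show "convex_cone hull B \<subseteq> convex_cone hull (v ` J)" by (intro convex_cone_hull_subset) auto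
  qed
qed

section \<open>Dimensions, hyperplanes and weights of a simple multi-polytope\<close>

lemma polytope_faces_dim:
  fixes \<Delta> :: "(nat set, 'v::euclidean_space) multi_fan"
  assumes poly: "simple_multi_polytope d \<Delta> F"
    and v: "\<forall>i\<in>{1..d}. v i \<in> fan_cone \<Delta> {i} \<and> v i \<noteq> 0"
  shows "J \<in> faces \<Delta> \<Longrightarrow> dim (fan_cone \<Delta> J) = card J" "faces_dim \<Delta> m = {J \<in> faces \<Delta>. card J = m}"
    "fan_dim \<Delta> = DIM('v)"
proof -
  show *: "dim (fan_cone \<Delta> J) = card J" if "J \<in> faces \<Delta>" for J
    using fan_cone_generators[OF poly v that] by (simp add: dim_convex_cone_hull dim_eq_card_independent card_image)
  then show "faces_dim \<Delta> m = {J \<in> faces \<Delta>. card J = m}" by (auto simp: faces_dim_def)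
  have "span (fan_lattice \<Delta>) = UNIV" using poly by (auto simp: simple_multi_polytope_def multi_polytope_def)
  then show "fan_dim \<Delta> = DIM('v)" unfolding fan_dim_def by (metis dim_UNIV dim_span)
qed

text \<open>Evaluation at \<open>v i\<close> is constant on a level set of \<open>g\<close>, hence a
  multiple of \<open>g\<close>; the multiple is nonzero because the inner product with
  \<open>v i\<close> does not vanish at \<open>v i\<close>.\<close>

lemma polytope_hyperplanes:
  fixes \<Delta> :: "(nat set, 'v::euclidean_space) multi_fan"
  assumes poly: "simple_multi_polytope d \<Delta> F"
    and v: "\<forall>i\<in>{1..d}. v i \<in> fan_cone \<Delta> {i} \<and> v i \<noteq> 0"
  obtains c where "\<And>i. i \<in> {1..d} \<Longrightarrow> F {i} = {f. blinfun_apply f (v i) = c i}"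
proof -
  have "\<exists>c. F {i} = {f. blinfun_apply f (v i) = c}" if i: "i \<in> {1..d}" for i
  proof -
    have "{i} \<in> faces_dim \<Delta> 1" using poly i by (auto simp: simple_multi_polytope_def augmented_on_def)
    then have aff: "affine_hyperplane (F {i})"
      and const: "\<forall>f \<in> F {i}. \<forall>g \<in> F {i}. blinfun_apply f (v i) = blinfun_apply g (v i)"
      using poly v i unfolding simple_multi_polytope_def multi_polytope_def by blast+
    from aff obtain g c where g: "linear g" "g \<noteq> (\<lambda>_. 0)" "F {i} = {f. g f = (c::real)}"
      unfolding affine_hyperplane_def by blast
    obtain h0 where "g h0 \<noteq> 0" using g(2) by auto
    then obtain h where h: "g h = 1" using linear_scale[OF g(1), of "1 / g h0" h0] by force
    have ker: "blinfun_apply f (v i) = g f * blinfun_apply h (v i)" for f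
    proof -
      have "c *\<^sub>R h \<in> F {i}" "c *\<^sub>R h + (f - g f *\<^sub>R h) \<in> F {i}"
        using h by (auto simp: g(3) linear_add[OF g(1)] linear_diff[OF g(1)] linear_scale[OF g(1)])
      with const have "blinfun_apply (c *\<^sub>R h) (v i) = blinfun_apply (c *\<^sub>R h + (f - g f *\<^sub>R h)) (v i)" by blast
      then show ?thesis by (simp add: blinfun.bilinear_simps)
    qed
    have "v i \<noteq> 0" using v i by blast
    then have "blinfun_apply (blinfun_inner_right (v i)) (v i) \<noteq> 0" by simp
    then have "blinfun_apply h (v i) \<noteq> 0" using ker[of "blinfun_inner_right (v i)"] by auto
    then have "g f = c \<longleftrightarrow> blinfun_apply f (v i) = c * blinfun_apply h (v i)" for f
      by (subst ker[of f]) simp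
    then have "F {i} = {f. blinfun_apply f (v i) = c * blinfun_apply h (v i)}"
      unfolding g(3) by blast
    then show ?thesis by blast
  qed
  then show ?thesis using that by metis
qed

text \<open>The projected multi-fan of a codimension one face lives on a line. Its pre-completeness
  compares the degrees in the two directions of that line, i.e. the weights on the two sides of the
  kernel of \<open>h\<close>.\<close>

lemma polytope_balanced:
  fixes \<Delta> :: "(nat set, 'v::euclidean_space) multi_fan" and h :: "'v \<Rightarrow> real"
  assumes poly: "simple_multi_polytope d \<Delta> F"
    and v: "\<forall>i\<in>{1..d}. v i \<in> fan_cone \<Delta> {i} \<and> v i \<noteq> 0"
    and K: "K \<in> faces \<Delta>" "Suc (card K) = DIM('v)"
    and h: "linear h" "\<And>k. k \<in> K \<Longrightarrow> h (v k) = (0::real)"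
  shows "(\<Sum>i | i \<notin> K \<and> insert i K \<in> faces \<Delta>. of_int (weight \<Delta> (insert i K)) * sgn (h (v i))) = 0"
proof -
  \<comment> \<open>The vector representing \<open>h\<close> by the inner product. If nonzero, it
    spans the orthogonal complement of the \<open>v k\<close>, in which \<open>quot_map\<close>
    takes its values.\<close>
  define a where "a = (\<Sum>b\<in>Basis. h b *\<^sub>R b)"
  have ha: "h z = z \<bullet> a" for z
  proof -
    have "h z = h (\<Sum>b\<in>Basis. (z \<bullet> b) *\<^sub>R b)" by (simp add: euclidean_representation)
    also have "\<dots> = z \<bullet> a"
      by (simp add: a_def linear_sum[OF h(1)] linear_scale[OF h(1)] inner_sum_right mult.commute)
    finally show ?thesis .
  qed
  show ?thesis
  proof (cases "a = 0")
    case True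
    then show ?thesis by (simp add: ha)
  next
    case False
    let ?C = "fan_cone \<Delta>"
    let ?W = "span (v ` K)"
    let ?q = "\<lambda>z. (z \<bullet> a / (a \<bullet> a)) *\<^sub>R a"
    let ?P = "projected \<Delta> K"
    have aa: "a \<bullet> a > 0" using False by simp
    note gen = fan_cone_generators[OF poly v]
    have finite_face: "finite I" if "I \<in> faces \<Delta>" for I
      using that poly finite_subset[of I "{1..d}"] by (auto simp: simple_multi_polytope_def augmented_on_def)
    note finK = finite_face[OF K(1)]
    have fin: "finite (faces \<Delta>)" using poly by (auto simp: simple_multi_polytope_def multi_polytope_def is_multi_fan_def)
    have Worth: "w \<bullet> a = 0" if "w \<in> ?W" for w
      using linear_eq_0_on_span[OF h(1) _ that] h(2) ha by auto
    have aW: "a \<notin> ?W" using Worth[of a] aa by auto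
    then have ind: "independent (insert a (v ` K))" using gen(2)[OF K(1)] by (simp add: independent_insert)
    have cardI: "card (insert a (v ` K)) = DIM('v)"
      using aW K(2) gen(1)[OF K(1)] finK span_base[of a "v ` K"] by (auto simp: card_insert_if card_image)
    have "UNIV \<subseteq> span (insert a (v ` K))"
      by (rule card_ge_dim_independent) (use ind cardI in \<open>auto simp: dim_UNIV\<close>)
    then have decomp: "\<exists>r. z - r *\<^sub>R a \<in> ?W" for z using span_breakdown_eq[of z a "v ` K"] by auto
    have qW: "z - ?q z \<in> ?W" for z
    proof -
      obtain r where r: "z - r *\<^sub>R a \<in> ?W" using decomp by blast
      then have "r = z \<bullet> a / (a \<bullet> a)" using Worth[OF r] aa by (simp add: inner_diff_left divide_simps)
      then show ?thesis using r by simp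
    qed
    have q: "quot_map (span (?C K)) = ?q"
    proof
      fix z
      have W: "span (?C K) = ?W" by (simp add: gen(3)[OF K(1)] span_convex_cone_hull)
      show "quot_map (span (?C K)) z = ?q z"
        unfolding quot_map_def W
      proof (rule the_equality)
        have "?q z \<in> orthogonal_comp ?W"
          using Worth by (auto simp: orthogonal_comp_def orthogonal_def)
        then show "?q z \<in> orthogonal_comp ?W \<and> z - ?q z \<in> ?W" using qW by blast
        fix y assume y: "y \<in> orthogonal_comp ?W \<and> z - y \<in> ?W"
        have "?q z - y \<in> ?W" using span_diff[of "z - y" "v ` K" "z - ?q z"] y qW by (simp add: algebra_simps)
        moreover from this have "(?q z - y) \<bullet> y = 0" "(?q z - y) \<bullet> ?q z = 0"
          using y Worth by (auto simp: orthogonal_comp_def orthogonal_def)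
        then have "(?q z - y) \<bullet> (?q z - y) = 0" using inner_diff_right[of "?q z - y" "?q z" y] by linarith
        ultimately show "y = ?q z" by (simp only: inner_eq_zero_iff right_minus_eq)
      qed
    qed
    have linq: "linear ?q" by (intro linearI) (auto simp: inner_add_left add_divide_distrib scaleR_add_left)
    have UL: "span (fan_lattice \<Delta>) = UNIV" using poly by (auto simp: simple_multi_polytope_def multi_polytope_def)
    have spanP: "span (fan_lattice ?P) = span {a}"
    proof -
      have "span (fan_lattice ?P) = ?q ` UNIV"
        unfolding projected_def q using linear_span_image[OF linq, of "fan_lattice \<Delta>"] UL by simp
      also have "\<dots> = span {a}"
      proof
        show "?q ` UNIV \<subseteq> span {a}" by (auto intro: span_scale span_base)
        show "span {a} \<subseteq> ?q ` UNIV"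
        proof
          fix z assume "z \<in> span {a}"
          then obtain r where "z = r *\<^sub>R a" by (auto simp: span_singleton)
          then show "z \<in> ?q ` UNIV" using aa by (intro image_eqI[of _ _ "r *\<^sub>R a"]) auto
        qed
      qed
      finally show ?thesis .
    qed
    have dimP: "fan_dim ?P = 1"
    proof -
      have "dim (fan_lattice ?P) = dim (span (fan_lattice ?P))" by (simp only: dim_span)
      then show ?thesis unfolding fan_dim_def spanP using False by (simp add: dim_insert)
    qed
    have CP: "fan_cone ?P J = convex_cone hull (?q ` v ` J)" if "J \<in> faces \<Delta>" for J
      unfolding projected_def q using gen(3)[OF that] convex_cone_hull_linear_image[OF linq] by simp
    have qK: "?q (v k) = 0" if "k \<in> K" for k using h(2)[OF that] ha by simp
    have genP: "generic ?P (t *\<^sub>R a)" if "t \<noteq> 0" for t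
      unfolding generic_def
    proof (intro conjI ballI impI)
      show "t *\<^sub>R a \<in> span (fan_lattice ?P)" unfolding spanP by (intro span_scale span_base) simp
      fix I assume "dim (fan_cone ?P I) < fan_dim ?P"
      then have "dim (fan_cone ?P I) = 0" using dimP by simp
      then have "fan_cone ?P I \<subseteq> {0}" by (simp add: dim_eq_0)
      then have "span (fan_cone ?P I) \<subseteq> {0}" using span_mono[of "fan_cone ?P I" "{0}"] by simp
      then show "t *\<^sub>R a \<notin> span (fan_cone ?P I)" using that False by auto
    qed
    let ?E = "{i. i \<notin> K \<and> insert i K \<in> faces \<Delta>}"
    have vE: "v i \<bullet> a \<noteq> 0" if "i \<in> ?E" for i
    proof
      assume "v i \<bullet> a = 0"
      then have "v i \<in> ?W" using qW[of "v i"] by simp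
      moreover have "independent (v ` insert i K)" "inj_on v (insert i K)" using gen(1,2)[of "insert i K"] that by auto
      moreover have "v i \<notin> v ` K" using \<open>inj_on v (insert i K)\<close> that by auto
      ultimately show False by (simp add: independent_insert)
    qed
    \<comment> \<open>A maximal cone of the projected fan is the ray of the image of a single
      \<open>v i\<close>, and it contains the given multiple of \<open>a\<close> iff
      \<open>v i\<close> lies on that side.\<close>
    have set: "{I \<in> faces_dim ?P (fan_dim ?P). t *\<^sub>R a \<in> fan_cone ?P I} = (\<lambda>i. insert i K) ` {i\<in>?E. t * (v i \<bullet> a) > 0}"
      if t: "t \<noteq> 0" for t
    proof
      show "{I \<in> faces_dim ?P (fan_dim ?P). t *\<^sub>R a \<in> fan_cone ?P I} \<subseteq> (\<lambda>i. insert i K) ` {i\<in>?E. t * (v i \<bullet> a) > 0}"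
      proof
        fix I assume "I \<in> {I \<in> faces_dim ?P (fan_dim ?P). t *\<^sub>R a \<in> fan_cone ?P I}"
        then have I: "I \<in> faces \<Delta>" "K \<subseteq> I" "t *\<^sub>R a \<in> fan_cone ?P I"
          by (auto simp: faces_dim_def projected_def)
        have "card I \<le> DIM('v)"
          using gen(1,2)[OF I(1)] independent_card_le[of "v ` I"] by (simp add: card_image)
        note finI = finite_face[OF I(1)]
        have "I \<noteq> K"
        proof
          assume "I = K"
          have "?q ` v ` K \<subseteq> {0}" using qK by auto
          then have "convex_cone hull (?q ` v ` K) \<subseteq> {0}" by (intro hull_minimal) auto
          then show False using I(3) CP[OF K(1)] \<open>I = K\<close> t False by auto
        qed
        then obtain i where i: "i \<in> I" "i \<notin> K" using I(2) by blast
        have "card (insert i K) = DIM('v)" using i(2) finK K(2) by simp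
        then have "insert i K = I" using \<open>card I \<le> DIM('v)\<close> finI I(2) i by (intro card_seteq) auto
        with i I have iE: "i \<in> ?E" by auto
        have "?q ` v ` I \<subseteq> insert 0 {?q (v i)}" using qK \<open>insert i K = I\<close> by auto
        also have "\<dots> \<subseteq> convex_cone hull {?q (v i)}" by (auto intro: hull_inc convex_cone_hull_contains_0)
        finally have "fan_cone ?P I \<subseteq> convex_cone hull {?q (v i)}" unfolding CP[OF I(1)] by (rule convex_cone_hull_subset)
        then obtain r where r: "t *\<^sub>R a = r *\<^sub>R ?q (v i)" "r \<ge> 0" using I(3) convex_cone_hull_finite[of "{?q (v i)}"] by auto
        then have "t = r * (v i \<bullet> a / (a \<bullet> a))" using False by simp
        with t r(2) have "r > 0" by (auto simp: less_le)
        then have "t * (v i \<bullet> a) = r * (v i \<bullet> a)\<^sup>2 / (a \<bullet> a)" using \<open>t = _\<close> by (simp add: power2_eq_square)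
        also have "\<dots> > 0" using \<open>r > 0\<close> aa vE[OF iE] by (auto intro!: divide_pos_pos mult_pos_pos)
        finally show "I \<in> (\<lambda>i. insert i K) ` {i\<in>?E. t * (v i \<bullet> a) > 0}" using iE \<open>insert i K = I\<close> by auto
      qed
      show "(\<lambda>i. insert i K) ` {i\<in>?E. t * (v i \<bullet> a) > 0} \<subseteq> {I \<in> faces_dim ?P (fan_dim ?P). t *\<^sub>R a \<in> fan_cone ?P I}"
      proof
        fix I assume "I \<in> (\<lambda>i. insert i K) ` {i\<in>?E. t * (v i \<bullet> a) > 0}"
        then obtain i where i: "i \<in> ?E" "t * (v i \<bullet> a) > 0" "I = insert i K" by auto
        have If: "I \<in> faces \<Delta>" using i by auto
        let ?r = "t * (a \<bullet> a) / (v i \<bullet> a)"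
        have "?r = (t * (v i \<bullet> a)) * ((a \<bullet> a) / (v i \<bullet> a)\<^sup>2)"
          using vE[OF i(1)] by (simp add: power2_eq_square)
        also have "\<dots> > 0" using vE[OF i(1)] by (intro mult_pos_pos[OF i(2) divide_pos_pos[OF aa]]) simp
        finally have "?r > 0" .
        moreover have eq: "t *\<^sub>R a = ?r *\<^sub>R ?q (v i)" using vE[OF i(1)] aa by simp
        ultimately have inP: "t *\<^sub>R a \<in> fan_cone ?P I"
          unfolding CP[OF If] using i(3) by (subst eq) (intro convex_cone_hull_mul hull_inc, auto)
        have "fan_cone ?P I \<subseteq> span {a}"
          unfolding CP[OF If] by (rule hull_minimal) (auto simp: convex_cone_span intro!: span_scale intro: span_base)
        then have "dim (fan_cone ?P I) \<le> 1"
          using dim_subset[of "fan_cone ?P I" "span {a}"] False by (simp add: dim_insert)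
        moreover have "dim (fan_cone ?P I) \<noteq> 0" using inP t False by (auto simp: dim_eq_0)
        ultimately have "dim (fan_cone ?P I) = 1" by arith
        then show "I \<in> {I \<in> faces_dim ?P (fan_dim ?P). t *\<^sub>R a \<in> fan_cone ?P I}"
          using inP If i(3) dimP by (auto simp: faces_dim_def projected_def)
      qed
    qed
    have wP: "weight ?P = weight \<Delta>" by (auto simp: weight_def projected_def fun_eq_iff)
    have ld: "local_degree ?P (t *\<^sub>R a) = (\<Sum>i\<in>{i\<in>?E. t * (v i \<bullet> a) > 0}. weight \<Delta> (insert i K))" if "t \<noteq> 0" for t
      unfolding local_degree_def set[OF that] wP
      by (subst sum.reindex) (auto simp: inj_on_def)
    have "pre_complete ?P" using poly K(1) by (auto simp: simple_multi_polytope_def multi_polytope_def complete_fan_def)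
    then have "local_degree ?P y = local_degree ?P z" if "generic ?P y" "generic ?P z" for y z
      using that unfolding pre_complete_def by blast
    from this[OF genP genP, of 1 "-1"] have "local_degree ?P (1 *\<^sub>R a) = local_degree ?P ((-1) *\<^sub>R a)"
      by simp
    then have eq: "(\<Sum>i\<in>{i\<in>?E. v i \<bullet> a > 0}. weight \<Delta> (insert i K)) = (\<Sum>i\<in>{i\<in>?E. v i \<bullet> a < 0}. weight \<Delta> (insert i K))"
      using ld[of 1] ld[of "-1"] by simp
    have finE: "finite ?E"
    proof (rule finite_subset)
      show "?E \<subseteq> {1..d}" using poly by (auto simp: simple_multi_polytope_def augmented_on_def)
    qed simp
    have "(\<Sum>i\<in>?E. of_int (weight \<Delta> (insert i K)) * sgn (h (v i)))
       = (\<Sum>i\<in>?E. (if v i \<bullet> a > 0 then real_of_int (weight \<Delta> (insert i K)) else 0) - (if v i \<bullet> a < 0 then real_of_int (weight \<Delta> (insert i K)) else 0))"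
      using vE by (intro sum.cong) (auto simp: ha sgn_if)
    also have "\<dots> = real_of_int ((\<Sum>i\<in>{i\<in>?E. v i \<bullet> a > 0}. weight \<Delta> (insert i K)) - (\<Sum>i\<in>{i\<in>?E. v i \<bullet> a < 0}. weight \<Delta> (insert i K)))"
      using finE by (simp add: sum_subtractf sum.If_cases Int_def conj_commute)
    also have "\<dots> = 0" unfolding eq by simp
    finally show ?thesis .
  qed
qed

section \<open>Stratified maps from cell centres\<close>

lemma inj_unit_pt: "inj unit_pt"
  by (rule injI) (metis unit_pt_def zero_neq_one)

lemma fun_hull_unit:
  assumes "finite I"
  shows "fun_hull (unit_pt ` I) = {y. (\<forall>j. 0 \<le> y j) \<and> (\<forall>j. j \<notin> I \<longrightarrow> y j = 0) \<and> (\<Sum>j\<in>I. y j) = 1}"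
proof -
  have inj: "inj_on unit_pt I" using inj_unit_pt by (rule inj_on_subset) simp
  have eq: "(\<Sum>w\<in>unit_pt ` I. t w * w j) = (if j \<in> I then t (unit_pt j) else 0)" for t :: "(nat \<Rightarrow> real) \<Rightarrow> real" and j
  proof -
    have "(\<Sum>w\<in>unit_pt ` I. t w * w j) = (\<Sum>i\<in>I. t (unit_pt i) * unit_pt i j)"
      by (simp add: sum.reindex[OF inj])
    also have "\<dots> = (\<Sum>i\<in>I. if i = j then t (unit_pt j) else 0)"
      by (intro sum.cong) (auto simp: unit_pt_def)
    finally show ?thesis using assms by simp
  qed
  show ?thesis
  proof (intro equalityI subsetI)
    fix y assume "y \<in> fun_hull (unit_pt ` I)"
    then obtain t :: "(nat \<Rightarrow> real) \<Rightarrow> real" where t: "y = (\<lambda>j. \<Sum>w\<in>unit_pt ` I. t w * w j)" "\<forall>w\<in>unit_pt ` I. 0 \<le> t w" "(\<Sum>w\<in>unit_pt ` I. t w) = 1"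
      unfolding fun_hull_def by blast
    have y: "y j = (if j \<in> I then t (unit_pt j) else 0)" for j unfolding t(1) eq ..
    show "y \<in> {y. (\<forall>j. 0 \<le> y j) \<and> (\<forall>j. j \<notin> I \<longrightarrow> y j = 0) \<and> (\<Sum>j\<in>I. y j) = 1}"
      using t(2,3) by (simp add: y sum.reindex[OF inj])
  next
    fix y :: "nat \<Rightarrow> real" assume y: "y \<in> {y. (\<forall>j. 0 \<le> y j) \<and> (\<forall>j. j \<notin> I \<longrightarrow> y j = 0) \<and> (\<Sum>j\<in>I. y j) = 1}"
    define t where "t w = y (inv_into UNIV unit_pt w)" for w
    have t: "t (unit_pt j) = y j" for j unfolding t_def by (simp add: inv_f_f[OF inj_unit_pt])
    have "y = (\<lambda>j. \<Sum>w\<in>unit_pt ` I. t w * w j)" unfolding eq t using y by auto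
    moreover have "\<forall>w\<in>unit_pt ` I. 0 \<le> t w" "(\<Sum>w\<in>unit_pt ` I. t w) = 1"
      using y t by (auto simp: sum.reindex[OF inj])
    ultimately show "y \<in> fun_hull (unit_pt ` I)" unfolding fun_hull_def by blast
  qed
qed

lemma barycentre_apply: "finite I \<Longrightarrow> barycentre I j = (if j \<in> I then 1 / real (card I) else 0)"
  by (simp add: barycentre_def unit_pt_def if_distrib sum.delta cong: if_cong)

text \<open>Peeling off the minimal positive value writes \<open>y\<close> as a nonnegative combination of barycentres along
  the chain of its superlevel sets.\<close>

lemma barycentric_chain:
  assumes "finite I" "I \<noteq> {}" "\<And>j. j \<in> I \<Longrightarrow> 0 < y j" "\<And>j. j \<notin> I \<Longrightarrow> y j = (0::real)"
  shows "\<exists>c \<mu>. finite c \<and> (\<forall>X\<in>c. X \<subseteq> I \<and> {i. \<forall>j. y j \<le> y i} \<subseteq> X \<and> X \<noteq> {}) \<and> (\<forall>X\<in>c. \<forall>Z\<in>c. X \<subseteq> Z \<or> Z \<subseteq> X) \<and>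
    (\<forall>X\<in>c. 0 \<le> \<mu> X) \<and> (\<forall>j. y j = (\<Sum>X\<in>c. \<mu> X * barycentre X j))"
  using assms
proof (induction "card I" arbitrary: I y rule: less_induct)
  case less
  note I = less.prems(1,2) and pos = less.prems(3) and zero = less.prems(4)
  define m where "m = Min (y ` I)"
  have mle: "m \<le> y j" if "j \<in> I" for j unfolding m_def using that I by simp
  have "m \<in> y ` I" unfolding m_def using I by (intro Min_in) auto
  then obtain j0 where j0: "j0 \<in> I" "y j0 = m" by auto
  have m0: "0 < m" using j0 pos by auto
  define y' where "y' j = (if j \<in> I then y j - m else 0)" for j
  define I' where "I' = {j \<in> I. y j \<noteq> m}"
  let ?M = "{i. \<forall>j. y j \<le> y i}"
  have MI: "?M \<subseteq> I"
  proof
    fix i assume "i \<in> ?M"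
    then have "m \<le> y i" using j0 by auto
    then show "i \<in> I" using m0 zero[of i] by auto
  qed
  have yI: "y j = y' j + m * real (card I) * barycentre I j" for j
    using I zero by (auto simp: y'_def barycentre_apply)
  show ?case
  proof (cases "I' = {}")
    case True
    then have "y' j = 0" for j by (auto simp: y'_def I'_def)
    then show ?thesis
      using I MI m0 yI by (intro exI[of _ "{I}"] exI[of _ "\<lambda>_. m * real (card I)"]) auto
  next
    case False
    have sub: "I' \<subset> I" using j0 by (auto simp: I'_def)
    then have "card I' < card I" using I by (simp add: psubset_card_mono)
    have "\<exists>c \<mu>. finite c \<and> (\<forall>X\<in>c. X \<subseteq> I' \<and> {i. \<forall>j. y' j \<le> y' i} \<subseteq> X \<and> X \<noteq> {}) \<and> (\<forall>X\<in>c. \<forall>Z\<in>c. X \<subseteq> Z \<or> Z \<subseteq> X) \<and>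
      (\<forall>X\<in>c. 0 \<le> \<mu> X) \<and> (\<forall>j. y' j = (\<Sum>X\<in>c. \<mu> X * barycentre X j))"
    proof (rule less.hyps[OF \<open>card I' < card I\<close> _ False])
      show "finite I'" using I(1) sub finite_subset by blast
      show "0 < y' j" if "j \<in> I'" for j using that mle[of j] by (auto simp: I'_def y'_def less_le)
      show "y' j = 0" if "j \<notin> I'" for j using that by (auto simp: I'_def y'_def)
    qed
    then obtain c where "\<exists>\<mu>. finite c \<and> (\<forall>X\<in>c. X \<subseteq> I' \<and> {i. \<forall>j. y' j \<le> y' i} \<subseteq> X \<and> X \<noteq> {}) \<and> (\<forall>X\<in>c. \<forall>Z\<in>c. X \<subseteq> Z \<or> Z \<subseteq> X) \<and>
      (\<forall>X\<in>c. 0 \<le> \<mu> X) \<and> (\<forall>j. y' j = (\<Sum>X\<in>c. \<mu> X * barycentre X j))" ..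
    then obtain \<mu> where C: "finite c \<and> (\<forall>X\<in>c. X \<subseteq> I' \<and> {i. \<forall>j. y' j \<le> y' i} \<subseteq> X \<and> X \<noteq> {}) \<and> (\<forall>X\<in>c. \<forall>Z\<in>c. X \<subseteq> Z \<or> Z \<subseteq> X) \<and>
      (\<forall>X\<in>c. 0 \<le> \<mu> X) \<and> (\<forall>j. y' j = (\<Sum>X\<in>c. \<mu> X * barycentre X j))" ..
    note c = C[THEN conjunct1] C[THEN conjunct2, THEN conjunct1] C[THEN conjunct2, THEN conjunct2, THEN conjunct1]
      C[THEN conjunct2, THEN conjunct2, THEN conjunct2, THEN conjunct1]
      C[THEN conjunct2, THEN conjunct2, THEN conjunct2, THEN conjunct2, THEN spec]
    have Inc: "I \<notin> c" using c(2) sub by auto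
    have Meq: "?M \<subseteq> {i. \<forall>j. y' j \<le> y' i}" using MI mle by (auto simp: y'_def)
    define \<mu>' where "\<mu>' X = (if X = I then m * real (card I) else \<mu> X)" for X
    have "(\<Sum>X\<in>insert I c. \<mu>' X * barycentre X j) = y j" for j
      unfolding yI c(5) using c(1) Inc by (simp add: \<mu>'_def) (intro sum.cong, auto)
    moreover have "\<forall>X\<in>insert I c. X \<subseteq> I \<and> ?M \<subseteq> X \<and> X \<noteq> {}"
    proof
      fix X assume X: "X \<in> insert I c"
      show "X \<subseteq> I \<and> ?M \<subseteq> X \<and> X \<noteq> {}"
      proof (cases "X = I")
        case True
        then show ?thesis using MI I(2) by simp
      next
        case False
        then have "X \<subseteq> I'" "{i. \<forall>j. y' j \<le> y' i} \<subseteq> X" "X \<noteq> {}" using X c(2) by auto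
        then show ?thesis using order_trans[OF _ psubset_imp_subset[OF sub]] order_trans[OF Meq] by simp
      qed
    qed
    moreover have "\<forall>X\<in>insert I c. \<forall>Z\<in>insert I c. X \<subseteq> Z \<or> Z \<subseteq> X"
      using c(2,3) sub by blast
    moreover have "\<forall>X\<in>insert I c. 0 \<le> \<mu>' X" using c(4) m0 by (simp add: \<mu>'_def)
    ultimately show ?thesis
      using c(1) by (intro exI[of _ "insert I c"] exI[of _ \<mu>'] conjI allI) (simp_all only: finite_insert)
  qed
qed

section \<open>Points of the realisation and stars in its subdivision\<close>

locale finite_complex =
  fixes K :: "nat set set" and d :: nat
  assumes sub: "K \<subseteq> Pow {1..d}" and down: "I \<in> K \<Longrightarrow> J \<subseteq> I \<Longrightarrow> J \<in> K"
begin

definition points :: "(nat \<Rightarrow> real) set"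
  where "points = (\<Union>I \<in> K - {{}}. fun_hull (unit_pt ` I))"

lemma finite_face: "I \<in> K \<Longrightarrow> finite I"
  using sub finite_subset by blast

lemma finite_K: "finite K"
  using sub by (rule finite_subset) simp

lemma realization_points: "realization K = subtopology (powertop_real UNIV) points"
  by (simp add: realization_def points_def)

lemma points_iff: "y \<in> points \<longleftrightarrow> (\<forall>j. 0 \<le> y j) \<and> {j. y j \<noteq> 0} \<in> K \<and> (\<Sum>j | y j \<noteq> 0. y j) = 1"
proof
  assume "y \<in> points"
  then obtain I where I: "I \<in> K" "y \<in> fun_hull (unit_pt ` I)" unfolding points_def by blast
  then have y: "\<forall>j. 0 \<le> y j" "\<forall>j. j \<notin> I \<longrightarrow> y j = 0" "(\<Sum>j\<in>I. y j) = 1"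
    using fun_hull_unit[OF finite_face] by auto
  then have "{j. y j \<noteq> 0} \<subseteq> I" by auto
  moreover from this have "(\<Sum>j | y j \<noteq> 0. y j) = (\<Sum>j\<in>I. y j)"
    using finite_face[OF I(1)] by (intro sum.mono_neutral_left) auto
  ultimately show "(\<forall>j. 0 \<le> y j) \<and> {j. y j \<noteq> 0} \<in> K \<and> (\<Sum>j | y j \<noteq> 0. y j) = 1"
    using y down[OF I(1)] by auto
next
  assume y: "(\<forall>j. 0 \<le> y j) \<and> {j. y j \<noteq> 0} \<in> K \<and> (\<Sum>j | y j \<noteq> 0. y j) = 1"
  then have "y \<in> fun_hull (unit_pt ` {j. y j \<noteq> 0})"
    using fun_hull_unit[OF finite_face, of "{j. y j \<noteq> 0}"] by simp
  moreover have "{j. y j \<noteq> 0} \<noteq> {}" using y by (metis sum.empty zero_neq_one)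
  ultimately show "y \<in> points" using y unfolding points_def by blast
qed

lemma points_zero: "y \<in> points \<Longrightarrow> j \<notin> {1..d} \<Longrightarrow> y j = 0"
  using sub unfolding points_iff by blast

text \<open>Members of a chain through \<open>{i}\<close> all contain \<open>i\<close>, and the
  barycentre of such a set is largest at \<open>i\<close>. Together with \<open>sd_starI\<close>
  this identifies the star of \<open>i\<close> with the points whose largest coordinate is at
  \<open>i\<close>.\<close>

lemma sd_star_max:
  assumes "y \<in> sd_star K i"
  shows "y j \<le> y i"
proof -
  from assms obtain c where c: "subset.chain (K - {{}}) c" "{i} \<in> c" "y \<in> fun_hull (barycentre ` c)"
    unfolding sd_star_def by blast
  obtain t :: "(nat \<Rightarrow> real) \<Rightarrow> real" where t: "y = (\<lambda>j. \<Sum>w\<in>barycentre ` c. t w * w j)" "\<forall>w\<in>barycentre ` c. 0 \<le> t w"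
    using c(3) unfolding fun_hull_def by blast
  have "w j \<le> w i" if w: "w \<in> barycentre ` c" for w
  proof -
    obtain X where X: "X \<in> c" "w = barycentre X" using w by blast
    then have "X \<in> K" "X \<noteq> {}" using c(1) unfolding subset_chain_def by auto
    moreover have "X \<subseteq> {i} \<or> {i} \<subseteq> X" using c X(1) unfolding subset_chain_def by blast
    ultimately have "i \<in> X" by auto
    then show ?thesis using finite_face[OF \<open>X \<in> K\<close>] unfolding X(2) by (simp add: barycentre_apply)
  qed
  then show ?thesis unfolding t(1) using t(2) by (intro sum_mono mult_left_mono) auto
qed

lemma sd_star_subset: "sd_star K i \<subseteq> points"
proof
  fix y assume "y \<in> sd_star K i"
  then obtain c where c: "subset.chain (K - {{}}) c" "{i} \<in> c" "y \<in> fun_hull (barycentre ` c)"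
    unfolding sd_star_def by blast
  have cK: "c \<subseteq> K - {{}}" using c(1) unfolding subset_chain_def by blast
  then have fin: "finite c" using finite_K by (meson finite_Diff finite_subset)
  have UK: "\<Union>c \<in> K"
    using Union_in_chain[OF fin _ c(1)] c(2) cK by auto
  obtain t :: "(nat \<Rightarrow> real) \<Rightarrow> real" where t: "y = (\<lambda>j. \<Sum>w\<in>barycentre ` c. t w * w j)" "\<forall>w\<in>barycentre ` c. 0 \<le> t w" "(\<Sum>w\<in>barycentre ` c. t w) = 1"
    using c(3) unfolding fun_hull_def by blast
  have w: "0 \<le> w j" "j \<notin> \<Union>c \<Longrightarrow> w j = 0" "(\<Sum>j\<in>\<Union>c. w j) = 1" if w: "w \<in> barycentre ` c" for w j
  proof -
    obtain X where X: "X \<in> c" "w = barycentre X" using w by blast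
    then have XK: "finite X" "X \<noteq> {}" "X \<subseteq> \<Union>c" using cK finite_face by auto
    show "0 \<le> w j" "j \<notin> \<Union>c \<Longrightarrow> w j = 0" using XK X by (auto simp: barycentre_apply)
    have "(\<Sum>j\<in>\<Union>c. w j) = (\<Sum>j\<in>X. w j)"
      using XK X finite_face[OF UK] by (intro sum.mono_neutral_right) (auto simp: barycentre_apply)
    then show "(\<Sum>j\<in>\<Union>c. w j) = 1" using XK X by (simp add: barycentre_apply)
  qed
  have "(\<Sum>j\<in>\<Union>c. y j) = (\<Sum>w\<in>barycentre ` c. t w * (\<Sum>j\<in>\<Union>c. w j))"
    unfolding t(1) sum_distrib_left by (rule sum.swap)
  also have "\<dots> = 1" using w(3) t(3) by simp
  finally have "y \<in> fun_hull (unit_pt ` (\<Union>c))"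
    unfolding fun_hull_unit[OF finite_face[OF UK]] using t(2) w unfolding t(1)
    by (auto intro!: sum_nonneg sum.neutral)
  then show "y \<in> points" unfolding points_def using UK c(2) by blast
qed

text \<open>The chain of superlevel sets from \<open>barycentric_chain\<close> consists of sets
  containing \<open>i\<close>, so \<open>{i}\<close> can be added to it; it gets weight 0 if it is
  not yet a member.\<close>

lemma sd_starI:
  assumes y: "y \<in> points" and i: "\<And>j. y j \<le> y i"
  shows "y \<in> sd_star K i"
proof -
  let ?I = "{j. y j \<noteq> 0}"
  have IK: "?I \<in> K" and nn: "\<And>j. 0 \<le> y j" and sum1: "(\<Sum>j\<in>?I. y j) = 1" using y unfolding points_iff by auto
  have ne: "?I \<noteq> {}" using sum1 by (metis sum.empty zero_neq_one)
  have "\<exists>c \<mu>. finite c \<and> (\<forall>X\<in>c. X \<subseteq> ?I \<and> {i. \<forall>j. y j \<le> y i} \<subseteq> X \<and> X \<noteq> {}) \<and> (\<forall>X\<in>c. \<forall>Z\<in>c. X \<subseteq> Z \<or> Z \<subseteq> X) \<and>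
    (\<forall>X\<in>c. 0 \<le> \<mu> X) \<and> (\<forall>j. y j = (\<Sum>X\<in>c. \<mu> X * barycentre X j))"
    by (rule barycentric_chain) (use finite_face[OF IK] ne nn in \<open>auto simp: less_le\<close>)
  then obtain c where "\<exists>\<mu>. finite c \<and> (\<forall>X\<in>c. X \<subseteq> ?I \<and> {i. \<forall>j. y j \<le> y i} \<subseteq> X \<and> X \<noteq> {}) \<and> (\<forall>X\<in>c. \<forall>Z\<in>c. X \<subseteq> Z \<or> Z \<subseteq> X) \<and>
    (\<forall>X\<in>c. 0 \<le> \<mu> X) \<and> (\<forall>j. y j = (\<Sum>X\<in>c. \<mu> X * barycentre X j))" ..
  then obtain \<mu> where C: "finite c \<and> (\<forall>X\<in>c. X \<subseteq> ?I \<and> {i. \<forall>j. y j \<le> y i} \<subseteq> X \<and> X \<noteq> {}) \<and> (\<forall>X\<in>c. \<forall>Z\<in>c. X \<subseteq> Z \<or> Z \<subseteq> X) \<and>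
    (\<forall>X\<in>c. 0 \<le> \<mu> X) \<and> (\<forall>j. y j = (\<Sum>X\<in>c. \<mu> X * barycentre X j))" ..
  note C' = C[THEN conjunct1] C[THEN conjunct2, THEN conjunct1] C[THEN conjunct2, THEN conjunct2, THEN conjunct1]
    C[THEN conjunct2, THEN conjunct2, THEN conjunct2, THEN conjunct1]
    C[THEN conjunct2, THEN conjunct2, THEN conjunct2, THEN conjunct2, THEN spec]
  have iM: "i \<in> {i. \<forall>j. y j \<le> y i}" using i by simp
  have c: "finite c" "X \<in> c \<Longrightarrow> X \<subseteq> ?I" "X \<in> c \<Longrightarrow> i \<in> X"
    "X \<in> c \<Longrightarrow> Z \<in> c \<Longrightarrow> X \<subseteq> Z \<or> Z \<subseteq> X"
    "X \<in> c \<Longrightarrow> 0 \<le> \<mu> X" "y j = (\<Sum>X\<in>c. \<mu> X * barycentre X j)" for X Z j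
  proof -
    show "finite c" by (rule C'(1))
    show "X \<subseteq> ?I" if "X \<in> c" using bspec[OF C'(2) that] by (rule conjunct1)
    show "i \<in> X" if "X \<in> c"
      using bspec[OF C'(2) that, THEN conjunct2, THEN conjunct1] iM by (rule subsetD)
    show "X \<subseteq> Z \<or> Z \<subseteq> X" if "X \<in> c" "Z \<in> c"
      by (rule bspec[OF bspec[OF C'(3) that(1)] that(2)])
    show "0 \<le> \<mu> X" if "X \<in> c" by (rule bspec[OF C'(4) that])
    show "y j = (\<Sum>X\<in>c. \<mu> X * barycentre X j)" by (rule C'(5))
  qed
  have iI: "i \<in> ?I" using ne i nn by (metis (mono_tags, lifting) antisym empty_Collect_eq mem_Collect_eq)
  let ?c = "insert {i} c"
  have cX: "X \<in> K" "i \<in> X" "X \<subseteq> ?I" "finite X" if "X \<in> ?c" for X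
  proof -
    show "i \<in> X" "X \<subseteq> ?I" using that c iI by auto
    then show "X \<in> K" using down[OF IK] by blast
    then show "finite X" by (rule finite_face)
  qed
  have chain: "subset.chain (K - {{}}) ?c"
    unfolding subset_chain_def
  proof (intro conjI ballI)
    show "?c \<subseteq> K - {{}}" using cX(1,2) by blast
    fix X Z assume XZ: "X \<in> ?c" "Z \<in> ?c"
    then show "X \<subseteq> Z \<or> Z \<subseteq> X" using c(4) cX(2)[OF XZ(1)] cX(2)[OF XZ(2)] by blast
  qed
  have inj: "inj_on barycentre ?c"
  proof (rule inj_onI)
    fix X Z assume XZ: "X \<in> ?c" "Z \<in> ?c" "barycentre X = barycentre Z"
    have "j \<in> X \<longleftrightarrow> j \<in> Z" for j
      using fun_cong[OF XZ(3), of j] cX(4)[OF XZ(1)] cX(4)[OF XZ(2)] by (auto simp: barycentre_apply split: if_splits)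
    then show "X = Z" by blast
  qed
  define \<mu>' where "\<mu>' X = (if X \<in> c then \<mu> X else 0)" for X
  define t where "t w = \<mu>' (inv_into ?c barycentre w)" for w
  have t: "t (barycentre X) = \<mu>' X" if "X \<in> ?c" for X unfolding t_def using inv_into_f_f[OF inj that] by simp
  have ext: "(\<Sum>w\<in>barycentre ` ?c. t w * g w) = (\<Sum>X\<in>c. \<mu> X * g (barycentre X))" for g :: "(nat \<Rightarrow> real) \<Rightarrow> real"
  proof -
    have "(\<Sum>w\<in>barycentre ` ?c. t w * g w) = (\<Sum>X\<in>?c. \<mu>' X * g (barycentre X))"
      unfolding sum.reindex[OF inj] using t by (intro sum.cong) auto
    also have "\<dots> = (\<Sum>X\<in>c. \<mu> X * g (barycentre X))"
      using c(1) by (intro sum.mono_neutral_cong_right) (auto simp: \<mu>'_def)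
    finally show ?thesis .
  qed
  have "(\<Sum>w\<in>barycentre ` ?c. t w) = (\<Sum>X\<in>c. \<mu> X)" using ext[of "\<lambda>_. 1"] by simp
  also have "\<dots> = (\<Sum>X\<in>c. \<mu> X * (\<Sum>j\<in>?I. barycentre X j))"
  proof (rule sum.cong[OF refl])
    fix X assume X: "X \<in> c"
    then have Xc: "X \<in> ?c" by simp
    have "(\<Sum>j\<in>?I. barycentre X j) = (\<Sum>j\<in>X. barycentre X j)"
      using cX[OF Xc] finite_face[OF IK] by (intro sum.mono_neutral_right) (auto simp: barycentre_apply)
    also have "\<dots> = 1" using cX[OF Xc] by (auto simp: barycentre_apply)
    finally show "\<mu> X = \<mu> X * (\<Sum>j\<in>?I. barycentre X j)" by simp
  qed
  also have "\<dots> = (\<Sum>j\<in>?I. y j)" unfolding c(6) sum_distrib_left by (rule sum.swap)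
  finally have "(\<Sum>w\<in>barycentre ` ?c. t w) = 1" using sum1 by simp
  moreover have "y = (\<lambda>j. \<Sum>w\<in>barycentre ` ?c. t w * w j)"
    using ext[of "\<lambda>w. w j" for j] c(6) by auto
  moreover have "\<forall>w\<in>barycentre ` ?c. 0 \<le> t w" using t c(5) by (auto simp: \<mu>'_def)
  ultimately have "y \<in> fun_hull (barycentre ` ?c)" unfolding fun_hull_def by blast
  then show ?thesis unfolding sd_star_def using chain by blast
qed

lemma points_max:
  assumes "y \<in> points"
  obtains i where "i \<in> {1..d}" "{i} \<in> K" "\<And>j. y j \<le> y i" "0 < y i"
proof -
  let ?I = "{j. y j \<noteq> 0}"
  have IK: "?I \<in> K" and nn: "\<And>j. 0 \<le> y j" and sum1: "(\<Sum>j\<in>?I. y j) = 1" using assms unfolding points_iff by auto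
  have ne: "?I \<noteq> {}" using sum1 by (metis sum.empty zero_neq_one)
  have "Max (y ` ?I) \<in> y ` ?I" using finite_face[OF IK] ne by (intro Max_in) auto
  then obtain i where i: "i \<in> ?I" "y i = Max (y ` ?I)" by auto
  have "y j \<le> y i" for j
    using finite_face[OF IK] nn[of i] i(2) by (cases "y j = 0") auto
  moreover have "0 < y i" using i nn[of i] by (simp add: less_le)
  moreover have "{i} \<in> K" "i \<in> {1..d}" using i down[OF IK, of "{i}"] IK sub by auto
  ultimately show ?thesis using that by blast
qed

text \<open>The weight of \<open>X\<close> is positive exactly where \<open>y\<close> is larger on \<open>X\<close> than off \<open>X\<close>; the index \<open>0\<close>, never a
  vertex, stands for the value \<open>0\<close>.\<close>

definition bump :: "nat set \<Rightarrow> (nat \<Rightarrow> real) \<Rightarrow> real"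
  where "bump X y = (\<Prod>i\<in>X. \<Prod>j\<in>{0..d} - X. max 0 (y i - y j))"

lemma bump_nonneg: "0 \<le> bump X y"
  unfolding bump_def by (intro prod_nonneg ballI) auto

lemma bump_pos:
  assumes "bump X y \<noteq> 0" "i \<in> X" "j \<in> {0..d} - X" "X \<in> K"
  shows "y j < y i"
proof -
  have "(\<Prod>j\<in>{0..d} - X. max 0 (y i - y j)) \<noteq> 0"
    using assms finite_face[OF assms(4)] unfolding bump_def by (simp add: prod_zero_iff)
  then have "max 0 (y i - y j) \<noteq> 0" using assms(3) by (simp add: prod_zero_iff)
  then show ?thesis by (auto simp: max_def split: if_splits)
qed

text \<open>The first claim confines the faces that count on the boundary of a maximal simplex. The
  second puts the value of a cell map at \<open>y\<close> into every hyperplane whose index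
  maximises \<open>y\<close>.\<close>

lemma bump_support:
  assumes y: "y \<in> points" and X: "X \<in> K - {{}}" "bump X y \<noteq> 0"
  shows "X \<subseteq> {j. y j \<noteq> 0}" "\<And>i. (\<And>j. y j \<le> y i) \<Longrightarrow> i \<in> X"
proof -
  have "X \<subseteq> {1..d}" using X(1) sub by blast
  then have 0: "0 \<in> {0..d} - X" by auto
  have y0: "y 0 = 0" using points_zero[OF y, of 0] by simp
  show "X \<subseteq> {j. y j \<noteq> 0}" using bump_pos[OF X(2) _ 0] X(1) y0 by force
  fix i assume i: "\<And>j. y j \<le> y i"
  obtain k where k: "k \<in> X" using X by auto
  then have "0 < y k" using bump_pos[OF X(2) _ 0, of k] X(1) y0 by simp
  then have "0 < y i" using i[of k] by simp
  then have "i \<in> {1..d}" using points_zero[OF y, of i] by force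
  then show "i \<in> X" using bump_pos[OF X(2) k, of i] X(1) i[of k] by fastforce
qed

text \<open>One weight is always positive: that of the set where \<open>y\<close> is
  maximal.\<close>

lemma bump_sum_pos:
  assumes y: "y \<in> points"
  shows "0 < (\<Sum>X\<in>K - {{}}. bump X y)"
proof -
  obtain i where i: "i \<in> {1..d}" "\<And>j. y j \<le> y i" "0 < y i" using points_max[OF y] by blast
  let ?M = "{k. y k = y i}"
  have MK: "?M \<in> K"
  proof (rule down)
    show "{j. y j \<noteq> 0} \<in> K" using y unfolding points_iff by blast
  qed (use i in auto)
  have "0 < bump ?M y"
    unfolding bump_def
  proof (intro prod_pos ballI)
    fix k j assume "k \<in> ?M" "j \<in> {0..d} - ?M"
    then have "y k = y i" "\<not> y j = y i" by auto
    then have "y j < y k" using i(2)[of j] by linarith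
    then show "0 < max 0 (y k - y j)" by simp
  qed
  then show ?thesis
    using MK finite_K bump_nonneg by (intro sum_pos2[of _ ?M]) auto
qed

lemma continuous_bump: "continuous_on A (bump X)"
  unfolding bump_def by (intro continuous_intros)

text \<open>A partition of unity over the chain of superlevel sets of \<open>y\<close>, in place of
  the piecewise linear map on the subdivision: continuity needs no gluing of simplices, and affine
  conditions common to the centres involved are inherited.\<close>

definition cell_map :: "(nat set \<Rightarrow> 'w::real_normed_vector) \<Rightarrow> (nat \<Rightarrow> real) \<Rightarrow> 'w"
  where "cell_map q y = (\<Sum>X\<in>K - {{}}. (bump X y / (\<Sum>Z\<in>K - {{}}. bump Z y)) *\<^sub>R q X)"

lemma continuous_cell_map: "continuous_on points (cell_map q)"
  unfolding cell_map_def
  by (intro continuous_intros continuous_bump) (use bump_sum_pos in force)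

lemma cell_map_const:
  fixes q :: "nat set \<Rightarrow> 'v::real_normed_vector \<Rightarrow>\<^sub>L real"
  assumes y: "y \<in> points" and "\<And>X. X \<in> K - {{}} \<Longrightarrow> bump X y \<noteq> 0 \<Longrightarrow> blinfun_apply (q X) w = t"
  shows "blinfun_apply (cell_map q y) w = t"
proof -
  let ?S = "\<Sum>Z\<in>K - {{}}. bump Z y"
  have "blinfun_apply (cell_map q y) w = (\<Sum>X\<in>K - {{}}. (bump X y / ?S) * blinfun_apply (q X) w)"
    by (simp add: cell_map_def blinfun.sum_left blinfun.scaleR_left)
  also have "\<dots> = (\<Sum>X\<in>K - {{}}. (bump X y / ?S) * t)"
    using assms(2) by (intro sum.cong) auto
  also have "\<dots> = t"
    using bump_sum_pos[OF y] by (simp flip: sum_distrib_right sum_divide_distrib)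
  finally show ?thesis .
qed

end

section \<open>Singular simplices with vertices in increasing order\<close>

lemma sorted_list_remove_nth:
  assumes "finite I" "k < card I" "j < card I - 1"
  shows "sorted_list_of_set (I - {sorted_list_of_set I ! k}) ! j =
    (if j < k then sorted_list_of_set I ! j else sorted_list_of_set I ! Suc j)"
proof -
  let ?s = "sorted_list_of_set I"
  have len: "length ?s = card I" using assms(1) by simp
  have sp: "?s = take k ?s @ ?s ! k # drop (Suc k) ?s" using assms(2) len by (simp add: id_take_nth_drop)
  have "distinct ?s" by simp
  then have "?s ! k \<notin> set (take k ?s)" using sp by (metis distinct_append disjoint_iff list.set_intros(1))
  then have "remove1 (?s ! k) ?s = take k ?s @ drop (Suc k) ?s"
    by (subst (2) sp) (simp add: remove1_append)
  then have "sorted_list_of_set (I - {?s ! k}) = take k ?s @ drop (Suc k) ?s"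
    using sorted_list_of_set_remove[OF assms(1), of "?s ! k"] by simp
  then show ?thesis using assms(2,3) len by (auto simp: nth_append min_def)
qed

lemma bij_betw_sorted_list:
  assumes "finite I"
  shows "bij_betw (\<lambda>k. sorted_list_of_set I ! k) {..<card I} I"
  using bij_betw_nth[of "sorted_list_of_set I" "{..<card I}" I] assms by simp

text \<open>The simplex in \<open>oriented_face\<close> without its sign.\<close>

definition std_simplex :: "nat set \<Rightarrow> (nat \<Rightarrow> real) \<Rightarrow> nat \<Rightarrow> real"
  where "std_simplex I = oriented_simplex (card I - 1) (\<lambda>k. unit_pt (sorted_list_of_set I ! k))"

lemma std_simplex_apply:
  assumes "finite I" "card I = Suc n" "y \<in> standard_simplex n" "k \<le> n"
  shows "std_simplex I y (sorted_list_of_set I ! k) = y k"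
proof -
  have "unit_pt (sorted_list_of_set I ! j) (sorted_list_of_set I ! k) = (if j = k then 1 else 0)" if "j \<le> n" for j
  proof -
    have "(sorted_list_of_set I ! j = sorted_list_of_set I ! k) = (j = k)"
      by (rule nth_eq_iff_index_eq) (use that assms in auto)
    then show ?thesis by (auto simp: unit_pt_def)
  qed
  then have "(\<Sum>j\<le>n. unit_pt (sorted_list_of_set I ! j) (sorted_list_of_set I ! k) * y j) = (\<Sum>j\<le>n. if j = k then y j else 0)"
    by (intro sum.cong) auto
  then show ?thesis using assms by (simp add: std_simplex_def oriented_simplex_def)
qed

lemma std_simplex_off:
  assumes "finite I" "card I = Suc n" "y \<in> standard_simplex n" "i \<notin> I"
  shows "std_simplex I y i = 0"
proof -
  have "unit_pt (sorted_list_of_set I ! j) i = 0" if "j \<le> n" for j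
    using that assms nth_mem[of j "sorted_list_of_set I"] by (auto simp: unit_pt_def)
  then show ?thesis using assms by (simp add: std_simplex_def oriented_simplex_def)
qed

lemma singular_face_std_simplex:
  assumes "finite I" "card I = Suc (Suc n)" "k \<le> Suc n"
  shows "singular_face (Suc n) k (std_simplex I) = std_simplex (I - {sorted_list_of_set I ! k})"
proof -
  have "sorted_list_of_set I ! k \<in> I" using assms nth_mem[of k "sorted_list_of_set I"] by simp
  then have "card (I - {sorted_list_of_set I ! k}) = Suc n" using assms by simp
  then show ?thesis
    using assms sorted_list_remove_nth[of I k]
    by (auto simp: std_simplex_def singular_face_oriented_simplex oriented_simplex_eq)
qed

lemma (in finite_complex) std_simplex_points:
  assumes I: "I \<in> K" "card I = Suc n" and y: "y \<in> standard_simplex n"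
  shows "std_simplex I y \<in> points"
proof -
  have fin: "finite I" using I(1) by (rule finite_face)
  let ?s = "sorted_list_of_set I"
  have "std_simplex I y i \<ge> 0" for i
  proof (cases "i \<in> I")
    case True
    then obtain k where "k \<le> n" "i = ?s ! k"
      using fin I(2) by (metis in_set_conv_nth length_sorted_list_of_set less_Suc_eq_le set_sorted_list_of_set)
    then show ?thesis using std_simplex_apply[OF fin I(2) y] y by (simp add: standard_simplex_def)
  qed (simp add: std_simplex_off[OF fin I(2) y])
  moreover have "(\<Sum>i\<in>I. std_simplex I y i) = (\<Sum>k<card I. std_simplex I y (?s ! k))"
    by (rule sum.reindex_bij_betw[OF bij_betw_sorted_list[OF fin], symmetric])
  then have "(\<Sum>i\<in>I. std_simplex I y i) = 1"
    using std_simplex_apply[OF fin I(2) y] y I(2) by (simp add: lessThan_Suc_atMost standard_simplex_def del: sum.lessThan_Suc)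
  ultimately have "std_simplex I y \<in> fun_hull (unit_pt ` I)"
    unfolding fun_hull_unit[OF fin] using std_simplex_off[OF fin I(2) y] by auto
  then show ?thesis unfolding points_def using I by auto
qed

lemma (in finite_complex) singular_simplex_std_simplex:
  assumes "I \<in> K" "card I = Suc n"
  shows "singular_simplex n (realization K) (std_simplex I)"
proof -
  have "simplicial_simplex n points (std_simplex I)"
    unfolding simplicial_simplex using std_simplex_points[OF assms] assms(2) by (auto simp: std_simplex_def)
  then show ?thesis
    unfolding realization_points by (rule simplicial_imp_singular_simplex)
qed

section \<open>The contribution of one maximal simplex\<close>

lemma continuous_map_simplex_top:
  "continuous_on (standard_simplex n) f \<Longrightarrow> continuous_map (simplex_top n) euclidean f"
  by (simp add: euclidean_product_topology)

lemma chain_map_id_simplex: "chain_map n f (frag_of (id_simplex n)) = frag_of (restrict f (standard_simplex n))"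
  by (auto simp: simplex_map_def fun_eq_iff intro!: arg_cong[where f = frag_of])

lemma homologous_straight_simplex:
  fixes f g :: "(nat \<Rightarrow> real) \<Rightarrow> 'w::real_normed_vector"
  assumes f: "continuous_on (standard_simplex n) f" and g: "continuous_on (standard_simplex n) g"
    and A: "\<And>y s. y \<in> standard_simplex n \<Longrightarrow> 0 \<le> s \<Longrightarrow> s \<le> 1 \<Longrightarrow> (1 - s) *\<^sub>R f y + s *\<^sub>R g y \<in> A"
    and H: "\<And>y s. y \<in> simplex_bd n \<Longrightarrow> 0 \<le> s \<Longrightarrow> s \<le> 1 \<Longrightarrow> (1 - s) *\<^sub>R f y + s *\<^sub>R g y \<in> H"
  shows "homologous_rel n (top_of_set A) H (frag_of (restrict f (standard_simplex n))) (frag_of (restrict g (standard_simplex n)))"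
  unfolding chain_map_id_simplex[of n f, symmetric] chain_map_id_simplex[of n g, symmetric]
proof (rule homologous_straight[OF singular_relcycle_id])
  show "continuous_map (simplex_top n) euclidean f" "continuous_map (simplex_top n) euclidean g"
    by (rule continuous_map_simplex_top[OF f], rule continuous_map_simplex_top[OF g])
  show "(1 - s) *\<^sub>R f y + s *\<^sub>R g y \<in> A" if "y \<in> topspace (simplex_top n)" "0 \<le> s" "s \<le> 1" for y s
    by (rule A[OF _ that(2,3)]) (use that(1) in simp)
  show "(1 - s) *\<^sub>R f y + s *\<^sub>R g y \<in> H" if "y \<in> simplex_bd n" "0 \<le> s" "s \<le> 1" for y s
    by (rule H[OF that])
qed

lemma simplex_argmax:
  assumes "y \<in> standard_simplex n"
  obtains j where "j \<le> n" "\<And>i. y i \<le> y j"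
proof -
  have "Max (y ` {..n}) \<in> y ` {..n}" by (rule Max_in) auto
  then obtain j where j: "Max (y ` {..n}) = y j" "j \<in> {..n}" unfolding image_iff by blast
  have "y i \<le> y j" for i
  proof (cases "i \<le> n")
    case True
    then show ?thesis unfolding j(1)[symmetric] by (intro Max_ge) auto
  next
    case False
    then show ?thesis using assms by (simp add: standard_simplex_def)
  qed
  with j(2) show ?thesis by (intro that) auto
qed

lemma diff_less_zero_scale:
  fixes r s t :: real
  assumes "0 < t" "r * 2 - s * t < 0"
  shows "r * (2 / t) - s < 0"
  using assms by (simp add: field_simps)

text \<open>One maximal simplex in normal form: \<open>P\<close> is its vertex of the arrangement,
  the \<open>b j\<close> are the ray vectors rescaled to sum \<open>x\<close>, and \<open>g\<close>
  is the cell map on the simplex. Where the barycentric coordinate \<open>j\<close> is largest,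
  \<open>g\<close> stays on the hyperplane of index \<open>j\<close>, so a homotopy respecting this
  condition misses \<open>u\<close> by \<open>off\<close>.\<close>

locale corner =
  fixes b :: "nat \<Rightarrow> 'v::euclidean_space" and x :: 'v and u P :: "'v \<Rightarrow>\<^sub>L real" and g :: "(nat \<Rightarrow> real) \<Rightarrow> 'v \<Rightarrow>\<^sub>L real"
  assumes b: "ordered_basis b" and x: "x = (\<Sum>k<DIM('v). b k)"
    and g: "continuous_on (standard_simplex (DIM('v) - 1)) g"
    and g_face: "\<And>y j. y \<in> standard_simplex (DIM('v) - 1) \<Longrightarrow> j < DIM('v) \<Longrightarrow> (\<And>i. y i \<le> y j) \<Longrightarrow>
      blinfun_apply (g y) (b j) = blinfun_apply P (b j)"
    and g_bd: "\<And>y. y \<in> simplex_bd (DIM('v) - 1) \<Longrightarrow>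
      blinfun_apply (g y) x = blinfun_apply u x + 1 / (2 * real DIM('v) - 1)"
    and off: "\<And>j. j < DIM('v) \<Longrightarrow> blinfun_apply u (b j) \<noteq> blinfun_apply P (b j)"
begin

abbreviation "T \<equiv> blinfun_apply u x + 1 / (2 * real DIM('v) - 1)"
abbreviation "H \<equiv> {f. T \<le> blinfun_apply f x}"
abbreviation "X \<equiv> top_of_set (UNIV - {u})"

lemma DIM_ge_1: "1 \<le> real DIM('v)"
proof -
  have "0 < DIM('v)" by simp
  then show ?thesis by linarith
qed

lemma two_DIM_pos: "0 < (2 * real DIM('v) - 1)"
  using DIM_ge_1 by linarith

lemma less_DIM_iff: "j < DIM('v) \<longleftrightarrow> j \<le> (DIM('v) - 1)"
  using Suc_DIM[where 'v='v] by linarith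

lemma sum_lessThan_DIM: "(\<Sum>k<DIM('v). f k) = (\<Sum>k\<le>(DIM('v) - 1). f k)" for f :: "nat \<Rightarrow> 'z::comm_monoid_add"
  by (intro sum.cong) (auto simp: less_DIM_iff)

lemma dual_x: "k < DIM('v) \<Longrightarrow> blinfun_apply (dual b k) x = 1"
  by (simp add: x blinfun.sum_right dual_apply[OF b])

lemma subtopology_H: "subtopology X H = top_of_set H"
proof -
  have "H \<subseteq> UNIV - {u}" using two_DIM_pos by auto
  then show ?thesis by (simp add: subtopology_subtopology Int_absorb1)
qed

lemma simplex_in_H:
  assumes "continuous_on (standard_simplex (DIM('v) - 1)) f" "\<And>y. y \<in> standard_simplex (DIM('v) - 1) \<Longrightarrow> f y \<in> H"
  shows "homologous_rel (DIM('v) - 1) X H (frag_of (restrict f (standard_simplex (DIM('v) - 1)))) 0"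
proof -
  have "singular_simplex (DIM('v) - 1) (top_of_set H) (restrict f (standard_simplex (DIM('v) - 1)))"
    unfolding singular_simplex_def continuous_map_simplex_iff using assms by (auto cong: continuous_on_cong)
  then have "singular_chain (DIM('v) - 1) (subtopology X H) (frag_of (restrict f (standard_simplex (DIM('v) - 1))))"
    unfolding subtopology_H by (simp add: singular_chain_of)
  then show ?thesis by (simp add: homologous_rel_def singular_chain_imp_relboundary)
qed

lemma segment_H:
  assumes "T \<le> blinfun_apply f x" "T \<le> blinfun_apply f' x" "0 \<le> s" "s \<le> 1"
  shows "(1 - s) *\<^sub>R f + s *\<^sub>R f' \<in> H"
proof -
  have "(1 - s) * T + s * T \<le> (1 - s) * blinfun_apply f x + s * blinfun_apply f' x"
    using assms by (intro add_mono mult_left_mono) auto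
  moreover have "(1 - s) * T + s * T = T" by (simp only: left_diff_distrib mult_1_left diff_add_cancel)
  ultimately show ?thesis by (simp only: mem_Collect_eq blinfun.add_left blinfun.scaleR_left real_scaleR_def)
qed

text \<open>The image can be pushed into \<open>H\<close> on the side of \<open>b j0\<close>: first
  to a map \<open>f\<close> that keeps the face conditions of \<open>g\<close> and exceeds
  \<open>u\<close> at \<open>b j0\<close> everywhere, then to a constant in
  \<open>H\<close>.\<close>

lemma homologous_outside:
  assumes j0: "j0 < DIM('v)" "blinfun_apply u (b j0) < blinfun_apply P (b j0)"
  shows "homologous_rel (DIM('v) - 1) X H (frag_of (restrict g (standard_simplex (DIM('v) - 1)))) 0"
proof -
  define t where "t = max 0 (T - blinfun_apply P x)"
  \<comment> \<open>\<open>G j\<close> vanishes where coordinate \<open>j\<close> is largest, so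
    \<open>f\<close> meets the face conditions. On the boundary the \<open>G\<close> of a vanishing
    coordinate is 1, so the factor \<open>t\<close> lifts \<open>f\<close> to height
    \<open>T\<close> there.\<close>
  define G where "G k y = (\<Sum>j<DIM('v). max 0 (y j - y k))" for k and y :: "nat \<Rightarrow> real"
  define f where "f y = P + t *\<^sub>R (\<Sum>k<DIM('v). G k y *\<^sub>R dual b k)" for y
  define Q where "Q = P + t *\<^sub>R (\<Sum>k<DIM('v). dual b k)"
  have t: "0 \<le> t" "T \<le> blinfun_apply P x + t" by (auto simp: t_def)
  have G0: "0 \<le> G k y" for k y unfolding G_def by (intro sum_nonneg) auto
  have contf: "continuous_on S f" for S unfolding f_def G_def by (intro continuous_intros)
  have fb: "blinfun_apply (f y) (b j) = blinfun_apply P (b j) + t * G j y" if "j < DIM('v)" for y j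
    using that by (simp add: f_def blinfun.bilinear_simps blinfun.sum_left dual_apply[OF b] if_distrib cong: if_cong)
  have fx: "blinfun_apply (f y) x = blinfun_apply P x + t * (\<Sum>k<DIM('v). G k y)" for y
    by (simp add: f_def blinfun.bilinear_simps blinfun.sum_left dual_x)
  have Qb: "blinfun_apply Q (b j) = blinfun_apply P (b j) + t" if "j < DIM('v)" for j
    using that by (simp add: Q_def blinfun.bilinear_simps blinfun.sum_left dual_apply[OF b] if_distrib cong: if_cong)
  have Qx: "blinfun_apply Q x = blinfun_apply P x + t * DIM('v)"
    by (simp add: Q_def blinfun.bilinear_simps blinfun.sum_left dual_x)
  have f_bd: "T \<le> blinfun_apply (f y) x" if y: "y \<in> simplex_bd (DIM('v) - 1)" for y
  proof -
    obtain i where i: "i \<le> (DIM('v) - 1)" "y i = 0" using y by (auto simp: simplex_bd_def)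
    have ys: "(\<Sum>j\<le>(DIM('v) - 1). y j) = 1" "\<And>j. 0 \<le> y j" using y by (auto simp: simplex_bd_def standard_simplex_def)
    have "G i y = (\<Sum>j<DIM('v). y j)" unfolding G_def using i ys(2) by (intro sum.cong) auto
    then have "G i y = 1" using ys(1) by (simp add: sum_lessThan_DIM)
    moreover have "G i y \<le> (\<Sum>k<DIM('v). G k y)" using i G0 by (intro member_le_sum) (auto simp: less_DIM_iff)
    ultimately have "t * 1 \<le> t * (\<Sum>k<DIM('v). G k y)" using t by (intro mult_left_mono) auto
    then show ?thesis unfolding fx using t by linarith
  qed
  have "homologous_rel (DIM('v) - 1) X H (frag_of (restrict g (standard_simplex (DIM('v) - 1)))) (frag_of (restrict f (standard_simplex (DIM('v) - 1))))"
  proof (rule homologous_straight_simplex[OF g contf])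
    fix y :: "nat \<Rightarrow> real" and s :: real
    assume s: "0 \<le> s" "s \<le> 1"
    show "(1 - s) *\<^sub>R g y + s *\<^sub>R f y \<in> H" if "y \<in> simplex_bd (DIM('v) - 1)"
      using g_bd[OF that] f_bd[OF that] s by (intro segment_H) auto
    assume y: "y \<in> standard_simplex (DIM('v) - 1)"
    obtain j where j: "j \<le> (DIM('v) - 1)" "\<And>i. y i \<le> y j" using simplex_argmax[OF y] by blast
    then have jn: "j < DIM('v)" by (simp add: less_DIM_iff)
    have "G j y = 0" unfolding G_def using j(2) by (intro sum.neutral) auto
    then have "blinfun_apply ((1 - s) *\<^sub>R g y + s *\<^sub>R f y) (b j) = blinfun_apply P (b j)"
      using g_face[OF y jn j(2)] fb[OF jn, of y] by (simp add: blinfun.bilinear_simps algebra_simps)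
    then show "(1 - s) *\<^sub>R g y + s *\<^sub>R f y \<in> UNIV - {u}" using off[OF jn] by auto
  qed
  moreover have "homologous_rel (DIM('v) - 1) X H (frag_of (restrict f (standard_simplex (DIM('v) - 1)))) (frag_of (restrict (\<lambda>_. Q) (standard_simplex (DIM('v) - 1))))"
  proof (rule homologous_straight_simplex[OF contf])
    fix y :: "nat \<Rightarrow> real" and s :: real
    assume s: "0 \<le> s" "s \<le> 1"
    have "t * 1 \<le> t * DIM('v)" using t DIM_ge_1 by (intro mult_left_mono) auto
    then have Q: "T \<le> blinfun_apply Q x" unfolding Qx using t by linarith
    show "(1 - s) *\<^sub>R f y + s *\<^sub>R Q \<in> H" if "y \<in> simplex_bd (DIM('v) - 1)"
      using f_bd[OF that] Q s by (intro segment_H) auto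
    have "(1 - s) * blinfun_apply P (b j0) + s * blinfun_apply P (b j0) \<le> (1 - s) * blinfun_apply (f y) (b j0) + s * blinfun_apply Q (b j0)"
      unfolding fb[OF j0(1)] Qb[OF j0(1)] using s t G0[of j0 y] by (intro add_mono mult_left_mono) auto
    then have "blinfun_apply P (b j0) \<le> blinfun_apply ((1 - s) *\<^sub>R f y + s *\<^sub>R Q) (b j0)"
      by (simp add: blinfun.bilinear_simps algebra_simps)
    then show "(1 - s) *\<^sub>R f y + s *\<^sub>R Q \<in> UNIV - {u}" using j0(2) by auto
  qed simp
  moreover have "homologous_rel (DIM('v) - 1) X H (frag_of (restrict (\<lambda>_. Q) (standard_simplex (DIM('v) - 1)))) 0"
  proof (rule simplex_in_H)
    have "t * 1 \<le> t * DIM('v)" using t DIM_ge_1 by (intro mult_left_mono) auto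
    then show "Q \<in> H" unfolding mem_Collect_eq Qx using t by linarith
  qed simp
  ultimately show ?thesis using homologous_rel_trans by blast
qed

text \<open>The vertices other than the first of the dual simplex of the reflected basis take the value \<open>T\<close> at
  \<open>x\<close>, so the opposite face lies in \<open>H\<close>, and the other faces together are a model for \<open>g\<close>.\<close>

definition reflected :: "nat \<Rightarrow> 'v"
  where "reflected k = 2 *\<^sub>R x - b k"

text \<open>The sum of the \<open>reflected k\<close> is (2n - 1)x with n the dimension, so each
  dual functional has the value 1/(2n - 1) at \<open>x\<close>. As \<open>b j\<close> is 2x minus
  \<open>reflected j\<close>, its values at the \<open>b j\<close> are then forced.\<close>

lemma reflected_basis: "ordered_basis reflected"
  and dual_reflected: "k < DIM('v) \<Longrightarrow> dual reflected k = (2 / (2 * real DIM('v) - 1)) *\<^sub>R (\<Sum>k<DIM('v). dual b k) - dual b k"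
proof -
  let ?f = "\<lambda>k. (2 / (2 * real DIM('v) - 1)) *\<^sub>R (\<Sum>k<DIM('v). dual b k) - dual b k"
  have S: "blinfun_apply (\<Sum>k<DIM('v). dual b k) (b j) = 1" if "j < DIM('v)" for j
    using that by (simp add: blinfun.sum_left dual_apply[OF b])
  have Sx: "blinfun_apply (\<Sum>k<DIM('v). dual b k) x = DIM('v)"
    by (simp add: blinfun.sum_left dual_x)
  have *: "blinfun_apply (?f i) (reflected j) = (if j = i then 1 else 0)" if ij: "i < DIM('v)" "j < DIM('v)" for i j
  proof -
    define r where "r = 2 / (2 * real DIM('v) - 1)"
    have "r * (2 * real DIM('v) - 1) = 2" unfolding r_def using two_DIM_pos by (intro nonzero_eq_divide_eq[THEN iffD1] refl) auto
    then have r: "2 * (r * DIM('v)) - r = 2" by (simp add: algebra_simps)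
    define \<delta> where "\<delta> = (if j = i then 1 else 0 :: real)"
    have "blinfun_apply (?f i) (b j) = r - \<delta>"
      using ij by (simp add: r_def[symmetric] \<delta>_def blinfun.diff_left blinfun.scaleR_left S dual_apply[OF b])
    moreover have "blinfun_apply (?f i) x = r * DIM('v) - 1"
      using ij by (simp add: r_def[symmetric] blinfun.diff_left blinfun.scaleR_left Sx dual_x)
    moreover have "blinfun_apply (?f i) (reflected j) = 2 * blinfun_apply (?f i) x - blinfun_apply (?f i) (b j)"
      by (simp only: reflected_def blinfun.diff_right blinfun.scaleR_right real_scaleR_def)
    ultimately have "blinfun_apply (?f i) (reflected j) = \<delta>" using r by linarith
    then show ?thesis unfolding \<delta>_def .
  qed
  show "ordered_basis reflected" by (rule ordered_basis_dual(1)[of ?f, OF *])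
  show "dual reflected k = ?f k" if "k < DIM('v)" by (rule ordered_basis_dual(2)[of ?f, OF * that])
qed

text \<open>The model \<open>f\<close> is the face produced by the horn retraction. It enters
  \<open>homologous_horn\<close> with a minus sign, and the other face there vanishes modulo
  \<open>H\<close>. Where coordinate \<open>j\<close> is largest, \<open>f\<close> and
  \<open>g\<close> are both below \<open>u\<close> at \<open>b j\<close>, so the segments between
  them miss \<open>u\<close>.\<close>

lemma homologous_inside:
  assumes pos: "\<And>j. j < DIM('v) \<Longrightarrow> blinfun_apply P (b j) < blinfun_apply u (b j)"
  shows "homologous_rel (DIM('v) - 1) X H (frag_of (restrict g (standard_simplex (DIM('v) - 1)))) (- aff_bd DIM('v) (dual_simplex u reflected))"
proof -
  let ?l = "dual_simplex u reflected"
  let ?r = "\<lambda>y. horn_retract DIM('v) (simplical_face 0 y)"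
  define f where "f y = aff DIM('v) ?l (?r y)" for y
  have dab: "blinfun_apply (dual reflected k) (b j) = 2 / (2 * real DIM('v) - 1) - (if k = j then 1 else 0)" if "k < DIM('v)" "j < DIM('v)" for k j
    using that by (simp add: dual_reflected blinfun.bilinear_simps blinfun.sum_left dual_apply[OF b])
  have dax: "blinfun_apply (dual reflected k) x = 1 / (2 * real DIM('v) - 1)" if "k < DIM('v)" for k
  proof -
    have "blinfun_apply (dual reflected k) x = (2 / (2 * real DIM('v) - 1)) * DIM('v) - 1"
      using that by (simp add: dual_reflected blinfun.bilinear_simps blinfun.sum_left dual_x)
    also have "\<dots> = 1 / (2 * real DIM('v) - 1)" using two_DIM_pos by (simp add: field_simps)
    finally show ?thesis .
  qed
  have contr: "continuous_on S ?r" for S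
  proof (rule continuous_on_compose2[of UNIV "horn_retract DIM('v)"])
    show "continuous_on UNIV (horn_retract DIM('v))" using continuous_on_horn_retract[of UNIV "DIM('v) - 1"] unfolding Suc_DIM .
    show "continuous_on S (simplical_face 0 :: (nat \<Rightarrow> real) \<Rightarrow> _)"
      unfolding simplical_face_def
    proof (rule continuous_on_coordinatewise_then_product)
      fix i show "continuous_on S (\<lambda>y::nat \<Rightarrow> real. if i < 0 then y i else if i = 0 then 0 else y (i - 1))"
        by (cases "i = 0") (auto intro: continuous_on_eval)
    qed
  qed simp
  have contf: "continuous_on S f" for S
    unfolding f_def by (rule continuous_on_compose2[OF continuous_aff[of UNIV] contr]) simp
  have face: "simplical_face 0 y \<in> standard_simplex DIM('v)" if "y \<in> standard_simplex (DIM('v) - 1)" for y :: "nat \<Rightarrow> real"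
    using simplical_face_in_standard_simplex[of "DIM('v)" 0 y] that DIM_ge_1 by simp
  define m where "m y = (INF k\<in>{1..DIM('v)}. simplical_face 0 y k)" for y :: "nat \<Rightarrow> real"
  have sf: "simplical_face 0 y (Suc k) = y k" "simplical_face 0 y 0 = 0" for y :: "nat \<Rightarrow> real" and k
    by (auto simp: simplical_face_def)
  have mle: "m y \<le> y k" if "k < DIM('v)" for y k
    using INF_interval_le[of "Suc k" "DIM('v) - 1" "simplical_face 0 y"] that unfolding m_def Suc_DIM by (simp add: sf)
  have matt: "\<exists>k<DIM('v). m y = y k" for y
  proof -
    obtain i where "i \<in> {1..DIM('v)}" "m y = simplical_face 0 y i"
      using INF_interval_attained[of "DIM('v) - 1" "simplical_face 0 y"] unfolding m_def Suc_DIM by blast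
    then show ?thesis by (cases i) (auto simp: sf Suc_le_eq)
  qed
  have rS: "?r y (Suc k) = y k - m y" "?r y 0 = DIM('v) * m y" if "k < DIM('v)" for y k
    using that by (auto simp: horn_retract_def sf m_def)
  have f_eq: "f y = u + (\<Sum>k<DIM('v). (y k - m y - DIM('v) * m y) *\<^sub>R dual reflected k)" if y: "y \<in> standard_simplex (DIM('v) - 1)" for y
  proof -
    have "?r y \<in> simplex_horn DIM('v)" using horn_retract_in_horn[of "simplical_face 0 y" "DIM('v) - 1"] face[OF y] unfolding Suc_DIM by blast
    then have "?r y \<in> standard_simplex DIM('v)" using simplex_horn_subset simplex_bd_subset by blast
    from aff_dual_simplex[OF this, of u reflected] show ?thesis unfolding f_def by (simp add: rS)
  qed
  \<comment> \<open>On the boundary the minimum \<open>m y\<close> is 0 and the retraction changes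
    nothing, so \<open>f\<close> has height exactly \<open>T\<close>.\<close>
  have fx_bd: "blinfun_apply (f y) x = T" if y: "y \<in> simplex_bd (DIM('v) - 1)" for y
  proof -
    have ys: "y \<in> standard_simplex (DIM('v) - 1)" using y simplex_bd_subset by blast
    obtain i where i: "i \<le> (DIM('v) - 1)" "y i = 0" using y by (auto simp: simplex_bd_def)
    have "m y \<le> 0" using mle[of i y] i by (simp add: less_DIM_iff)
    moreover obtain k where "k < DIM('v)" "m y = y k" using matt by blast
    ultimately have m0: "m y = 0" using ys by (simp add: standard_simplex_def antisym)
    have "blinfun_apply (f y) x = blinfun_apply u x + (\<Sum>k<DIM('v). y k * (1 / (2 * real DIM('v) - 1)))"
      unfolding f_eq[OF ys] m0 by (simp add: blinfun.bilinear_simps blinfun.sum_left dax)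
    also have "(\<Sum>k<DIM('v). y k * (1 / (2 * real DIM('v) - 1))) = 1 / (2 * real DIM('v) - 1)"
      using ys unfolding sum_distrib_right[symmetric] sum_lessThan_DIM by (simp add: standard_simplex_def)
    finally show ?thesis .
  qed
  have fb: "blinfun_apply (f y) (b j) < blinfun_apply u (b j)"
    if y: "y \<in> standard_simplex (DIM('v) - 1)" and j: "j < DIM('v)" "\<And>i. y i \<le> y j" for y j
  proof -
    let ?m = "m y"
    obtain k0 where k0: "k0 < DIM('v)" "?m = y k0" using matt by blast
    have m0: "0 \<le> ?m" using y k0 by (simp add: standard_simplex_def)
    have sum1: "(\<Sum>k<DIM('v). y k) = 1" using y by (simp add: sum_lessThan_DIM standard_simplex_def)
    \<comment> \<open>The total weight is at most the minimum plus n - 1 times the maximum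
      \<open>y j\<close>; this bound decides the sign below.\<close>
    have "1 = ?m + (\<Sum>k\<in>{..<DIM('v)} - {k0}. y k)" using sum1 k0 by (simp add: sum.remove[of "{..<DIM('v)}" k0])
    also have "\<dots> \<le> ?m + (\<Sum>k\<in>{..<DIM('v)} - {k0}. y j)" using j(2) by (intro add_left_mono sum_mono) auto
    also have "(\<Sum>k\<in>{..<DIM('v)} - {k0}. y j) = (real DIM('v) - 1) * y j" using k0 DIM_ge_1 by (simp add: of_nat_diff)
    finally have le: "1 \<le> ?m + (real DIM('v) - 1) * y j" .
    have "blinfun_apply (f y) (b j) = blinfun_apply u (b j) + (\<Sum>k<DIM('v). (y k - ?m - DIM('v) * ?m) * (2 / (2 * real DIM('v) - 1) - (if k = j then 1 else 0)))"
      unfolding f_eq[OF y] using j by (simp add: blinfun.bilinear_simps blinfun.sum_left dab)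
    also have "(\<Sum>k<DIM('v). (y k - ?m - DIM('v) * ?m) * (2 / (2 * real DIM('v) - 1) - (if k = j then 1 else 0))) =
       (\<Sum>k<DIM('v). (y k - ?m - DIM('v) * ?m) * (2 / (2 * real DIM('v) - 1))) - (\<Sum>k<DIM('v). if k = j then y j - ?m - DIM('v) * ?m else 0)"
      unfolding sum_subtractf[symmetric] by (intro sum.cong) (auto simp: algebra_simps)
    also have "(\<Sum>k<DIM('v). (y k - ?m - DIM('v) * ?m) * (2 / (2 * real DIM('v) - 1))) = (1 - DIM('v) * ?m - DIM('v) * (DIM('v) * ?m)) * (2 / (2 * real DIM('v) - 1))"
      unfolding sum_distrib_right[symmetric] by (simp add: sum_subtractf sum1)
    also have "(\<Sum>k<DIM('v). if k = j then y j - ?m - DIM('v) * ?m else 0) = y j - ?m - DIM('v) * ?m" using j by simp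
    finally have eq: "blinfun_apply (f y) (b j) = blinfun_apply u (b j) +
      ((1 - DIM('v) * ?m - DIM('v) * (DIM('v) * ?m)) * (2 / (2 * real DIM('v) - 1)) - (y j - ?m - DIM('v) * ?m))" .
    have D: "?m \<le> y j" using j mle by blast
    \<comment> \<open>Expanded, with m the minimum, the left side is 2 - (2n - 1) y_j - (n + 1) m,
      and \<open>le\<close> bounds the 2 by 2m + (2n - 2) y_j.\<close>
    have "(1 - DIM('v) * ?m - DIM('v) * (DIM('v) * ?m)) * 2 - (y j - ?m - DIM('v) * ?m) * (2 * real DIM('v) - 1) \<le> - (y j - ?m) - DIM('v) * ?m"
      using le by (simp add: algebra_simps)
    also have "\<dots> < 0"
    proof -
      have "0 \<le> DIM('v) * ?m" using m0 by simp
      moreover have "\<not> (y j = ?m \<and> ?m = 0)" using le by auto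
      moreover have "0 < DIM('v) * ?m" if "?m \<noteq> 0" using m0 that by simp
      ultimately show ?thesis using D by (cases "?m = 0") auto
    qed
    finally have "(1 - DIM('v) * ?m - DIM('v) * (DIM('v) * ?m)) * (2 / (2 * real DIM('v) - 1)) - (y j - ?m - DIM('v) * ?m) < 0"
      by (rule diff_less_zero_scale[OF two_DIM_pos])
    then show ?thesis unfolding eq by linarith
  qed
  have "homologous_rel (DIM('v) - 1) X H (frag_of (restrict g (standard_simplex (DIM('v) - 1)))) (frag_of (restrict f (standard_simplex (DIM('v) - 1))))"
  proof (rule homologous_straight_simplex[OF g contf])
    fix y :: "nat \<Rightarrow> real" and s :: real
    assume s: "0 \<le> s" "s \<le> 1"
    show "(1 - s) *\<^sub>R g y + s *\<^sub>R f y \<in> H" if "y \<in> simplex_bd (DIM('v) - 1)"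
      using g_bd[OF that] fx_bd[OF that] s by (intro segment_H) auto
    assume y: "y \<in> standard_simplex (DIM('v) - 1)"
    obtain j where j: "j \<le> (DIM('v) - 1)" "\<And>i. y i \<le> y j" using simplex_argmax[OF y] by blast
    then have jn: "j < DIM('v)" by (simp add: less_DIM_iff)
    have "blinfun_apply (g y) (b j) < blinfun_apply u (b j)" "blinfun_apply (f y) (b j) < blinfun_apply u (b j)"
      using g_face[OF y jn j(2)] pos[OF jn] fb[OF y jn j(2)] by auto
    then have "(1 - s) * blinfun_apply (g y) (b j) + s * blinfun_apply (f y) (b j) < blinfun_apply u (b j)"
      using s by (intro convex_bound_lt) auto
    then show "(1 - s) *\<^sub>R g y + s *\<^sub>R f y \<in> UNIV - {u}" by (auto simp: blinfun.bilinear_simps)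
  qed
  moreover have "homologous_rel (DIM('v) - 1) X H (frag_of (restrict f (standard_simplex (DIM('v) - 1)))) (- aff_bd DIM('v) ?l)"
  proof -
    have "homologous_rel (DIM('v) - 1) X {} (aff_bd (Suc (DIM('v) - 1)) ?l) (frag_of (affine_simplex (DIM('v) - 1) (?l \<circ> Suc)) -
        frag_of (\<lambda>y\<in>standard_simplex (DIM('v) - 1). aff (Suc (DIM('v) - 1)) ?l (horn_retract (Suc (DIM('v) - 1)) (simplical_face 0 y))))"
    proof (rule homologous_horn)
      fix y assume "y \<in> simplex_horn (Suc (DIM('v) - 1))"
      then have "y \<in> simplex_bd DIM('v)" using simplex_horn_subset unfolding Suc_DIM by blast
      then show "aff (Suc (DIM('v) - 1)) ?l y \<in> UNIV - {u}" using dual_simplex_avoids[OF reflected_basis] unfolding Suc_DIM by blast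
    qed
    then have "homologous_rel (DIM('v) - 1) X {} (aff_bd DIM('v) ?l) (frag_of (affine_simplex (DIM('v) - 1) (?l \<circ> Suc)) - frag_of (restrict f (standard_simplex (DIM('v) - 1))))"
      unfolding Suc_DIM f_def .
    then have 1: "homologous_rel (DIM('v) - 1) X H (aff_bd DIM('v) ?l) (frag_of (affine_simplex (DIM('v) - 1) (?l \<circ> Suc)) - frag_of (restrict f (standard_simplex (DIM('v) - 1))))"
      by (rule homologous_rel_empty_imp)
    have "homologous_rel (DIM('v) - 1) X H (frag_of (affine_simplex (DIM('v) - 1) (?l \<circ> Suc))) 0"
    proof -
      have "affine_simplex (DIM('v) - 1) (?l \<circ> Suc) = restrict (aff (DIM('v) - 1) (?l \<circ> Suc)) (standard_simplex (DIM('v) - 1))"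
        by (auto simp: affine_simplex_def aff_def)
      moreover have "aff (DIM('v) - 1) (?l \<circ> Suc) y \<in> H" if y: "y \<in> standard_simplex (DIM('v) - 1)" for y
      proof -
        have "blinfun_apply (aff (DIM('v) - 1) (?l \<circ> Suc) y) x = (\<Sum>k\<le>(DIM('v) - 1). y k * T)"
          using dax by (simp add: aff_def blinfun.sum_left blinfun.scaleR_left dual_simplex_def blinfun.add_left less_DIM_iff)
        also have "\<dots> = T" using y unfolding sum_distrib_right[symmetric] by (simp add: standard_simplex_def)
        finally show ?thesis by simp
      qed
      ultimately show ?thesis using simplex_in_H[OF continuous_aff] by simp
    qed
    from homologous_rel_diff[OF this homologous_rel_refl[of "DIM('v) - 1" X H "frag_of (restrict f (standard_simplex (DIM('v) - 1)))"]]
    have "homologous_rel (DIM('v) - 1) X H (aff_bd DIM('v) ?l) (- frag_of (restrict f (standard_simplex (DIM('v) - 1))))"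
      using 1 homologous_rel_trans by fastforce
    from homologous_rel_minus[OF this] show ?thesis using homologous_rel_sym by fastforce
  qed
  ultimately show ?thesis using homologous_rel_trans by blast
qed

end

section \<open>The cycle of a multi-polytope\<close>

lemma sum_scaleR_in_cone_hull:
  assumes "finite I" "\<And>i. i \<in> I \<Longrightarrow> 0 \<le> t i"
  shows "(\<Sum>i\<in>I. t i *\<^sub>R g i) \<in> convex_cone hull (g ` I)"
proof -
  have "(\<Sum>i\<in>J. t i *\<^sub>R g i) \<in> convex_cone hull (g ` I)" if "J \<subseteq> I" for J
    using finite_subset[OF that assms(1)] that
  proof (induction rule: finite_induct)
    case (insert j J)
    have "t j *\<^sub>R g j \<in> convex_cone hull (g ` I)"
      by (rule convex_cone_hull_mul[OF hull_inc]) (use insert assms(2) in auto)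
    then show ?case using insert by (auto intro: convex_cone_hull_add)
  qed (simp add: convex_cone_hull_contains_0)
  then show ?thesis by blast
qed

lemma frag_cmul_sum_left: "finite A \<Longrightarrow> frag_cmul (\<Sum>i\<in>A. k i) c = (\<Sum>i\<in>A. frag_cmul (k i) c)"
  by (induction rule: finite_induct) (auto simp: frag_cmul_distrib)

text \<open>The data of a multi-polytope that the topological argument works with: faces
  \<open>K\<close>, weights \<open>w\<close>, and the constants \<open>c i\<close> of the
  hyperplanes. Completeness enters as \<open>balanced\<close>, genericity as the position of
  \<open>x\<close>.\<close>

locale polytope = finite_complex K d
  for K :: "nat set set" and d :: nat +
  fixes v :: "nat \<Rightarrow> 'v::euclidean_space" and w :: "nat set \<Rightarrow> int" and c :: "nat \<Rightarrow> real"
    and F :: "nat set \<Rightarrow> ('v \<Rightarrow>\<^sub>L real) set" and e :: "nat \<Rightarrow> 'v" and x :: 'v and u :: "'v \<Rightarrow>\<^sub>L real"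
  assumes e: "ordered_basis e"
    and inj_v: "\<And>I. I \<in> K \<Longrightarrow> inj_on v I" and independent_v: "\<And>I. I \<in> K \<Longrightarrow> independent (v ` I)"
    and balanced: "\<And>J h. J \<in> K \<Longrightarrow> Suc (card J) = DIM('v) \<Longrightarrow> linear h \<Longrightarrow> (\<And>k. k \<in> J \<Longrightarrow> h (v k) = (0::real)) \<Longrightarrow>
      (\<Sum>i | i \<notin> J \<and> insert i J \<in> K. of_int (w (insert i J)) * sgn (h (v i))) = 0"
    and generic_x: "\<And>I. I \<in> K \<Longrightarrow> card I < DIM('v) \<Longrightarrow> x \<notin> span (v ` I)"
    and F: "\<And>i. i \<in> {1..d} \<Longrightarrow> F {i} = {f. blinfun_apply f (v i) = c i}"
    and u: "\<And>i. i \<in> {1..d} \<Longrightarrow> u \<notin> F {i}"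
begin

definition top_faces :: "nat set set"
  where "top_faces = {I \<in> K. card I = DIM('v)}"

definition face_basis :: "nat set \<Rightarrow> nat \<Rightarrow> 'v"
  where "face_basis I = (\<lambda>k. v (sorted_list_of_set I ! k))"

definition orient :: "nat set \<Rightarrow> int"
  where "orient I = (if positive_basis e (face_basis I) then 1 else -1)"

definition fan_cycle :: "(nat \<Rightarrow> real) chain"
  where "fan_cycle = (\<Sum>I\<in>top_faces. frag_cmul (w I) (oriented_face e v I))"

text \<open>For a member \<open>i\<close> of \<open>I\<close> the number of smaller members, thus
  the exponent of the sign of the face \<open>I - {i}\<close> in the boundary.\<close>

definition position :: "nat set \<Rightarrow> nat \<Rightarrow> nat"
  where "position I = inv_into {..<card I} (\<lambda>k. sorted_list_of_set I ! k)"

lemma fan_cycle_eq: "fan_cycle = (\<Sum>I\<in>top_faces. frag_cmul (w I * orient I) (frag_of (std_simplex I)))"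
  by (simp add: fan_cycle_def oriented_face_def orient_def std_simplex_def face_basis_def)

lemma finite_top: "finite top_faces"
  unfolding top_faces_def using finite_K by simp

lemma face_vertex: "I \<in> K \<Longrightarrow> i \<in> I \<Longrightarrow> i \<in> {1..d}"
  using sub by blast

lemma top_face:
  assumes "I \<in> top_faces"
  shows "I \<in> K" "finite I" "card I = DIM('v)" "card I = Suc (DIM('v) - 1)"
    "bij_betw (\<lambda>k. sorted_list_of_set I ! k) {..<DIM('v)} I" "span (v ` I) = UNIV"
proof -
  show I: "I \<in> K" "card I = DIM('v)" using assms by (auto simp: top_faces_def)
  show fin: "finite I" using I(1) by (rule finite_face)
  show "card I = Suc (DIM('v) - 1)" using I(2) Suc_DIM[where 'v='v] by simp
  show "bij_betw (\<lambda>k. sorted_list_of_set I ! k) {..<DIM('v)} I" using bij_betw_sorted_list[OF fin] I(2) by simp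
  have "UNIV \<subseteq> span (v ` I)"
    by (rule card_ge_dim_independent) (use I inj_v independent_v in \<open>auto simp: card_image dim_UNIV\<close>)
  then show "span (v ` I) = UNIV" by blast
qed

lemma face_basis_image:
  assumes "I \<in> top_faces"
  shows "face_basis I ` {..<DIM('v)} = v ` I"
proof -
  have "(\<lambda>k. sorted_list_of_set I ! k) ` {..<DIM('v)} = I" using top_face(5)[OF assms] by (simp add: bij_betw_def)
  then show ?thesis unfolding face_basis_def by (simp only: image_image[symmetric, of v "\<lambda>k. sorted_list_of_set I ! k"])
qed

lemma ordered_face_basis:
  assumes "I \<in> top_faces"
  shows "ordered_basis (face_basis I)"
proof -
  note I = top_face[OF assms]
  have "inj_on (v \<circ> (\<lambda>k. sorted_list_of_set I ! k)) {..<DIM('v)}"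
    using I(5) inj_v[OF I(1)] unfolding bij_betw_def by (intro comp_inj_on) auto
  then have "inj_on (face_basis I) {..<DIM('v)}" by (simp add: face_basis_def o_def)
  then show ?thesis unfolding ordered_basis_def face_basis_image[OF assms] using I(6) independent_v[OF I(1)] by blast
qed

lemma orient_sgn: "I \<in> top_faces \<Longrightarrow> of_int (orient I) = sgn (det_wrt e (face_basis I))"
  using homologous_dual_simplex(1)[OF e ordered_face_basis] by (auto simp: orient_def positive_basis_def sgn_if)

text \<open>The determinant with \<open>z\<close> put in front of the basis vectors of
  \<open>J\<close> is a linear form vanishing on these. Moving \<open>v i\<close> to its place in
  the sorted order costs the incidence sign, so the coefficient of \<open>J\<close> in the boundary
  of an oriented face records on which side of its hyperplane \<open>v i\<close> lies.\<close>

lemma orient_position: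
  assumes J: "J \<in> K" "Suc (card J) = DIM('v)"
  obtains h where "linear h" "\<And>k. k \<in> J \<Longrightarrow> h (v k) = (0::real)"
    "\<And>i. i \<notin> J \<Longrightarrow> insert i J \<in> K \<Longrightarrow> of_int (orient (insert i J) * (-1) ^ position (insert i J) i) = sgn (h (v i))"
proof -
  have finJ: "finite J" using J(1) by (rule finite_face)
  define h where "h z = det_wrt e (\<lambda>k. if k = 0 then z else face_basis J (k - 1))" for z
  have n0: "0 < DIM('v)" by simp
  have h_upd: "h z = det_wrt e ((\<lambda>k. face_basis J (k - 1))(0 := z))" for z
    unfolding h_def by (rule det_wrt_cong) auto
  have lin: "linear h"
    using linear_det_wrt_upd[OF e n0, of "\<lambda>k. face_basis J (k - 1)"] unfolding h_upd[abs_def] .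
  have zero: "h (v k) = 0" if k: "k \<in> J" for k
  proof -
    obtain m where m: "m < card J" "k = sorted_list_of_set J ! m"
      using k bij_betw_sorted_list[OF finJ] unfolding bij_betw_def by auto
    show ?thesis unfolding h_def
      by (rule det_wrt_eq_rows[OF e n0, of "Suc m"]) (use m J(2) in \<open>auto simp: face_basis_def\<close>)
  qed
  have pos: "of_int (orient (insert i J) * (-1) ^ position (insert i J) i) = sgn (h (v i))"
    if i: "i \<notin> J" "insert i J \<in> K" for i
  proof -
    let ?I = "insert i J"
    have I: "?I \<in> top_faces" using i J finJ by (simp add: top_faces_def)
    note I' = top_face[OF I]
    have bij: "bij_betw (\<lambda>k. sorted_list_of_set ?I ! k) {..<card ?I} ?I" using bij_betw_sorted_list[OF I'(2)] .
    define p where "p = position ?I i"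
    have p: "p < DIM('v)" "sorted_list_of_set ?I ! p = i"
      using inv_into_into[of i "\<lambda>k. sorted_list_of_set ?I ! k" "{..<card ?I}"] f_inv_into_f[of i "\<lambda>k. sorted_list_of_set ?I ! k" "{..<card ?I}"]
        bij I'(3) unfolding p_def position_def bij_betw_def by auto
    have rem: "sorted_list_of_set J ! j = (if j < p then sorted_list_of_set ?I ! j else sorted_list_of_set ?I ! Suc j)"
      if "j < DIM('v) - 1" for j
      using sorted_list_remove_nth[OF I'(2), of p j] p that i(1) I'(3) by simp
    have "face_basis ?I k = (if k < p then face_basis J k else if k = p then v i else face_basis J (k - 1))" if "k < DIM('v)" for k
    proof (cases k p rule: linorder_cases)
      case less
      then show ?thesis using rem[of k] p(1) by (simp add: face_basis_def)
    next
      case equal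
      then show ?thesis using p(2) by (simp add: face_basis_def)
    next
      case greater
      then have "sorted_list_of_set J ! (k - 1) = sorted_list_of_set ?I ! k"
      proof -
        have "k - 1 < DIM('v) - 1" "\<not> k - 1 < p" "Suc (k - 1) = k" using greater that by linarith+
        then show ?thesis using rem[of "k - 1"] by (simp only: if_False)
      qed
      then show ?thesis using greater by (simp add: face_basis_def)
    qed
    then have "det_wrt e (face_basis ?I) = det_wrt e (\<lambda>k. if k < p then face_basis J k else if k = p then v i else face_basis J (k - 1))"
      by (rule det_wrt_cong)
    also have "\<dots> = (-1) ^ p * h (v i)" unfolding h_def by (rule det_wrt_insert[OF e p(1)])
    finally have "of_int (orient ?I) = sgn ((-1) ^ p * h (v i))" using orient_sgn[OF I] by simp
    then show ?thesis unfolding p_def[symmetric] by (cases "even p") (simp_all add: sgn_minus)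
  qed
  from lin zero pos show ?thesis by (rule that)
qed

lemma balanced_orient:
  assumes J: "J \<in> K" "Suc (card J) = DIM('v)"
  shows "(\<Sum>i | i \<notin> J \<and> insert i J \<in> K. w (insert i J) * (orient (insert i J) * (-1) ^ position (insert i J) i)) = 0"
proof -
  obtain h where h: "linear h" "\<And>k. k \<in> J \<Longrightarrow> h (v k) = (0::real)"
    "\<And>i. i \<notin> J \<Longrightarrow> insert i J \<in> K \<Longrightarrow> of_int (orient (insert i J) * (-1) ^ position (insert i J) i) = sgn (h (v i))"
    using orient_position[OF J] by blast
  have "real_of_int (\<Sum>i | i \<notin> J \<and> insert i J \<in> K. w (insert i J) * (orient (insert i J) * (-1) ^ position (insert i J) i)) =
    (\<Sum>i | i \<notin> J \<and> insert i J \<in> K. of_int (w (insert i J)) * sgn (h (v i)))"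
    unfolding of_int_sum
  proof (rule sum.cong[OF refl])
    fix i assume "i \<in> {i. i \<notin> J \<and> insert i J \<in> K}"
    then have hi: "of_int (orient (insert i J) * (-1) ^ position (insert i J) i) = sgn (h (v i))" using h(3) by blast
    show "real_of_int (w (insert i J) * (orient (insert i J) * (-1) ^ position (insert i J) i)) =
      of_int (w (insert i J)) * sgn (h (v i))"
      by (simp only: of_int_mult[of "w (insert i J)"] hi)
  qed
  also have "\<dots> = 0" by (rule balanced[OF J h(1,2)])
  finally show ?thesis by (simp only: of_int_eq_0_iff)
qed

text \<open>Incidences are counted from the codimension one faces, where the balancing condition
  applies.\<close>

lemma sum_top_faces:
  fixes f :: "nat set \<Rightarrow> nat \<Rightarrow> 'z::comm_monoid_add"
  shows "(\<Sum>I\<in>top_faces. \<Sum>i\<in>I. f I i) =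
    (\<Sum>J | J \<in> K \<and> Suc (card J) = DIM('v). \<Sum>i | i \<notin> J \<and> insert i J \<in> K. f (insert i J) i)"
proof -
  have finE: "finite {i. i \<notin> J \<and> insert i J \<in> K}" for J
    by (rule finite_subset[of _ "{1..d}"]) (use sub in auto)
  have "(\<Sum>I\<in>top_faces. \<Sum>i\<in>I. f I i) = (\<Sum>(I, i)\<in>(SIGMA I:top_faces. I). f I i)"
    using finite_top top_face(2) by (intro sum.Sigma) auto
  also have "\<dots> = (\<Sum>(J, i)\<in>(SIGMA J:{J \<in> K. Suc (card J) = DIM('v)}. {i. i \<notin> J \<and> insert i J \<in> K}). f (insert i J) i)"
  proof (rule sum.reindex_bij_witness[where i = "\<lambda>(J, i). (insert i J, i)" and j = "\<lambda>(I, i). (I - {i}, i)"], goal_cases)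
    case (2 a)
    then obtain I i where a: "a = (I, i)" "I \<in> top_faces" "i \<in> I" by auto
    have "I - {i} \<in> K" "insert i (I - {i}) = I" using down top_face(1)[OF a(2)] a(3) by auto
    moreover have "Suc (card (I - {i})) = DIM('v)" using card_Suc_Diff1[OF top_face(2)[OF a(2)] a(3)] top_face(3)[OF a(2)] by (rule trans)
    ultimately show ?case using a top_face(1)[OF a(2)] by auto
  next
    case (4 a)
    then obtain J i where a: "a = (J, i)" "J \<in> K" "Suc (card J) = DIM('v)" "i \<notin> J" "insert i J \<in> K" by auto
    then show ?case using finite_face[OF a(2)] by (auto simp: top_faces_def)
  qed (auto simp: insert_absorb)
  also have "\<dots> = (\<Sum>J | J \<in> K \<and> Suc (card J) = DIM('v). \<Sum>i | i \<notin> J \<and> insert i J \<in> K. f (insert i J) i)"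
    using finite_K finE by (intro sum.Sigma[symmetric]) auto
  finally show ?thesis .
qed

text \<open>In dimension one the only codimension one face is the empty set and all positions are 0,
  so balancing at \<open>{}\<close> is the vanishing of the augmentation.\<close>

lemma chain_sum_fan_cycle:
  assumes "DIM('v) = 1"
  shows "chain_sum fan_cycle = 0"
proof -
  have pos: "orient I * (-1) ^ position I i = orient I" if "I \<in> top_faces" "i \<in> I" for I i
  proof -
    have "position I i \<in> {..<card I}" unfolding position_def
      by (rule inv_into_into) (use top_face[OF that(1)] that(2) in \<open>auto simp: bij_betw_def\<close>)
    then have "position I i = 0" using top_face(3)[OF that(1)] assms by simp
    then show ?thesis by simp
  qed
  have "(\<Sum>I\<in>top_faces. w I * orient I) = (\<Sum>I\<in>top_faces. \<Sum>i\<in>I. w I * (orient I * (-1) ^ position I i))"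
  proof (rule sum.cong[OF refl])
    fix I assume I: "I \<in> top_faces"
    obtain i where "I = {i}" using top_face(3)[OF I] assms by (metis card_1_singletonE)
    then show "w I * orient I = (\<Sum>i\<in>I. w I * (orient I * (-1) ^ position I i))"
      using pos[OF I, of i] by simp
  qed
  also have "\<dots> = 0" unfolding sum_top_faces using balanced_orient by (intro sum.neutral) auto
  finally show ?thesis
    unfolding fan_cycle_eq by (simp add: chain_sum_sum[OF finite_top] flip: frag_cmul_sum_left[OF finite_top])
qed

text \<open>In the boundary each codimension one face carries the coefficient that
  \<open>balanced_orient\<close> annihilates. In dimension one all 0-chains are cycles.\<close>

lemma fan_cycle_cycle: "singular_relcycle (DIM('v) - 1) (realization K) {} fan_cycle"
proof -
  have chain: "singular_chain (DIM('v) - 1) (realization K) fan_cycle"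
    unfolding fan_cycle_eq
    by (intro singular_chain_sum singular_chain_cmul)
       (use singular_simplex_std_simplex top_face in \<open>auto simp: singular_chain_of\<close>)
  have "chain_boundary (DIM('v) - 1) fan_cycle = 0"
  proof (cases "DIM('v) - 1")
    case 0
    then show ?thesis by (simp add: chain_boundary_def)
  next
    case (Suc q)
    let ?G = "\<lambda>J. frag_of (std_simplex J)"
    have face: "chain_boundary (Suc q) (?G I) = (\<Sum>i\<in>I. frag_cmul ((-1) ^ position I i) (?G (I - {i})))"
      if I: "I \<in> top_faces" for I
    proof -
      have card: "card I = Suc (Suc q)" using top_face(4)[OF I] Suc by simp
      have inj: "inj_on (\<lambda>k. sorted_list_of_set I ! k) {..<card I}"
        using bij_betw_sorted_list[OF top_face(2)[OF I]] by (simp add: bij_betw_def)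
      have "chain_boundary (Suc q) (?G I) = (\<Sum>k\<le>Suc q. frag_cmul ((-1) ^ k) (frag_of (singular_face (Suc q) k (std_simplex I))))"
        by (simp add: chain_boundary_of del: sum.atMost_Suc)
      also have "\<dots> = (\<Sum>k<card I. (\<lambda>i. frag_cmul ((-1) ^ position I i) (?G (I - {i}))) (sorted_list_of_set I ! k))"
        unfolding card lessThan_Suc_atMost
      proof (rule sum.cong[OF refl])
        fix k assume k: "k \<in> {..Suc q}"
        then have "position I (sorted_list_of_set I ! k) = k"
          unfolding position_def by (intro inv_into_f_f[OF inj]) (auto simp: card)
        then show "frag_cmul ((-1) ^ k) (frag_of (singular_face (Suc q) k (std_simplex I))) =
          frag_cmul ((-1) ^ position I (sorted_list_of_set I ! k)) (?G (I - {sorted_list_of_set I ! k}))"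
          using singular_face_std_simplex[OF top_face(2)[OF I] card, of k] k by simp
      qed
      also have "\<dots> = (\<Sum>i\<in>I. frag_cmul ((-1) ^ position I i) (?G (I - {i})))"
        by (rule sum.reindex_bij_betw[OF bij_betw_sorted_list[OF top_face(2)[OF I]]])
      finally show ?thesis .
    qed
    have finE: "finite {i. i \<notin> J \<and> insert i J \<in> K}" for J
      by (rule finite_subset[of _ "{1..d}"]) (use sub in auto)
    have "chain_boundary (Suc q) fan_cycle =
      (\<Sum>I\<in>top_faces. \<Sum>i\<in>I. frag_cmul (w I * (orient I * (-1) ^ position I i)) (?G (I - {i})))"
      unfolding fan_cycle_eq chain_boundary_sum o_def chain_boundary_cmul
    proof (rule sum.cong[OF refl])
      fix I assume I: "I \<in> top_faces"
      show "frag_cmul (w I * orient I) (chain_boundary (Suc q) (?G I)) =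
        (\<Sum>i\<in>I. frag_cmul (w I * (orient I * (-1) ^ position I i)) (?G (I - {i})))"
        unfolding face[OF I] frag_cmul_sum by (simp add: mult.assoc)
    qed
    also have "\<dots> = (\<Sum>J | J \<in> K \<and> Suc (card J) = DIM('v). \<Sum>i | i \<notin> J \<and> insert i J \<in> K.
        frag_cmul (w (insert i J) * (orient (insert i J) * (-1) ^ position (insert i J) i)) (?G (insert i J - {i})))"
      by (rule sum_top_faces)
    also have "\<dots> = 0"
    proof (rule sum.neutral, rule ballI)
      fix J assume J: "J \<in> {J. J \<in> K \<and> Suc (card J) = DIM('v)}"
      have "(\<Sum>i | i \<notin> J \<and> insert i J \<in> K.
        frag_cmul (w (insert i J) * (orient (insert i J) * (-1) ^ position (insert i J) i)) (?G (insert i J - {i}))) =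
        (\<Sum>i | i \<notin> J \<and> insert i J \<in> K.
        frag_cmul (w (insert i J) * (orient (insert i J) * (-1) ^ position (insert i J) i)) (?G J))"
        by (intro sum.cong refl) (simp add: insert_Diff_if)
      also have "\<dots> = 0" using J balanced_orient[of J] by (simp flip: frag_cmul_sum_left[OF finE])
      finally show "(\<Sum>i | i \<notin> J \<and> insert i J \<in> K.
        frag_cmul (w (insert i J) * (orient (insert i J) * (-1) ^ position (insert i J) i)) (?G (insert i J - {i}))) = 0" .
    qed
    finally show ?thesis using Suc by simp
  qed
  with chain show ?thesis by (simp add: singular_cycle)
qed

end

section \<open>The image of the cycle\<close>

lemma aff_bd_cycle:
  fixes e :: "nat \<Rightarrow> 'v::euclidean_space"
  assumes e: "ordered_basis e"
  shows "singular_relcycle (DIM('v) - 1) (top_of_set (UNIV - {u})) {} (aff_bd DIM('v) (dual_simplex u e))"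
proof -
  have "aff (Suc (DIM('v) - 1)) (dual_simplex u e) y \<in> UNIV - {u}" if "y \<in> simplex_bd (Suc (DIM('v) - 1))" for y
    using that dual_simplex_avoids[OF e] unfolding Suc_DIM by blast
  from singular_cycle_aff_bd[OF this] show ?thesis unfolding Suc_DIM .
qed

lemma chain_sum_aff_bd_DIM:
  fixes e :: "nat \<Rightarrow> 'v::euclidean_space"
  shows "DIM('v) - 1 = 0 \<Longrightarrow> chain_sum (aff_bd DIM('v) (dual_simplex u e)) = 0"
  using chain_sum_aff_bd[of "DIM('v) - 1" "dual_simplex u e"] unfolding Suc_DIM by simp

context polytope
begin

lemma u_ne: "i \<in> {1..d} \<Longrightarrow> blinfun_apply u (v i) \<noteq> c i"
  using u F by blast

text \<open>By genericity \<open>x\<close> is independent of the \<open>v i\<close>, so the value at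
  \<open>x\<close> can be prescribed together with the hyperplane conditions.\<close>

lemma height_point:
  assumes I: "I \<in> K" "card I < DIM('v)"
  obtains f where "\<And>i. i \<in> I \<Longrightarrow> blinfun_apply f (v i) = c i" "blinfun_apply f x = t"
proof -
  have xI: "x \<notin> v ` I" using generic_x[OF I] span_base[of x "v ` I"] by auto
  have "independent (insert x (v ` I))"
    using independent_v[OF I(1)] generic_x[OF I] by (simp add: independent_insert)
  then obtain h where h: "linear h" "\<forall>y\<in>insert x (v ` I). h y = (if y = x then t else c (inv_into I v y))"
    using linear_independent_extend[of "insert x (v ` I)" "\<lambda>y. if y = x then t else c (inv_into I v y)"] by blast
  have app: "blinfun_apply (Blinfun h) z = h z" for z
    using h(1) by (simp add: bounded_linear_Blinfun_apply linear_conv_bounded_linear)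
  have "h (v i) = c i" if i: "i \<in> I" for i
    using h(2) i xI inv_into_f_f[OF inj_v[OF I(1)] i] by auto
  moreover have "h x = t" using h(2) by simp
  ultimately show ?thesis using that[of "Blinfun h"] app by simp
qed

text \<open>For a maximal face this is the point \<open>apex F I\<close>; for a smaller face it is
  an arbitrary point of \<open>F_int F I\<close>.\<close>

definition vertex_at :: "nat set \<Rightarrow> 'v \<Rightarrow>\<^sub>L real"
  where "vertex_at I = (SOME f. \<forall>i\<in>I. blinfun_apply f (v i) = c i)"

lemma vertex_at: "I \<in> K \<Longrightarrow> i \<in> I \<Longrightarrow> blinfun_apply (vertex_at I) (v i) = c i"
proof -
  assume I: "I \<in> K" "i \<in> I"
  obtain f :: "'v \<Rightarrow>\<^sub>L real" where "\<And>j. j \<in> I \<Longrightarrow> blinfun_apply f (v j) = c j"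
    using blinfun_interpolation[OF inj_v[OF I(1)] independent_v[OF I(1)]] by blast
  then have "\<exists>f :: 'v \<Rightarrow>\<^sub>L real. \<forall>i\<in>I. blinfun_apply f (v i) = c i" by blast
  from someI_ex[OF this] show ?thesis using I(2) unfolding vertex_at_def by blast
qed

text \<open>The offset is the value at \<open>x\<close> of the functionals dual to the reflected
  basis in \<open>corner\<close>, so the cell map and its model share one hyperplane.\<close>

definition height :: real
  where "height = blinfun_apply u x + 1 / (2 * real DIM('v) - 1)"

text \<open>All cell centres except the vertices of the arrangement are placed in the hyperplane
  \<open>f x = height\<close>, so the boundary of each maximal simplex is mapped there.\<close>

definition centre :: "nat set \<Rightarrow> 'v \<Rightarrow>\<^sub>L real"
  where "centre I = (SOME f. (\<forall>i\<in>I. blinfun_apply f (v i) = c i) \<and> (card I < DIM('v) \<longrightarrow> blinfun_apply f x = height))"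

lemma centre:
  assumes I: "I \<in> K"
  shows "i \<in> I \<Longrightarrow> blinfun_apply (centre I) (v i) = c i" "card I < DIM('v) \<Longrightarrow> blinfun_apply (centre I) x = height"
proof -
  have "\<exists>f. (\<forall>i\<in>I. blinfun_apply f (v i) = c i) \<and> (card I < DIM('v) \<longrightarrow> blinfun_apply f x = height)"
  proof (cases "card I < DIM('v)")
    case True
    then show ?thesis using height_point[OF I True, of height] by metis
  next
    case False
    then show ?thesis using vertex_at[OF I] by blast
  qed
  note * = someI_ex[OF this, folded centre_def]
  show "i \<in> I \<Longrightarrow> blinfun_apply (centre I) (v i) = c i" using conjunct1[OF *] by (rule bspec)
  show "card I < DIM('v) \<Longrightarrow> blinfun_apply (centre I) x = height" using conjunct2[OF *] by (rule mp)
qed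

lemma cell_map_face:
  assumes y: "y \<in> points" and i: "\<And>j. y j \<le> y i"
  shows "blinfun_apply (cell_map centre y) (v i) = c i"
proof (rule cell_map_const[OF y])
  fix X assume X: "X \<in> K - {{}}" "bump X y \<noteq> 0"
  then show "blinfun_apply (centre X) (v i) = c i"
    using centre(1) bump_support(2)[OF y X i] by blast
qed

lemma stratified_cell_map:
  fixes \<Delta> :: "(nat set, 'v) multi_fan"
  assumes "faces \<Delta> = K"
  shows "stratified_map d \<Delta> F (cell_map centre)"
  unfolding stratified_map_def assms
proof (intro conjI ballI impI)
  have "cell_map centre y \<in> (\<Union>i\<in>{1..d}. F {i})" if y: "y \<in> points" for y
  proof -
    obtain i where i: "i \<in> {1..d}" "\<And>j. y j \<le> y i" using points_max[OF y] by blast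
    then show ?thesis using cell_map_face[OF y i(2)] F by blast
  qed
  then show "continuous_map (realization K) (top_of_set (\<Union>i\<in>{1..d}. F {i})) (cell_map centre)"
    unfolding realization_points continuous_map_simplex_iff using continuous_cell_map by auto
  fix I assume I: "I \<in> K" "I \<noteq> {}"
  show "cell_map centre ` sd_dual K I \<subseteq> F_int F I"
  proof (rule image_subsetI)
    fix y assume "y \<in> sd_dual K I"
    then have y: "y \<in> sd_star K i" if "i \<in> I" for i using that by (auto simp: sd_dual_def)
    have "cell_map centre y \<in> F {i}" if i: "i \<in> I" for i
      using cell_map_face[of y i] sd_star_subset[of i] y[OF i] sd_star_max[OF y[OF i]] F[OF face_vertex[OF I(1) i]] by auto
    then show "cell_map centre y \<in> F_int F I" by (simp add: F_int_def)
  qed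
qed

text \<open>A point whose largest coordinate is at \<open>i\<close> lies in the star of
  \<open>i\<close>, where both maps take values in the convex set \<open>F {i}\<close>, which does
  not contain \<open>u\<close>.\<close>

lemma stratified_homologous:
  fixes \<Delta> :: "(nat set, 'v) multi_fan"
  assumes \<Delta>: "faces \<Delta> = K" and \<Psi>: "stratified_map d \<Delta> F \<Psi>"
  shows "continuous_map (realization K) (top_of_set (UNIV - {u})) \<Psi>"
    and "homologous_rel (DIM('v) - 1) (top_of_set (UNIV - {u})) {} (chain_map (DIM('v) - 1) \<Psi> fan_cycle)
      (chain_map (DIM('v) - 1) (cell_map centre) fan_cycle)"
proof -
  have cont: "continuous_map (realization K) (top_of_set (\<Union>i\<in>{1..d}. F {i})) \<Psi>"
    using \<Psi> \<Delta> by (simp add: stratified_map_def)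
  have pt: "\<exists>i\<in>{1..d}. blinfun_apply (\<Psi> y) (v i) = c i \<and> blinfun_apply (cell_map centre y) (v i) = c i" if y: "y \<in> points" for y
  proof -
    obtain i where i: "i \<in> {1..d}" "{i} \<in> K" "\<And>j. y j \<le> y i" using points_max[OF y] by blast
    have "y \<in> sd_dual K {i}" using sd_starI[OF y i(3)] by (simp add: sd_dual_def)
    then have "\<Psi> y \<in> F_int F {i}" using \<Psi> i(2) \<Delta> unfolding stratified_map_def by blast
    then show ?thesis using F[OF i(1)] i(1) cell_map_face[OF y i(3)] by (auto simp: F_int_def)
  qed
  have cf: "continuous_map (realization K) euclidean \<Psi>"
    using cont by (rule continuous_map_into_fulltopology)
  have cg: "continuous_map (realization K) euclidean (cell_map centre)"
    using stratified_cell_map[OF \<Delta>] \<Delta> unfolding stratified_map_def by (metis continuous_map_into_fulltopology)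
  have top: "topspace (realization K) = points" by (simp add: realization_points)
  show "continuous_map (realization K) (top_of_set (UNIV - {u})) \<Psi>"
    using cf pt u_ne by (force simp: continuous_map_in_subtopology top)
  show "homologous_rel (DIM('v) - 1) (top_of_set (UNIV - {u})) {} (chain_map (DIM('v) - 1) \<Psi> fan_cycle)
      (chain_map (DIM('v) - 1) (cell_map centre) fan_cycle)"
  proof (rule homologous_straight[OF fan_cycle_cycle cf cg])
    fix y and s :: real assume y: "y \<in> topspace (realization K)" and s: "0 \<le> s" "s \<le> 1"
    then obtain i where i: "i \<in> {1..d}" "blinfun_apply (\<Psi> y) (v i) = c i" "blinfun_apply (cell_map centre y) (v i) = c i"
      using pt top by blast
    have "blinfun_apply ((1 - s) *\<^sub>R \<Psi> y + s *\<^sub>R cell_map centre y) (v i) = c i"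
      by (simp add: blinfun.bilinear_simps i(2,3) algebra_simps)
    then show "(1 - s) *\<^sub>R \<Psi> y + s *\<^sub>R cell_map centre y \<in> UNIV - {u}" using u_ne[OF i(1)] by auto
  qed simp
qed

definition coord :: "nat set \<Rightarrow> nat \<Rightarrow> real"
  where "coord I k = blinfun_apply (dual (face_basis I) k) x"

text \<open>The coordinates of \<open>x\<close> as factors make the sum equal to \<open>x\<close>;
  their signs turn the functionals \<open>dual_vec_plus\<close> into positive multiples of the dual
  basis.\<close>

definition scaled_basis :: "nat set \<Rightarrow> nat \<Rightarrow> 'v"
  where "scaled_basis I k = coord I k *\<^sub>R face_basis I k"

text \<open>A zero coordinate would put \<open>x\<close> into the span of a codimension one
  face.\<close>

lemma coord_nonzero:
  assumes I: "I \<in> top_faces" and k: "k < DIM('v)"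
  shows "coord I k \<noteq> 0"
proof
  assume 0: "coord I k = 0"
  let ?i = "sorted_list_of_set I ! k"
  have bij: "bij_betw (\<lambda>k. sorted_list_of_set I ! k) {..<DIM('v)} I" by (rule top_face(5)[OF I])
  have i: "?i \<in> I" using bij k by (auto simp: bij_betw_def)
  have J: "I - {?i} \<in> K" "card (I - {?i}) < DIM('v)"
    using down[OF top_face(1)[OF I]] card_Suc_Diff1[OF top_face(2)[OF I] i] top_face(3)[OF I] by auto
  have "x = (\<Sum>j<DIM('v). coord I j *\<^sub>R face_basis I j)" unfolding coord_def by (rule basis_expand[OF ordered_face_basis[OF I]])
  also have "\<dots> \<in> span (v ` (I - {?i}))"
  proof (rule span_sum)
    fix j assume j: "j \<in> {..<DIM('v)}"
    show "coord I j *\<^sub>R face_basis I j \<in> span (v ` (I - {?i}))"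
    proof (cases "j = k")
      case True
      then show ?thesis using 0 by (simp add: span_zero)
    next
      case False
      then have "sorted_list_of_set I ! j \<in> I - {?i}"
        using bij j k unfolding bij_betw_def inj_on_def by auto
      then show ?thesis unfolding face_basis_def by (intro span_scale span_base) auto
    qed
  qed
  finally show False using generic_x[OF J] by blast
qed

lemma ordered_scaled_basis:
  assumes I: "I \<in> top_faces"
  shows "ordered_basis (scaled_basis I)"
proof (rule ordered_basis_dual(1)[of "\<lambda>k. (1 / coord I k) *\<^sub>R dual (face_basis I) k"])
  fix i j assume "i < DIM('v)" "j < DIM('v)"
  then show "blinfun_apply ((1 / coord I i) *\<^sub>R dual (face_basis I) i) (scaled_basis I j) = (if j = i then 1 else 0)"
    using coord_nonzero[OF I] by (simp add: scaled_basis_def blinfun.bilinear_simps dual_apply[OF ordered_face_basis[OF I]])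
qed

lemma corner_face:
  assumes I: "I \<in> top_faces"
  shows "corner (scaled_basis I) x u (vertex_at I) (cell_map centre \<circ> std_simplex I)"
proof
  let ?p = "DIM('v) - 1"
  note I' = top_face[OF I]
  show "ordered_basis (scaled_basis I)" by (rule ordered_scaled_basis[OF I])
  show "x = (\<Sum>k<DIM('v). scaled_basis I k)" unfolding scaled_basis_def coord_def by (rule basis_expand[OF ordered_face_basis[OF I]])
  have "continuous_on (standard_simplex ?p) (std_simplex I)"
    using singular_simplex_std_simplex[OF I'(1,4)]
    by (simp add: singular_simplex_def realization_points euclidean_product_topology continuous_map_in_subtopology)
  then show "continuous_on (standard_simplex ?p) (cell_map centre \<circ> std_simplex I)"
    by (rule continuous_on_compose[OF _ continuous_on_subset[OF continuous_cell_map]])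
       (use std_simplex_points[OF I'(1,4)] in auto)
  have scaled_vertex: "blinfun_apply (vertex_at I) (scaled_basis I j) = coord I j * c (sorted_list_of_set I ! j)"
    and s_I: "sorted_list_of_set I ! j \<in> I" if "j < DIM('v)" for j
  proof -
    show i: "sorted_list_of_set I ! j \<in> I" using I'(5) that by (auto simp: bij_betw_def)
    show "blinfun_apply (vertex_at I) (scaled_basis I j) = coord I j * c (sorted_list_of_set I ! j)"
      using vertex_at[OF I'(1) i] by (simp add: scaled_basis_def face_basis_def blinfun.scaleR_right)
  qed
  show "blinfun_apply ((cell_map centre \<circ> std_simplex I) y) (scaled_basis I j) = blinfun_apply (vertex_at I) (scaled_basis I j)"
    if y: "y \<in> standard_simplex ?p" and j: "j < DIM('v)" "\<And>i. y i \<le> y j" for y j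
  proof -
    let ?i = "sorted_list_of_set I ! j"
    have yi: "std_simplex I y ?i = y j" using std_simplex_apply[OF I'(2,4) y, of j] j(1) by simp
    have "std_simplex I y k \<le> std_simplex I y ?i" for k
    proof (cases "k \<in> I")
      case True
      then obtain m where "m < DIM('v)" "k = sorted_list_of_set I ! m" using I'(5) by (auto simp: bij_betw_def)
      then show ?thesis using std_simplex_apply[OF I'(2,4) y, of m] yi j(2) by simp
    next
      case False
      then show ?thesis using std_simplex_off[OF I'(2,4) y False] yi y by (simp add: standard_simplex_def)
    qed
    from cell_map_face[OF std_simplex_points[OF I'(1,4) y] this]
    show ?thesis unfolding scaled_vertex[OF j(1)] by (simp add: scaled_basis_def face_basis_def blinfun.scaleR_right)
  qed
  show "blinfun_apply ((cell_map centre \<circ> std_simplex I) y) x = blinfun_apply u x + 1 / (2 * real DIM('v) - 1)"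
    if yb: "y \<in> simplex_bd ?p" for y
  proof -
    have y: "y \<in> standard_simplex ?p" using yb simplex_bd_subset by blast
    obtain k where k: "k \<le> ?p" "y k = 0" using yb by (auto simp: simplex_bd_def)
    let ?i = "sorted_list_of_set I ! k"
    have yi: "std_simplex I y ?i = 0" using std_simplex_apply[OF I'(2,4) y k(1)] k(2) by simp
    have iI: "?i \<in> I" using s_I[of k] k(1) Suc_DIM[where 'v='v] by linarith
    have P: "std_simplex I y \<in> points" by (rule std_simplex_points[OF I'(1,4) y])
    have "blinfun_apply (cell_map centre (std_simplex I y)) x = height"
    proof (rule cell_map_const[OF P])
      \<comment> \<open>Faces with nonzero weight lie in the support of the point, which misses a
        vertex of \<open>I\<close>; being smaller than \<open>I\<close>, they have centres of the
        prescribed height.\<close>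
      fix Z assume Z: "Z \<in> K - {{}}" "bump Z (std_simplex I y) \<noteq> 0"
      have "Z \<subseteq> I - {?i}" using bump_support(1)[OF P Z] yi std_simplex_off[OF I'(2,4) y] by fastforce
      then have "card Z \<le> card (I - {?i})" using I'(2) by (intro card_mono) auto
      also have "\<dots> < DIM('v)" using card_Suc_Diff1[OF I'(2) iI] I'(3) by linarith
      finally show "blinfun_apply (centre Z) x = height" using centre(2) Z(1) by blast
    qed
    then show ?thesis by (simp add: height_def)
  qed
  show "blinfun_apply u (scaled_basis I j) \<noteq> blinfun_apply (vertex_at I) (scaled_basis I j)" if j: "j < DIM('v)" for j
    using u_ne[OF face_vertex[OF I'(1) s_I[OF j]]] coord_nonzero[OF I j]
    unfolding scaled_vertex[OF j] by (simp add: scaled_basis_def face_basis_def blinfun.scaleR_right)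
qed

lemma card_positive:
  assumes I: "I \<in> top_faces"
  shows "card {i \<in> I. blinfun_apply (dual_vec v I i) x > 0} = card {k. k < DIM('v) \<and> coord I k > 0}"
    and "k < DIM('v) \<Longrightarrow> dual_vec v I (sorted_list_of_set I ! k) = dual (face_basis I) k"
proof -
  let ?s = "\<lambda>k. sorted_list_of_set I ! k"
  note I' = top_face[OF I]
  have inj: "inj_on ?s {..<DIM('v)}" and img: "?s ` {..<DIM('v)} = I" using I'(5) by (auto simp: bij_betw_def)
  show dual: "dual_vec v I (?s k) = dual (face_basis I) k" if k: "k < DIM('v)" for k
  proof (rule dual_vec_eqI[OF I'(6)])
    fix j assume "j \<in> I"
    then obtain m where m: "m < DIM('v)" "j = ?s m" using img by auto
    have "(?s m = ?s k) = (m = k)" using inj_on_eq_iff[OF inj] m k by auto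
    then show "blinfun_apply (dual (face_basis I) k) (v j) = (if j = ?s k then 1 else 0)"
      using dual_apply[OF ordered_face_basis[OF I] m(1), of k] m(2) by (simp add: face_basis_def)
  qed
  have "{i \<in> I. blinfun_apply (dual_vec v I i) x > 0} = ?s ` {k. k < DIM('v) \<and> coord I k > 0}"
  proof (intro equalityI subsetI)
    fix i assume i: "i \<in> {i \<in> I. blinfun_apply (dual_vec v I i) x > 0}"
    then obtain k where k: "k < DIM('v)" "i = ?s k" using img by auto
    then have "coord I k > 0" using i dual[OF k(1)] by (simp add: coord_def)
    then show "i \<in> ?s ` {k. k < DIM('v) \<and> coord I k > 0}" using k by blast
  next
    fix i assume "i \<in> ?s ` {k. k < DIM('v) \<and> coord I k > 0}"
    then obtain k where k: "k < DIM('v)" "coord I k > 0" "i = ?s k" by blast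
    then show "i \<in> {i \<in> I. blinfun_apply (dual_vec v I i) x > 0}"
      using dual[OF k(1)] img by (auto simp: coord_def)
  qed
  then show "card {i \<in> I. blinfun_apply (dual_vec v I i) x > 0} = card {k. k < DIM('v) \<and> coord I k > 0}"
    using card_image[OF inj_on_subset[OF inj], of "{k. k < DIM('v) \<and> coord I k > 0}"] by auto
qed

text \<open>In the dual basis \<open>u - vertex_at I\<close> has its values at the
  \<open>v i\<close> as coordinates, so the cone is cut out by signs. The cone is closed, but
  equality would put \<open>u\<close> on a hyperplane, hence the strict inequalities.\<close>

lemma in_shifted_cone:
  assumes I: "I \<in> top_faces"
  shows "u \<in> shifted_cone F v x I \<longleftrightarrow> (\<forall>j<DIM('v). blinfun_apply (vertex_at I) (scaled_basis I j) < blinfun_apply u (scaled_basis I j))"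
proof -
  let ?s = "\<lambda>k. sorted_list_of_set I ! k"
  let ?g = "u - vertex_at I"
  note I' = top_face[OF I]
  have img: "?s ` {..<DIM('v)} = I" using I'(5) by (auto simp: bij_betw_def)
  have FI: "F_int F I = {f. \<forall>i\<in>I. blinfun_apply f (v i) = c i}"
    using F face_vertex[OF I'(1)] unfolding F_int_def by blast
  have apex: "apex F I = vertex_at I"
    unfolding apex_def
  proof (rule the_equality)
    show "vertex_at I \<in> F_int F I" unfolding FI using vertex_at[OF I'(1)] by blast
    fix f assume "f \<in> F_int F I"
    then show "f = vertex_at I" using vertex_at[OF I'(1)] unfolding FI
      by (intro blinfun_eq_spanning[OF I'(6)]) auto
  qed
  define \<xi> where "\<xi> i = blinfun_apply (dual_vec v I i) x" for i
  define D where "D = dual_vec_plus v x I"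
  have Dv: "blinfun_apply (dual_vec v I i) (v j) = (if j = i then 1 else 0)" if "j \<in> I" for i j
    by (rule dual_vec_apply[OF inj_v[OF I'(1)] independent_v[OF I'(1)] I'(6) that])
  have \<xi>s: "\<xi> (?s k) = coord I k" if "k < DIM('v)" for k
    unfolding \<xi>_def coord_def card_positive(2)[OF I that] ..
  have gx: "blinfun_apply ?g (scaled_basis I k) = \<xi> (?s k) * blinfun_apply ?g (v (?s k))" if "k < DIM('v)" for k
    using \<xi>s[OF that] by (simp add: scaled_basis_def face_basis_def blinfun.scaleR_right)
  have "u \<in> shifted_cone F v x I \<longleftrightarrow> ?g \<in> convex_cone hull (D ` I)"
    unfolding shifted_cone_def apex D_def by (auto simp: image_iff algebra_simps) (metis add_diff_cancel_left' diff_add_cancel add.commute)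
  also have "\<dots> \<longleftrightarrow> (\<forall>i\<in>I. 0 \<le> \<xi> i * blinfun_apply ?g (v i))"
  proof
    assume "?g \<in> convex_cone hull (D ` I)"
    moreover have "convex_cone hull (D ` I) \<subseteq> {f. \<forall>i\<in>I. 0 \<le> \<xi> i * blinfun_apply f (v i)}"
    proof (rule hull_minimal)
      show "D ` I \<subseteq> {f. \<forall>i\<in>I. 0 \<le> \<xi> i * blinfun_apply f (v i)}"
        by (auto simp: D_def dual_vec_plus_def \<xi>_def Dv blinfun.minus_left not_less)
      show "convex_cone {f. \<forall>i\<in>I. 0 \<le> \<xi> i * blinfun_apply f (v i)}"
        unfolding convex_cone_iff by (auto simp: blinfun.bilinear_simps distrib_left mult.left_commute)
    qed
    ultimately show "\<forall>i\<in>I. 0 \<le> \<xi> i * blinfun_apply ?g (v i)" by blast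
  next
    assume nn: "\<forall>i\<in>I. 0 \<le> \<xi> i * blinfun_apply ?g (v i)"
    \<comment> \<open>The coordinates of \<open>?g\<close> with respect to the sign-adjusted dual
      vectors.\<close>
    define t where "t i = (if 0 < \<xi> i then blinfun_apply ?g (v i) else - blinfun_apply ?g (v i))" for i
    have t0: "0 \<le> t i" if i: "i \<in> I" for i
    proof -
      obtain k where k: "k < DIM('v)" "i = ?s k" using img i by auto
      then have "\<xi> i \<noteq> 0" using \<xi>s coord_nonzero[OF I] by simp
      then show ?thesis using nn i by (auto simp: t_def zero_le_mult_iff)
    qed
    have "?g = (\<Sum>i\<in>I. t i *\<^sub>R D i)"
    proof (rule blinfun_eq_spanning[OF I'(6)])
      fix j assume j: "j \<in> I"
      have "blinfun_apply (\<Sum>i\<in>I. t i *\<^sub>R D i) (v j) = (\<Sum>i\<in>I. if i = j then blinfun_apply ?g (v j) else 0)"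
        unfolding blinfun.sum_left blinfun.scaleR_left using j
        by (intro sum.cong) (auto simp: t_def D_def dual_vec_plus_def \<xi>_def Dv blinfun.minus_left)
      then show "blinfun_apply ?g (v j) = blinfun_apply (\<Sum>i\<in>I. t i *\<^sub>R D i) (v j)" using j I'(2) by simp
    qed
    then show "?g \<in> convex_cone hull (D ` I)" using sum_scaleR_in_cone_hull[where g = D, OF I'(2) t0] by simp
  qed
  also have "\<dots> \<longleftrightarrow> (\<forall>k<DIM('v). 0 \<le> \<xi> (?s k) * blinfun_apply ?g (v (?s k)))"
    by (subst (1) img[symmetric]) auto
  also have "\<dots> \<longleftrightarrow> (\<forall>k<DIM('v). blinfun_apply (vertex_at I) (scaled_basis I k) < blinfun_apply u (scaled_basis I k))"
  proof -
    have "0 \<le> \<xi> (?s k) * blinfun_apply ?g (v (?s k)) \<longleftrightarrow> blinfun_apply (vertex_at I) (scaled_basis I k) < blinfun_apply u (scaled_basis I k)"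
      if k: "k < DIM('v)" for k
      using gx[OF k] corner.off[OF corner_face[OF I] k] by (simp add: blinfun.diff_left) linarith
    then show ?thesis by blast
  qed
  finally show ?thesis .
qed

text \<open>One factor -1 per index turns each positive sign into -1 and each negative one into
  1.\<close>

lemma prod_sgn:
  fixes a :: "nat \<Rightarrow> real"
  assumes "\<And>k. k < n \<Longrightarrow> a k \<noteq> 0"
  shows "(-1) ^ n * sgn (\<Prod>k<n. a k) = (-1) ^ card {k. k < n \<and> 0 < a k}"
  using assms
proof (induction n)
  case (Suc n)
  have "{k. k < Suc n \<and> 0 < a k} = (if 0 < a n then insert n {k. k < n \<and> 0 < a k} else {k. k < n \<and> 0 < a k})"
    by (auto simp: less_Suc_eq)
  then have "(-1) ^ card {k. k < Suc n \<and> 0 < a k} = ((-1) ^ card {k. k < n \<and> 0 < a k}) * (- sgn (a n))"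
    using Suc.prems[of n] by (auto simp: sgn_if)
  then show ?case using Suc by (simp add: sgn_mult algebra_simps)
qed simp

lemma homologous_face:
  assumes I: "I \<in> top_faces"
  shows "homologous_rel (DIM('v) - 1) (top_of_set (UNIV - {u})) {f. height \<le> blinfun_apply f x}
    (frag_cmul (orient I) (chain_map (DIM('v) - 1) (cell_map centre) (frag_of (std_simplex I))))
    (frag_cmul ((-1) ^ card {i \<in> I. blinfun_apply (dual_vec v I i) x > 0} * indicator (shifted_cone F v x I) u)
      (aff_bd DIM('v) (dual_simplex u e)))"
proof -
  let ?p = "DIM('v) - 1" and ?X = "top_of_set (UNIV - {u})" and ?H = "{f. height \<le> blinfun_apply f x}"
  interpret corner "scaled_basis I" x u "vertex_at I" "cell_map centre \<circ> std_simplex I" by (rule corner_face[OF I])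
  have simp: "chain_map ?p (cell_map centre) (frag_of (std_simplex I)) = frag_of (restrict (cell_map centre \<circ> std_simplex I) (standard_simplex ?p))"
    by (simp add: simplex_map_def)
  show ?thesis
  proof (cases "\<forall>j<DIM('v). blinfun_apply (vertex_at I) (scaled_basis I j) < blinfun_apply u (scaled_basis I j)")
    case True
    then have ind: "indicator (shifted_cone F v x I) u = (1 :: int)" using in_shifted_cone[OF I] by simp
    define \<sigma> :: int where "\<sigma> = (if det_wrt e reflected > 0 then 1 else -1)"
    have deta: "det_wrt e reflected \<noteq> 0" by (rule homologous_dual_simplex(1)[OF e reflected_basis])
    have "homologous_rel ?p ?X ?H (aff_bd DIM('v) (dual_simplex u reflected)) (frag_cmul \<sigma> (aff_bd DIM('v) (dual_simplex u e)))"
      unfolding \<sigma>_def by (rule homologous_rel_empty_imp[OF homologous_dual_simplex(2)[OF e reflected_basis]])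
    from homologous_rel_trans[OF homologous_rel_minus[OF this] homologous_inside[folded height_def]]
    have "homologous_rel ?p ?X ?H (frag_of (restrict (cell_map centre \<circ> std_simplex I) (standard_simplex ?p)))
      (- frag_cmul \<sigma> (aff_bd DIM('v) (dual_simplex u e)))" using True by blast
    from homologous_rel_cmul[OF this, of "orient I"]
    have hom: "homologous_rel ?p ?X ?H (frag_cmul (orient I) (frag_of (restrict (cell_map centre \<circ> std_simplex I) (standard_simplex ?p))))
      (frag_cmul (- (orient I * \<sigma>)) (aff_bd DIM('v) (dual_simplex u e)))" by simp
    \<comment> \<open>Sign tally: -1 from the horn, (-1)^(n - 1) from the reflection, the signs of
      the coordinates from the rescaling, and \<open>orient I\<close> twice. Together this is (-1)^n
      times the sign of the product of the coordinates, which is (-1)^I.\<close>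
    have "- (orient I * \<sigma>) = (-1) ^ card {i \<in> I. blinfun_apply (dual_vec v I i) x > 0}"
    proof -
      have xbv: "scaled_basis I = (\<lambda>k. coord I k *\<^sub>R face_basis I k)" by (simp add: scaled_basis_def[abs_def])
      have "det_wrt e reflected = (-1) ^ ?p * (2 * DIM('v) - 1) * det_wrt e (scaled_basis I)"
        unfolding reflected_def[abs_def] by (rule det_wrt_reflect[OF e x])
      also have "det_wrt e (scaled_basis I) = (\<Prod>k<DIM('v). coord I k) * det_wrt e (face_basis I)"
        unfolding xbv by (rule det_wrt_scale[OF e])
      finally have "sgn (det_wrt e reflected) = (-1) ^ ?p * sgn (\<Prod>k<DIM('v). coord I k) * sgn (det_wrt e (face_basis I))"
        using two_DIM_pos by (cases "even ?p") (simp_all add: sgn_mult sgn_minus)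
      moreover have "real_of_int \<sigma> = sgn (det_wrt e reflected)" using deta by (simp add: \<sigma>_def sgn_if)
      moreover have "sgn (det_wrt e (face_basis I)) * sgn (det_wrt e (face_basis I)) = 1"
        using homologous_dual_simplex(1)[OF e ordered_face_basis[OF I]] by (simp add: sgn_if)
      ultimately have "real_of_int (- (orient I * \<sigma>)) = - ((-1) ^ ?p * sgn (\<Prod>k<DIM('v). coord I k))"
        using orient_sgn[OF I] by (simp add: mult.left_commute mult.commute)
      also have "\<dots> = (-1) ^ DIM('v) * sgn (\<Prod>k<DIM('v). coord I k)"
        using Suc_DIM[where 'v='v] by (metis (no_types, lifting) mult_minus_left mult_minus1 power_Suc mult.assoc)
      also have "\<dots> = (-1) ^ card {k. k < DIM('v) \<and> 0 < coord I k}"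
        by (rule prod_sgn) (use coord_nonzero[OF I] in auto)
      finally have "real_of_int (- (orient I * \<sigma>)) = of_int ((-1) ^ card {i \<in> I. blinfun_apply (dual_vec v I i) x > 0})"
        unfolding card_positive(1)[OF I] by simp
      then show ?thesis by (simp only: of_int_eq_iff)
    qed
    with hom show ?thesis unfolding simp ind by simp
  next
    case False
    then have ind: "indicator (shifted_cone F v x I) u = (0 :: int)" using in_shifted_cone[OF I] by simp
    from False obtain j where j: "j < DIM('v)" "\<not> blinfun_apply (vertex_at I) (scaled_basis I j) < blinfun_apply u (scaled_basis I j)" by blast
    then have "blinfun_apply u (scaled_basis I j) < blinfun_apply (vertex_at I) (scaled_basis I j)" using off[OF j(1)] by linarith
    from homologous_rel_cmul[OF homologous_outside[OF j(1) this, folded height_def], of "orient I"]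
    show ?thesis unfolding simp ind by simp
  qed
qed

definition dh :: int
  where "dh = (\<Sum>I\<in>top_faces. (-1) ^ card {i \<in> I. blinfun_apply (dual_vec v I i) x > 0} * w I * indicator (shifted_cone F v x I) u)"

lemma homologous_fan_cycle:
  fixes \<Delta> :: "(nat set, 'v) multi_fan"
  assumes \<Delta>: "faces \<Delta> = K"
  shows "homologous_rel (DIM('v) - 1) (top_of_set (UNIV - {u})) {} (chain_map (DIM('v) - 1) (cell_map centre) fan_cycle)
    (frag_cmul dh (aff_bd DIM('v) (dual_simplex u e)))"
proof (rule homologous_rel_imp_homologous)
  let ?p = "DIM('v) - 1" and ?X = "top_of_set (UNIV - {u})" and ?H = "{f. height \<le> blinfun_apply f x}"
  let ?D = "aff_bd DIM('v) (dual_simplex u e)"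
  show "convex ?H"
  proof (rule convexI)
    fix f g and s t :: real assume fg: "f \<in> ?H" "g \<in> ?H" "0 \<le> s" "0 \<le> t" "s + t = 1"
    then have "s * height + t * height \<le> s * blinfun_apply f x + t * blinfun_apply g x"
      by (intro add_mono mult_left_mono) auto
    moreover have "s * height + t * height = height" using fg(5) by (metis distrib_right mult_1)
    ultimately show "s *\<^sub>R f + t *\<^sub>R g \<in> ?H" by (simp add: blinfun.bilinear_simps)
  qed
  have "0 < DIM('v)" by simp
  then have "1 \<le> real DIM('v)" by linarith
  then have "0 < 2 * real DIM('v) - 1" by linarith
  then have "0 < 1 / (2 * real DIM('v) - 1)" by simp
  then show "?H \<subseteq> UNIV - {u}" by (auto simp: height_def)
  show "singular_relcycle ?p ?X {} (chain_map ?p (cell_map centre) fan_cycle)"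
    by (rule singular_relcycle_chain_map[OF fan_cycle_cycle stratified_homologous(1)[OF \<Delta> stratified_cell_map[OF \<Delta>]]]) simp
  show "singular_relcycle ?p ?X {} (frag_cmul dh ?D)"
    by (rule singular_relcycle_cmul[OF aff_bd_cycle[OF e]])
  \<comment> \<open>In degree 0 both augmentations are 0, that of the fan cycle by
    balancing.\<close>
  show "chain_sum (chain_map ?p (cell_map centre) fan_cycle) = chain_sum (frag_cmul dh ?D)" if p: "?p = 0"
  proof -
    have "DIM('v) = 1" using p Suc_DIM[where 'v='v] by simp
    then show ?thesis using chain_sum_fan_cycle chain_sum_aff_bd_DIM[OF p] by (simp add: chain_sum_chain_map)
  qed
  have "chain_map ?p (cell_map centre) fan_cycle =
    (\<Sum>I\<in>top_faces. frag_cmul (w I) (frag_cmul (orient I) (chain_map ?p (cell_map centre) (frag_of (std_simplex I)))))"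
    unfolding fan_cycle_eq chain_map_sum[OF finite_top] by simp
  moreover have "frag_cmul dh ?D = (\<Sum>I\<in>top_faces. frag_cmul (w I)
      (frag_cmul ((-1) ^ card {i \<in> I. blinfun_apply (dual_vec v I i) x > 0} * indicator (shifted_cone F v x I) u) ?D))"
    unfolding dh_def frag_cmul_sum_left[OF finite_top] frag_cmul_cmul by (intro sum.cong refl arg_cong2[where f = frag_cmul]) simp
  ultimately show "homologous_rel ?p ?X ?H (chain_map ?p (cell_map centre) fan_cycle) (frag_cmul dh ?D)"
    by (simp only:) (intro homologous_rel_sum homologous_rel_cmul homologous_face finite_top finite_subset[OF _ finite_top]; blast)
qed

end

section \<open>The winding number\<close>

text \<open>The homology group is a quotient of a subgroup of the free abelian group on singular
  simplices; powers are computed there and pass down.\<close>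

lemma homologous_rel_set_int_pow:
  assumes c: "singular_relcycle p X S c"
  shows "homologous_rel_set p X S c [^]\<^bsub>relative_homology_group (int p) X S\<^esub> (k::int) =
    homologous_rel_set p X S (frag_cmul k c)"
proof -
  have "c \<in> carrier (subgroup_generated (free_Abelian_group (singular_simplex_set p X)) (singular_relcycle_set p X S))"
    using c by (metis carrier_relcycle_group chain_group_def mem_Collect_eq relcycle_group_def)
  moreover have "c \<in> carrier (free_Abelian_group (singular_simplex_set p X))"
    using c by (simp add: singular_relcycle_def singular_chain_def)
  ultimately have pow: "c [^]\<^bsub>relcycle_group p X S\<^esub> k = frag_cmul k c"
    by (simp add: relcycle_group_def chain_group_def group.int_pow_subgroup_generated)
  show ?thesis
    by (rule subst[OF right_coset_singular_relboundary])
      (simp add: pow normal.FactGroup_int_pow normal_subgroup_singular_relboundary_relcycle relative_homology_group_def c)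
qed

text \<open>The reduced group is a subgroup of the homology group and contains the class because
  \<open>hom_boundary\<close> maps into it, so powers may be taken in the full group.\<close>

lemma punctured_class_int_pow:
  fixes e :: "nat \<Rightarrow> 'v::euclidean_space" and u :: "'v \<Rightarrow>\<^sub>L real"
  assumes e: "ordered_basis e"
  shows "punctured_class e u [^]\<^bsub>reduced_homology_group (int (DIM('v) - 1)) (top_of_set (UNIV - {u}))\<^esub> (k::int) =
    homologous_rel_set (DIM('v) - 1) (top_of_set (UNIV - {u})) {} (frag_cmul k (aff_bd DIM('v) (dual_simplex u e)))"
proof -
  let ?p = "DIM('v) - 1" and ?X = "top_of_set (UNIV - {u})" and ?D = "aff_bd DIM('v) (dual_simplex u e)"
  let ?s = "frag_of (affine_simplex DIM('v) (dual_simplex u e))"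
  have "singular_chain DIM('v) euclidean ?s"
    unfolding frag_of_affine_simplex
    by (rule singular_chain_chain_map[OF singular_chain_id]) (use continuous_map_aff[of _ _ _ UNIV] in auto)
  moreover have "singular_chain ?p ?X ?D" using aff_bd_cycle[OF e] by (simp add: singular_cycle)
  ultimately have s: "singular_relcycle DIM('v) euclidean (UNIV - {u}) ?s"
    by (simp add: singular_relcycle)
  have cls: "fundamental_class e u = homologous_rel_set DIM('v) euclidean (UNIV - {u}) ?s"
    unfolding fundamental_class_def dual_simplex_def ..
  have eq: "punctured_class e u = homologous_rel_set ?p ?X {} ?D"
    unfolding punctured_class_def cls using hom_boundary_chain_boundary[OF s] by (simp add: Suc_leI)
  have "fundamental_class e u \<in> carrier (relative_homology_group (int DIM('v)) euclidean (UNIV - {u}))"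
    unfolding cls carrier_relative_homology_group using s by blast
  then have "punctured_class e u \<in> carrier (reduced_homology_group (int DIM('v) - 1) ?X)"
    unfolding punctured_class_def by (rule hom_in_carrier[OF hom_boundary_reduced_hom])
  moreover have "int DIM('v) - 1 = int ?p" by (simp add: of_nat_diff Suc_leI)
  ultimately have "punctured_class e u [^]\<^bsub>reduced_homology_group (int ?p) ?X\<^esub> k =
      punctured_class e u [^]\<^bsub>homology_group (int ?p) ?X\<^esub> k"
    unfolding reduced_homology_group_def
    by (intro group.int_pow_subgroup_generated) (simp_all del: of_nat_diff)
  then show ?thesis unfolding eq homologous_rel_set_int_pow[OF aff_bd_cycle[OF e]] .
qed

text \<open>\<open>WN\<close> describes the integer with the map quantified inside, so uniqueness
  needs every stratified map to give the same multiple, while existence uses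
  \<open>cell_map centre\<close>.\<close>

lemma (in polytope) WN_dh:
  fixes \<Delta> :: "(nat set, 'v) multi_fan"
  assumes \<Delta>: "faces \<Delta> = K" and cls: "fan_class \<Delta> e v = homologous_rel_set (DIM('v) - 1) (realization K) {} fan_cycle"
  shows "WN d \<Delta> F v e u = dh"
proof -
  let ?p = "DIM('v) - 1" and ?X = "top_of_set (UNIV - {u})" and ?D = "aff_bd DIM('v) (dual_simplex u e)"
  have iff: "hom_induced (int ?p) (realization (faces \<Delta>)) {} ?X {} \<Psi> (fan_class \<Delta> e v) =
      punctured_class e u [^]\<^bsub>reduced_homology_group (int ?p) ?X\<^esub> k \<longleftrightarrow> k = dh"
    if \<Psi>: "stratified_map d \<Delta> F \<Psi>" for \<Psi> and k :: int
  proof -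
    have "homologous_rel ?p ?X {} (chain_map ?p \<Psi> fan_cycle) (frag_cmul dh ?D)"
      by (rule homologous_rel_trans[OF homologous_fan_cycle[OF \<Delta>] stratified_homologous(2)[OF \<Delta> \<Psi>]])
    then have "hom_induced (int ?p) (realization (faces \<Delta>)) {} ?X {} \<Psi> (fan_class \<Delta> e v) =
        homologous_rel_set ?p ?X {} (frag_cmul dh ?D)"
      unfolding cls \<Delta> using hom_induced_chain_map[OF stratified_homologous(1)[OF \<Delta> \<Psi>] _ fan_cycle_cycle]
      by (simp add: homologous_rel_set_eq)
    moreover have "dh = k" if "homologous_rel ?p ?X {} (frag_cmul dh ?D) (frag_cmul k ?D)"
    proof -
      have "singular_relboundary ?p ?X {} (frag_cmul (dh - k) ?D)"
        using that unfolding homologous_rel_def frag_cmul_diff_distrib .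
      then show ?thesis using dual_simplex_infinite_order[OF e] by fastforce
    qed
    ultimately show ?thesis
      unfolding punctured_class_int_pow[OF e] homologous_rel_set_eq
      using homologous_rel_refl by fastforce
  qed
  show ?thesis
    unfolding WN_def
  proof (rule the_equality)
    show "\<exists>\<Psi>. stratified_map d \<Delta> F \<Psi> \<and> hom_induced (int ?p) (realization (faces \<Delta>)) {} ?X {} \<Psi> (fan_class \<Delta> e v) =
        punctured_class e u [^]\<^bsub>reduced_homology_group (int ?p) ?X\<^esub> dh"
      using stratified_cell_map[OF \<Delta>] iff by blast
  next
    fix k :: int assume "\<exists>\<Psi>. stratified_map d \<Delta> F \<Psi> \<and> hom_induced (int ?p) (realization (faces \<Delta>)) {} ?X {} \<Psi> (fan_class \<Delta> e v) =
        punctured_class e u [^]\<^bsub>reduced_homology_group (int ?p) ?X\<^esub> k"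
    then obtain \<Psi> where \<Psi>: "stratified_map d \<Delta> F \<Psi>" "hom_induced (int ?p) (realization (faces \<Delta>)) {} ?X {} \<Psi> (fan_class \<Delta> e v) =
        punctured_class e u [^]\<^bsub>reduced_homology_group (int ?p) ?X\<^esub> k" by blast
    then show "k = dh" using iff[OF \<Psi>(1)] by blast
  qed
qed

theorem theorem6p6:
  fixes \<Delta> :: "(nat set, 'v::euclidean_space) multi_fan"
    and F :: "nat set \<Rightarrow> ('v \<Rightarrow>\<^sub>L real) set"
    and d :: nat
    and v :: "nat \<Rightarrow> 'v"
    and x :: 'v
    and e :: "nat \<Rightarrow> 'v"
  assumes "simple_multi_polytope d \<Delta> F"
    and "\<forall>i\<in>{1..d}. v i \<in> fan_cone \<Delta> {i} \<and> v i \<noteq> 0"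
    and "generic \<Delta> x"
    and "ordered_basis e"
  shows "\<forall>u \<in> UNIV - (\<Union>i\<in>{1..d}. F {i}). DH \<Delta> F v x u = WN d \<Delta> F v e u"
proof
  fix u assume u: "u \<in> UNIV - (\<Union>i\<in>{1..d}. F {i})"
  note poly = assms(1) and v = assms(2)
  let ?K = "faces \<Delta>"
  obtain c where c: "\<And>i. i \<in> {1..d} \<Longrightarrow> F {i} = {f. blinfun_apply f (v i) = c i}"
    using polytope_hyperplanes[OF poly v] by metis
  have aug: "augmented_on d \<Delta>" using poly by (simp add: simple_multi_polytope_def)
  interpret polytope ?K d v "weight \<Delta>" c F e x u
  proof
    show "?K \<subseteq> Pow {1..d}" and "\<And>I J. I \<in> ?K \<Longrightarrow> J \<subseteq> I \<Longrightarrow> J \<in> ?K"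
      using aug by (auto simp: augmented_on_def)
    show "ordered_basis e" by (rule assms(4))
    show "inj_on v I" and "independent (v ` I)" if "I \<in> ?K" for I
      using fan_cone_generators(1,2)[OF poly v that] by simp_all
    show "(\<Sum>i | i \<notin> J \<and> insert i J \<in> ?K. of_int (weight \<Delta> (insert i J)) * sgn (h (v i))) = 0"
      if "J \<in> ?K" "Suc (card J) = DIM('v)" "linear h" "\<And>k. k \<in> J \<Longrightarrow> h (v k) = (0::real)" for J h
      by (rule polytope_balanced[OF poly v that])
    show "x \<notin> span (v ` I)" if I: "I \<in> ?K" "card I < DIM('v)" for I
    proof -
      have "dim (fan_cone \<Delta> I) < fan_dim \<Delta>" using I(2) polytope_faces_dim(1)[OF poly v I(1)] polytope_faces_dim(3)[OF poly v] by simp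
      then have "x \<notin> span (fan_cone \<Delta> I)" using assms(3) I(1) by (simp add: generic_def)
      then show ?thesis using fan_cone_generators(3)[OF poly v I(1)] by (simp add: span_convex_cone_hull)
    qed
    show "F {i} = {f. blinfun_apply f (v i) = c i}" if "i \<in> {1..d}" for i by (rule c[OF that])
    show "u \<notin> F {i}" if "i \<in> {1..d}" for i using u that by blast
  qed
  have top: "faces_dim \<Delta> (fan_dim \<Delta>) = top_faces" and dim: "fan_dim \<Delta> = DIM('v)"
    using polytope_faces_dim(2,3)[OF poly v] by (simp_all add: top_faces_def)
  have "WN d \<Delta> F v e u = dh"
    by (rule WN_dh) (simp_all add: fan_class_def fan_cycle_def top dim flip: dim)
  then show "DH \<Delta> F v x u = WN d \<Delta> F v e u" by (simp add: DH_def dh_def top)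
qed

end
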